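(* Let $m$ be fixed and let the $X_{i,j}$ ($1\leq j\leq m$, $1\leq i\leq n_j$) be i.i.d. with a common distribution satisfying condition $\mathcal{C}_2(\gamma,\rho,A)$ (stated in the context). Suppose that, as $n\to\infty$, $n_1/n_j\to b_j\in(0,\infty)$ and $k_1/k_j\to c_j\in(0,\infty)$ for any $j\in\{1,\ldots,m\}$, and that $k=\sum_{j=1}^mk_j\to\infty$ with $k/n\to0$ and $\sqrt{k}A(n/k)\to\lambda\in\mathbb{R}$, with $\lambda\neq0$. Let $\widetilde{\boldsymbol{\omega}}_n^{(\mathrm{Var})}=(k_1/k,\ldots,k_m/k)^\top$. Then $$\sqrt{k}(\widehat{\gamma}_n(\widetilde{\boldsymbol{\omega}}_n^{(\mathrm{Var})})-\gamma)\stackrel{d}{\longrightarrow}\mathcal{N}\left(\frac{\lambda}{1-\rho},\gamma^2\right)$$ if and only if $\rho=0$ or $k_j/n_j=(k/n)(1+\operatorname{o}(1))$ for any $j\in\{1,\ldots,m\}$. If moreover $k_j/n_j=(k/n)(1+\operatorname{O}(1/\sqrt{k}))$ for any $j$, then in fact $\sqrt{k}(\widehat{\gamma}_n(\widetilde{\boldsymbol{\omega}}_n^{(\mathrm{Var})})-\widehat{\gamma}_n^{(\mathrm{Hill})}(k))=\operatorname{o}_{\mathbb{P}}(1)$.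
   Context: Here $n_j=n_j(n)$, $n=\sum_{j=1}^mn_j$ is the total sample size, and $k_j=k_j(n)\geq1$ are integers. The common distribution function $F$ is continuous, with tail quantile function $U(t)=\inf\{x\in\mathbb{R}:1/(1-F(x))\geq t\}$. Condition $\mathcal{C}_2(\gamma,\rho,A)$: $\gamma>0$, $\rho\leq0$, $A$ has constant sign and converges to $0$ at infinity, and for all $x>0$, $\lim_{t\to\infty}\frac{1}{A(t)}\left[\frac{U(tx)}{U(t)}-x^\gamma\right]=x^\gamma\frac{x^\rho-1}{\rho}$ (read as $x^\gamma\log x$ if $\rho=0$). With $X_{1:n_j,j}\leq\cdots\leq X_{n_j:n_j,j}$ the order statistics of the $j$th subsample, $\widehat{\gamma}_j(k_j)=k_j^{-1}\sum_{i=1}^{k_j}\log(X_{n_j-i+1:n_j,j}/X_{n_j-k_j:n_j,j})$ and $\widehat{\gamma}_n(\boldsymbol{\omega})=\sum_{j=1}^m\omega_j\widehat{\gamma}_j(k_j)$. With $X_{1:n}\leq\cdots\leq X_{n:n}$ the order statistics of the combined sample $\{X_{i,j}:1\leq j\leq m,1\leq i\leq n_j\}$, the benchmark Hill estimator is $\widehat{\gamma}_n^{(\mathrm{Hill})}(k)=k^{-1}\sum_{i=1}^k\log(X_{n-i+1:n}/X_{n-k:n})$. *)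

theory Defs
  imports "HOL-Probability.Probability" "HOL-Library.Landau_Symbols"
begin

text \<open>
  The tail quantile function \<open>U(t) = inf {x. 1 / (1 - F x) \<ge> t}\<close>. The quotient is read as
  \<open>\<infinity>\<close> where \<open>F x = 1\<close>; HOL's convention \<open>1 / 0 = 0\<close> would drop those \<open>x\<close>.
\<close>

definition tail_quantile :: "(real \<Rightarrow> real) \<Rightarrow> real \<Rightarrow> real" where
  "tail_quantile F t = Inf {x. F x = 1 \<or> 1 / (1 - F x) \<ge> t}"

text \<open>
  The second-order regular variation condition. Constant sign of the auxiliary function is only
  required near infinity, which is where it matters and where the function need be meaningful.
\<close>

definition second_order_cond ::
    "real \<Rightarrow> real \<Rightarrow> (real \<Rightarrow> real) \<Rightarrow> (real \<Rightarrow> real) \<Rightarrow> bool" where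
  "second_order_cond \<gamma> \<rho> A U \<longleftrightarrow>
     \<gamma> > 0 \<and> \<rho> \<le> 0 \<and>
     ((\<forall>\<^sub>F t in at_top. A t > 0) \<or> (\<forall>\<^sub>F t in at_top. A t < 0)) \<and>
     (A \<longlongrightarrow> 0) at_top \<and>
     (\<forall>x>0. ((\<lambda>t. 1 / A t * (U (t * x) / U t - x powr \<gamma>)) \<longlongrightarrow>
        x powr \<gamma> * (if \<rho> = 0 then ln x else (x powr \<rho> - 1) / \<rho>)) at_top)"

text \<open>The \<open>i\<close>-th smallest value, with \<open>i\<close> counted from 1.\<close>

definition order_stat :: "real list \<Rightarrow> nat \<Rightarrow> real" where
  "order_stat xs i = sort xs ! (i - 1)"

text \<open>The Hill estimator; it is meaningful for \<open>1 \<le> k < length xs\<close>.\<close>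

definition hill :: "real list \<Rightarrow> nat \<Rightarrow> real" where
  "hill xs k =
     1 / real k * (\<Sum>i=1..k. ln (order_stat xs (length xs - i + 1) / order_stat xs (length xs - k)))"

text \<open>
  Observations are \<open>X i j\<close>: the \<open>i\<close>-th one on the \<open>j\<close>-th machine, both indices starting at 1.
  Subsample sizes and effective sample sizes are functions of \<open>j\<close>.
\<close>

definition subsample :: "(nat \<Rightarrow> nat \<Rightarrow> 'a \<Rightarrow> real) \<Rightarrow> (nat \<Rightarrow> nat) \<Rightarrow> nat \<Rightarrow> 'a \<Rightarrow> real list" where
  "subsample X N j \<omega> = map (\<lambda>i. X i j \<omega>) [1..<Suc (N j)]"

definition combined_sample ::
    "(nat \<Rightarrow> nat \<Rightarrow> 'a \<Rightarrow> real) \<Rightarrow> nat \<Rightarrow> (nat \<Rightarrow> nat) \<Rightarrow> 'a \<Rightarrow> real list" where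
  "combined_sample X m N \<omega> = concat (map (\<lambda>j. subsample X N j \<omega>) [1..<Suc m])"

definition pooled_hill ::
    "(nat \<Rightarrow> nat \<Rightarrow> 'a \<Rightarrow> real) \<Rightarrow> nat \<Rightarrow> (nat \<Rightarrow> nat) \<Rightarrow> (nat \<Rightarrow> nat) \<Rightarrow> (nat \<Rightarrow> real) \<Rightarrow> 'a \<Rightarrow> real" where
  "pooled_hill X m N K w \<omega> = (\<Sum>j=1..m. w j * hill (subsample X N j \<omega>) (K j))"

definition (in prob_space) conv_to_0_in_prob :: "(nat \<Rightarrow> 'a \<Rightarrow> real) \<Rightarrow> bool" where
  "conv_to_0_in_prob Y \<longleftrightarrow>
     (\<forall>\<epsilon>>0. (\<lambda>n. prob {\<omega> \<in> space M. \<bar>Y n \<omega>\<bar> > \<epsilon>}) \<longlonglongrightarrow> 0)"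

end

theory Submission
  imports Defs "HOL-Real_Asymp.Real_Asymp"
begin

text \<open>
  The variables \<open>W = - ln (1 - F X)\<close> are i.i.d. standard exponential and \<open>X = U (exp W)\<close> almost surely.
  With \<open>V w = ln (U (exp w))\<close> the second-order condition says that \<open>f w = V w - \<gamma> w\<close> has increments
  \<open>f (w + s) - f w \<sim> A (exp w) (exp (\<rho> s) - 1) / \<rho>\<close>, locally uniformly and with an exponential bound in \<open>s\<close>.
  Replacing the random threshold of the Hill estimator by \<open>u = ln (n / k)\<close> and inserting the
  Bahadur representation of that threshold gives, for every subsample as well as for the combined sample,
  \<open>sqrt k (Hill - \<gamma>) = \<gamma> / sqrt k \<Sum> (W - u - 1) 1{W > u} + sqrt k A (n / k) / (1 - \<rho>) + o\<^sub>P(1)\<close>.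
  The sums are centered and add up over the machines to an asymptotically standard normal term, while the
  bias of the pooled estimator tends to \<open>\<lambda> / (1 - \<rho>) \<Sum> p\<^sub>j (q\<^sub>j / p\<^sub>j) powr \<rho>\<close>, where \<open>p\<^sub>j\<close> and \<open>q\<^sub>j\<close> are the
  limits of \<open>k\<^sub>j / k\<close> and \<open>n\<^sub>j / n\<close>; by strict convexity the last sum is \<open>1\<close> only if \<open>\<rho> = 0\<close> or \<open>p = q\<close>.
  If \<open>p = q\<close>, moving the thresholds of the subsamples to the common one changes the sums by \<open>o\<^sub>P(sqrt k)\<close>.
\<close>

section \<open>Regular variation of second order\<close>

text \<open>The summand \<open>W - u - 1\<close> on \<open>W > u\<close> is centered at every level
  \<open>u\<close>, because the exponential law is memoryless. Hence machines with different
  thresholds add no bias through the exponential sums: their thresholds enter the limit mean only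
  through \<open>A (n_j / k_j)\<close>, and moving a threshold costs variance alone. The
  \<open>- 1\<close> comes from the empirical threshold, whose displacement is to first order the
  relative surplus of exceedances, to be subtracted once per exceedance.

  Two obstacles shape the work. The second-order condition is pointwise in \<open>x\<close>, while a
  random threshold and sums of unbounded excesses need it along sequences and with an integrable
  majorant; hence the uniform convergence theorem and the Potter-type bound. And the order
  statistics are dependent; sums over all observations above a deterministic level have independent
  terms, so second moments and characteristic functions suffice, without any representation of the
  joint law of the order statistics.\<close>

lemma measure_exceedance_tendsto_0:
  fixes d :: "nat \<Rightarrow> real \<Rightarrow> real"
  assumes [measurable]: "\<And>n. d n \<in> borel_measurable borel"
    and "\<And>y. (\<lambda>n. d n y) \<longlonglongrightarrow> 0" and "\<epsilon> > 0"
  shows "(\<lambda>n. measure lborel {y \<in> {p..q}. \<bar>d n y\<bar> > \<epsilon>}) \<longlonglongrightarrow> 0"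
proof -
  let ?S = "\<lambda>n. {y \<in> {p..q}. \<bar>d n y\<bar> > \<epsilon>}"
  have "(\<lambda>n. \<integral>y. (indicator (?S n) y :: real) \<partial>lborel) \<longlonglongrightarrow> (\<integral>y. 0 \<partial>(lborel :: real measure))"
  proof (rule integral_dominated_convergence[where w = "indicator {p..q}"])
    show "AE y in lborel. (\<lambda>n. indicator (?S n) y) \<longlonglongrightarrow> (0 :: real)"
    proof (intro AE_I2)
      fix y
      have "\<forall>\<^sub>F n in sequentially. \<bar>d n y\<bar> < \<epsilon>"
        using tendstoD[OF assms(2)[of y] \<open>\<epsilon> > 0\<close>] by (simp add: dist_norm)
      then have "\<forall>\<^sub>F n in sequentially. indicator (?S n) y = (0 :: real)"
        by eventually_elim (simp add: indicator_def)
      then show "(\<lambda>n. indicator (?S n) y) \<longlonglongrightarrow> (0 :: real)"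
        by (rule tendsto_eventually)
    qed
  qed (auto simp: indicator_def intro!: integrable_real_indicator emeasure_bounded_finite)
  then show ?thesis
    by simp
qed

text \<open>The measure-theoretic proof of the uniform convergence theorem. For any
  \<open>y\<close>, the increment over \<open>s n\<close> is the one over \<open>s n + y\<close>
  from \<open>x n\<close> minus the one over \<open>y\<close> from \<open>x n + s n\<close>. The
  pointwise limits are nearly attained for most \<open>y\<close> in the unit interval, so some
  \<open>y\<close>, depending on \<open>n\<close>, is good for both. Convergence of the ratios of
  \<open>a\<close> is a hypothesis because the lemma serves first for the logarithm of the auxiliary
  function and only then for \<open>f\<close> itself.\<close>

lemma regular_variation_uniform_seq:
  fixes f a h r :: "real \<Rightarrow> real"
  assumes [measurable]: "f \<in> borel_measurable borel"
    and h: "continuous_on UNIV h" and r: "continuous_on UNIV r"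
    and cocycle: "\<And>s y. h (s + y) = h s + r s * h y"
    and nz: "\<forall>\<^sub>F w in at_top. a w \<noteq> 0"
    and lim: "\<And>s. ((\<lambda>w. (f (w + s) - f w) / a w) \<longlongrightarrow> h s) at_top"
    and ratio: "(\<lambda>n. a (x n + s n) / a (x n)) \<longlonglongrightarrow> r l"
    and x: "filterlim x at_top sequentially" and s: "s \<longlonglongrightarrow> l"
  shows "(\<lambda>n. (f (x n + s n) - f (x n)) / a (x n)) \<longlonglongrightarrow> h l"
proof -
  have [measurable]: "h \<in> borel_measurable borel"
    using h by (rule borel_measurable_continuous_onI)
  define z where "z = (\<lambda>n. x n + s n)"
  have z: "filterlim z at_top sequentially"
    unfolding z_def using filterlim_tendsto_add_at_top[OF s x] by (simp add: add.commute)
  define d where "d n y = (f (x n + y) - f (x n)) / a (x n) - h y" for n y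
  define d' where "d' n y = (f (z n + y) - f (z n)) / a (z n) - h y" for n y
  have [measurable]: "d n \<in> borel_measurable borel" "d' n \<in> borel_measurable borel" for n
    unfolding d_def d'_def by measurable
  have d: "(\<lambda>n. d n y) \<longlonglongrightarrow> 0" and d': "(\<lambda>n. d' n y) \<longlonglongrightarrow> 0" for y
    unfolding d_def d'_def
    using filterlim_compose[OF lim[of y] x] filterlim_compose[OF lim[of y] z]
    by (auto simp: LIM_zero_iff)
  have hr: "isCont h y" "isCont r y" for y
    using h r by (auto simp: continuous_on_eq_continuous_at)
  have hs: "(\<lambda>n. h (s n)) \<longlonglongrightarrow> h l" and rs: "(\<lambda>n. r (s n)) \<longlonglongrightarrow> r l"
    using isCont_tendsto_compose[OF hr(1) s] isCont_tendsto_compose[OF hr(2) s] .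
  define q where "q = (\<lambda>n. a (z n) / a (x n))"
  have q: "q \<longlonglongrightarrow> r l"
    using ratio by (simp add: q_def z_def)
  obtain B where B: "\<And>y. y \<in> {0..1} \<Longrightarrow> \<bar>h y\<bar> \<le> B"
  proof -
    have "compact (h ` {0..1})"
      by (intro compact_continuous_image continuous_on_subset[OF h]) auto
    then have "bounded (h ` {0..1})"
      by (rule compact_imp_bounded)
    then show ?thesis
      using that unfolding bounded_iff by (metis imageI real_norm_def)
  qed
  then have B0: "B \<ge> 0"
    by (meson abs_ge_zero atLeastAtMost_iff order.refl order.trans zero_le_one)
  have nzx: "\<forall>\<^sub>F n in sequentially. a (x n) \<noteq> 0" and nzz: "\<forall>\<^sub>F n in sequentially. a (z n) \<noteq> 0"
    using nz x z by (auto intro: eventually_compose_filterlim)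
  have key: "\<forall>\<^sub>F n in sequentially. \<bar>(f (x n + s n) - f (x n)) / a (x n) - h (s n)\<bar>
      \<le> \<epsilon> + \<bar>r (s n) - q n\<bar> * B + \<bar>q n\<bar> * \<epsilon>" if "\<epsilon> > 0" for \<epsilon>
  proof -
    \<comment> \<open>The interval contains \<open>s n + y\<close> whenever \<open>s n\<close> is
      within 1 of \<open>l\<close> and \<open>y\<close> is in the unit interval.\<close>
    let ?E = "\<lambda>n. {y \<in> {l - 1..l + 2}. \<bar>d n y\<bar> > \<epsilon>}"
    let ?E' = "\<lambda>n. {y \<in> {0..1}. \<bar>d' n y\<bar> > \<epsilon>}"
    have "\<forall>\<^sub>F n in sequentially. measure lborel (?E n) < 1 / 4"
      by (rule order_tendstoD[OF measure_exceedance_tendsto_0[OF _ d that]]) auto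
    moreover have "\<forall>\<^sub>F n in sequentially. measure lborel (?E' n) < 1 / 4"
      by (rule order_tendstoD[OF measure_exceedance_tendsto_0[OF _ d' that]]) auto
    moreover have "\<forall>\<^sub>F n in sequentially. dist (s n) l < 1"
      by (rule tendstoD[OF s]) auto
    ultimately show ?thesis
      using nzx nzz
    proof eventually_elim
      case (elim n)
      have E: "?E n \<in> sets lborel" "?E' n \<in> sets lborel"
        by measurable
      have fm: "?E n \<in> fmeasurable lborel" "?E' n \<in> fmeasurable lborel"
        by (rule fmeasurableI, use E in simp, rule emeasure_bounded_finite,
            rule bounded_subset[OF bounded_closed_interval], blast)+
      have T: "(\<lambda>y. s n + y) -` ?E n \<in> sets lborel"
        using measurable_sets[of "(\<lambda>y. s n + y)" borel borel "?E n"] E by auto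
      have tr: "emeasure lborel ((\<lambda>y. s n + y) -` ?E n) = emeasure lborel (?E n)"
      proof -
        have "emeasure lborel (?E n) = emeasure (distr lborel borel ((+) (s n))) (?E n)"
          by (simp add: lborel_distr_plus)
        also have "\<dots> = emeasure lborel ((+) (s n) -` ?E n \<inter> space lborel)"
          by (rule emeasure_distr) (use E in auto)
        finally show ?thesis
          by simp
      qed
      \<comment> \<open>Each exceptional set has measure below 1/4, and translation by
        \<open>s n\<close> preserves it, so together they cannot cover an interval of length
        1.\<close>
      have "\<exists>y\<in>{0..1}. s n + y \<notin> ?E n \<and> y \<notin> ?E' n"
      proof (rule ccontr)
        assume "\<not> ?thesis"
        then have "{0..1} \<subseteq> (\<lambda>y. s n + y) -` ?E n \<union> ?E' n"
          by auto
        then have "emeasure lborel {0..1::real} \<le> emeasure lborel ((\<lambda>y. s n + y) -` ?E n \<union> ?E' n)"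
          using E T by (intro emeasure_mono) auto
        also have "\<dots> \<le> emeasure lborel ((\<lambda>y. s n + y) -` ?E n) + emeasure lborel (?E' n)"
          using E T by (intro emeasure_subadditive) auto
        also have "\<dots> = ennreal (measure lborel (?E n)) + ennreal (measure lborel (?E' n))"
          unfolding tr using fm by (simp add: emeasure_eq_measure2)
        also have "\<dots> = ennreal (measure lborel (?E n) + measure lborel (?E' n))"
          by simp
        also have "\<dots> < ennreal 1"
          using elim by (intro ennreal_lessI) auto
        finally show False
          by simp
      qed
      then obtain y where y: "y \<in> {0..1}" "s n + y \<notin> ?E n" "y \<notin> ?E' n"
        by blast
      moreover have "s n + y \<in> {l - 1..l + 2}"
        using elim(3) y(1) by (auto simp: dist_real_def)
      ultimately have dd: "\<bar>d n (s n + y)\<bar> \<le> \<epsilon>" "\<bar>d' n y\<bar> \<le> \<epsilon>"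
        by auto
      have "(f (x n + s n) - f (x n)) / a (x n)
          = (d n (s n + y) + h (s n + y)) - q n * (d' n y + h y)"
        using elim(4,5) by (simp add: d_def d'_def q_def z_def field_simps)
      \<comment> \<open>The cocycle identity leaves only \<open>(r (s n) - q n) * h y\<close> of the
        limit terms; it vanishes because \<open>q n\<close> and \<open>r (s n)\<close> have the same
        limit.\<close>
      also have "\<dots> - h (s n) = d n (s n + y) + (r (s n) - q n) * h y - q n * d' n y"
        unfolding cocycle[of "s n" y] by (simp only: algebra_simps)
      also have "\<bar>\<dots>\<bar> \<le> \<bar>d n (s n + y)\<bar> + \<bar>r (s n) - q n\<bar> * \<bar>h y\<bar> + \<bar>q n\<bar> * \<bar>d' n y\<bar>"
        by (simp add: abs_mult[symmetric])
      also have "\<dots> \<le> \<epsilon> + \<bar>r (s n) - q n\<bar> * B + \<bar>q n\<bar> * \<epsilon>"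
        using dd B[OF y(1)] by (intro add_mono mult_left_mono) auto
      finally show ?case .
    qed
  qed
  have "(\<lambda>n. (f (x n + s n) - f (x n)) / a (x n) - h (s n)) \<longlonglongrightarrow> 0"
  proof (rule tendstoI)
    fix e :: real assume e: "e > 0"
    define \<epsilon> where "\<epsilon> = e / (2 * (2 + \<bar>r l\<bar>))"
    have \<epsilon>: "\<epsilon> > 0"
      using e by (simp add: \<epsilon>_def add_pos_nonneg)
    have "(\<lambda>n. \<epsilon> + \<bar>r (s n) - q n\<bar> * B + \<bar>q n\<bar> * \<epsilon>) \<longlonglongrightarrow> \<epsilon> + \<bar>r l - r l\<bar> * B + \<bar>r l\<bar> * \<epsilon>"
      by (intro tendsto_intros rs q)
    moreover have "\<epsilon> + \<bar>r l - r l\<bar> * B + \<bar>r l\<bar> * \<epsilon> < e"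
    proof -
      have "\<epsilon> + \<bar>r l\<bar> * \<epsilon> < \<epsilon> * (2 + \<bar>r l\<bar>)"
        using \<epsilon> by (simp add: algebra_simps)
      also have "\<dots> = e / 2"
        unfolding \<epsilon>_def by (simp add: field_simps add_nonneg_eq_0_iff)
      finally show ?thesis
        using e by simp
    qed
    ultimately have "\<forall>\<^sub>F n in sequentially. \<epsilon> + \<bar>r (s n) - q n\<bar> * B + \<bar>q n\<bar> * \<epsilon> < e"
      by (rule order_tendstoD(2))
    then show "\<forall>\<^sub>F n in sequentially. dist ((f (x n + s n) - f (x n)) / a (x n) - h (s n)) 0 < e"
      using key[OF \<epsilon>] by eventually_elim simp
  qed
  from tendsto_add[OF this hs] show ?thesis
    by simp
qed

text \<open>A failure of uniformity would produce bad pairs \<open>(x n, s n)\<close> with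
  \<open>x n\<close> unbounded; along a convergent subsequence of \<open>s\<close> they contradict
  the hypothesis.\<close>

lemma uniform_on_compact_of_seq:
  fixes d :: "real \<Rightarrow> real \<Rightarrow> real"
  assumes seq: "\<And>x s l. filterlim x at_top sequentially \<Longrightarrow> s \<longlonglongrightarrow> l \<Longrightarrow> (\<lambda>n. d (x n) (s n)) \<longlonglongrightarrow> 0"
    and "\<epsilon> > 0"
  shows "\<forall>\<^sub>F w in at_top. \<forall>s\<in>{p..q}. \<bar>d w s\<bar> \<le> \<epsilon>"
proof (rule ccontr)
  assume "\<not> ?thesis"
  then have "\<forall>n::nat. \<exists>w\<ge>real n. \<exists>s\<in>{p..q}. \<bar>d w s\<bar> > \<epsilon>"
    unfolding eventually_at_top_linorder by (meson not_le)
  then obtain x s where x: "\<And>n::nat. x n \<ge> real n" and s: "\<And>n. s n \<in> {p..q}"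
    and big: "\<And>n. \<bar>d (x n) (s n)\<bar> > \<epsilon>"
    by metis
  have xlim: "filterlim x at_top sequentially"
    by (rule filterlim_at_top_mono[OF filterlim_real_sequentially]) (use x in auto)
  obtain l \<sigma> where \<sigma>: "strict_mono (\<sigma> :: nat \<Rightarrow> nat)" and l: "(s \<circ> \<sigma>) \<longlonglongrightarrow> l"
    using compact_Icc[of p q] s unfolding compact_def by metis
  have "(\<lambda>n. d ((x \<circ> \<sigma>) n) ((s \<circ> \<sigma>) n)) \<longlonglongrightarrow> 0"
    by (rule seq[OF _ l]) (use filterlim_compose[OF xlim filterlim_subseq[OF \<sigma>]] in \<open>simp add: o_def\<close>)
  from tendstoD[OF this \<open>\<epsilon> > 0\<close>] have "\<forall>\<^sub>F n in sequentially. False"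
    by eventually_elim (use big in \<open>force simp: dist_norm dest: less_asym\<close>)
  then show False
    by simp
qed


text \<open>The Box-Cox transform at \<open>exp s\<close>: the limit function of the second-order
  condition after the substitution \<open>x = exp s\<close> and division by
  \<open>x powr \<gamma>\<close>.\<close>

definition box_cox :: "real \<Rightarrow> real \<Rightarrow> real" where
  "box_cox \<rho> s = (if \<rho> = 0 then s else (exp (\<rho> * s) - 1) / \<rho>)"

lemma box_cox_add:
  "box_cox \<rho> (s + y) = box_cox \<rho> s + exp (\<rho> * s) * box_cox \<rho> y"
  by (simp add: box_cox_def field_simps exp_add)

lemma box_cox_0 [simp]: "box_cox \<rho> 0 = 0"
  by (simp add: box_cox_def)

lemma continuous_box_cox: "continuous_on UNIV (box_cox \<rho>)"
  unfolding box_cox_def by (cases "\<rho> = 0") (auto intro!: continuous_intros)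

lemma box_cox_bounds:
  assumes "\<rho> \<le> 0" "s \<ge> 0"
  shows "0 \<le> box_cox \<rho> s" "box_cox \<rho> s \<le> s"
proof -
  have "\<rho> * s \<le> 0"
    using assms by (simp add: mult_nonpos_nonneg)
  then have "exp (\<rho> * s) \<le> 1" "1 + \<rho> * s \<le> exp (\<rho> * s)"
    by (auto intro: exp_ge_add_one_self)
  then show "0 \<le> box_cox \<rho> s" "box_cox \<rho> s \<le> s"
    using assms by (auto simp: box_cox_def field_simps)
qed

lemma box_cox_pos:
  assumes "\<rho> \<le> 0" "s > 0"
  shows "0 < box_cox \<rho> s"
proof (cases "\<rho> = 0")
  case False
  with assms have "\<rho> * s < 0"
    by (simp add: mult_neg_pos)
  then show ?thesis
    using False assms by (simp add: box_cox_def zero_less_divide_iff)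
qed (use assms in \<open>simp add: box_cox_def\<close>)

text \<open>Second-order regular variation in additive notation. It will be used with
  \<open>f w = ln (U (exp w)) - \<gamma> * w\<close> and \<open>a w = A (exp w)\<close>.\<close>

locale second_order_variation =
  fixes f a :: "real \<Rightarrow> real" and \<rho> :: real
  assumes f_measurable [measurable]: "f \<in> borel_measurable borel"
    and a_sign: "(\<forall>\<^sub>F w in at_top. a w > 0) \<or> (\<forall>\<^sub>F w in at_top. a w < 0)"
    and rho_nonpos: "\<rho> \<le> 0"
    and increment: "\<And>s. ((\<lambda>w. (f (w + s) - f w) / a w) \<longlongrightarrow> box_cox \<rho> s) at_top"
begin

lemma a_nonzero: "\<forall>\<^sub>F w in at_top. a w \<noteq> 0"
  using a_sign by (auto elim: eventually_mono)

lemma shift_at_top: "filterlim (\<lambda>w. w + s) at_top (at_top :: real filter)"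
  using filterlim_tendsto_add_at_top[OF tendsto_const[of s] filterlim_ident] by (simp add: add.commute)

text \<open>The increment of \<open>f\<close> from \<open>w + s\<close> to \<open>w + s + 1\<close>
  has the limit \<open>box_cox \<rho> 1\<close> after division by \<open>a (w + s)\<close> and
  \<open>exp (\<rho> * s) * box_cox \<rho> 1\<close> after division by \<open>a w\<close>. The ratio
  of \<open>a\<close> is the quotient of the two.\<close>

lemma a_ratio: "((\<lambda>w. a (w + s) / a w) \<longlongrightarrow> exp (\<rho> * s)) at_top"
proof -
  let ?h = "box_cox \<rho>"
  have h1: "?h 1 > 0"
    using rho_nonpos by (simp add: box_cox_pos)
  have 1: "((\<lambda>w. (f (w + s + 1) - f (w + s)) / a (w + s)) \<longlongrightarrow> ?h 1) at_top"
    using filterlim_compose[OF increment[of 1] shift_at_top[of s]] .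
  have "((\<lambda>w. (f (w + (s + 1)) - f w) / a w - (f (w + s) - f w) / a w) \<longlongrightarrow> ?h (s + 1) - ?h s) at_top"
    by (intro tendsto_diff increment)
  then have 2: "((\<lambda>w. (f (w + s + 1) - f (w + s)) / a w) \<longlongrightarrow> exp (\<rho> * s) * ?h 1) at_top"
    by (simp add: box_cox_add diff_divide_distrib[symmetric] add.assoc)
  have quot: "D / p / (D / q) = q / p" if "0 < D / q" for D p q :: real
    using that by (auto simp: zero_less_divide_iff)
  have "((\<lambda>w. ((f (w + s + 1) - f (w + s)) / a w) / ((f (w + s + 1) - f (w + s)) / a (w + s)))
      \<longlongrightarrow> exp (\<rho> * s) * ?h 1 / ?h 1) at_top"
    using h1 by (intro tendsto_divide 1 2) auto
  moreover have "\<forall>\<^sub>F w in at_top. ((f (w + s + 1) - f (w + s)) / a w) / ((f (w + s + 1) - f (w + s)) / a (w + s))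
      = a (w + s) / a w"
    using order_tendstoD(1)[OF 1 h1]
    by eventually_elim (rule quot, auto)
  ultimately have "((\<lambda>w. a (w + s) / a w) \<longlongrightarrow> exp (\<rho> * s) * ?h 1 / ?h 1) at_top"
    by (rule Lim_transform_eventually)
  then show ?thesis
    using h1 by simp
qed

text \<open>
  The auxiliary function need not be measurable; the increments of \<open>f\<close> provide a measurable
  function asymptotic to it.
\<close>

lemma a_ratio_seq:
  assumes x: "filterlim x at_top sequentially" and s: "s \<longlonglongrightarrow> l"
  shows "(\<lambda>n. a (x n + s n) / a (x n)) \<longlonglongrightarrow> exp (\<rho> * l)"
proof -
  let ?h1 = "box_cox \<rho> 1"
  have h1: "?h1 > 0"
    using rho_nonpos by (simp add: box_cox_pos)
  define b where "b = (\<lambda>w. (f (w + 1) - f w) / ?h1)"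
  have [measurable]: "b \<in> borel_measurable borel"
    unfolding b_def by measurable
  have ba: "((\<lambda>w. b w / a w) \<longlongrightarrow> 1) at_top"
    using tendsto_divide[OF increment[of 1] tendsto_const[of ?h1]] h1
    by (simp add: b_def field_simps)
  have ba_pos: "\<forall>\<^sub>F w in at_top. b w / a w > 0"
    by (rule order_tendstoD(1)[OF ba]) auto
  have b_ratio: "((\<lambda>w. b (w + s) / b w) \<longlongrightarrow> exp (\<rho> * s)) at_top" for s
  proof -
    have "((\<lambda>w. (b (w + s) / a (w + s)) * (a (w + s) / a w) / (b w / a w)) \<longlongrightarrow> 1 * exp (\<rho> * s) / 1) at_top"
      by (intro tendsto_intros a_ratio ba filterlim_compose[OF ba shift_at_top]) auto
    moreover have "\<forall>\<^sub>F w in at_top. (b (w + s) / a (w + s)) * (a (w + s) / a w) / (b w / a w) = b (w + s) / b w"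
      using ba_pos a_nonzero eventually_compose_filterlim[OF a_nonzero shift_at_top[of s]]
      by eventually_elim (auto simp: field_simps)
    ultimately have "((\<lambda>w. b (w + s) / b w) \<longlongrightarrow> 1 * exp (\<rho> * s) / 1) at_top"
      by (rule Lim_transform_eventually)
    then show ?thesis
      by simp
  qed
  \<comment> \<open>The logarithm turns ratios of \<open>b\<close> into increments with the linear
    limit \<open>\<rho> * s\<close>, to which the uniform convergence theorem applies with
    \<open>a\<close> and \<open>r\<close> constantly 1.\<close>
  define g where "g = (\<lambda>w. ln \<bar>b w\<bar>)"
  have g: "(\<lambda>n. (g (x n + s n) - g (x n)) / 1) \<longlonglongrightarrow> \<rho> * l"
  proof (rule regular_variation_uniform_seq[where r = "\<lambda>_. 1" and a = "\<lambda>_. 1", OF _ _ _ _ _ _ _ x s])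
    show "g \<in> borel_measurable borel"
      unfolding g_def by measurable
    show "((\<lambda>w. (g (w + s) - g w) / 1) \<longlongrightarrow> \<rho> * s) at_top" for s
    proof -
      have "((\<lambda>w. ln (b (w + s) / b w)) \<longlongrightarrow> ln (exp (\<rho> * s))) at_top"
        by (intro tendsto_ln b_ratio) auto
      moreover have "\<forall>\<^sub>F w in at_top. ln (b (w + s) / b w) = (g (w + s) - g w) / 1"
        using order_tendstoD(1)[OF b_ratio, of 0 s, simplified]
      proof eventually_elim
        case (elim w)
        then have "b (w + s) / b w = \<bar>b (w + s)\<bar> / \<bar>b w\<bar>" "b w \<noteq> 0" "b (w + s) \<noteq> 0"
          by (auto simp: zero_less_divide_iff)
        then show ?case
          by (simp add: g_def ln_div)
      qed
      ultimately show ?thesis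
        by (simp add: filterlim_cong)
    qed
  qed (auto intro!: continuous_intros simp: algebra_simps)
  have z: "filterlim (\<lambda>n. x n + s n) at_top sequentially"
    using filterlim_tendsto_add_at_top[OF s x] by (simp add: add.commute)
  have "(\<lambda>n. exp (g (x n + s n) - g (x n))) \<longlonglongrightarrow> exp (\<rho> * l)"
    using tendsto_exp[OF g] by (simp only: div_by_1)
  then have "(\<lambda>n. exp (g (x n + s n) - g (x n)) * (b (x n) / a (x n)) / (b (x n + s n) / a (x n + s n)))
      \<longlonglongrightarrow> exp (\<rho> * l) * 1 / 1"
    by (intro tendsto_divide tendsto_mult filterlim_compose[OF ba x] filterlim_compose[OF ba z]) auto
  moreover have "\<forall>\<^sub>F n in sequentially. exp (g (x n + s n) - g (x n)) * (b (x n) / a (x n)) / (b (x n + s n) / a (x n + s n))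
      = a (x n + s n) / a (x n)"
  proof -
    \<comment> \<open>The absolute value inside \<open>g\<close> is undone by the constant sign of
      \<open>a\<close>, which \<open>b\<close> shares because \<open>b / a\<close> tends to
      1.\<close>
    have "\<forall>\<^sub>F n in sequentially. a (x n + s n) / a (x n) > 0"
      using a_sign eventually_compose_filterlim[OF _ x] eventually_compose_filterlim[OF _ z]
      by (elim disjE) (fastforce elim: eventually_elim2 simp: zero_less_divide_iff)+
    with eventually_compose_filterlim[OF ba_pos x] eventually_compose_filterlim[OF ba_pos z]
    show ?thesis
      by eventually_elim (auto simp: g_def exp_diff zero_less_divide_iff)
  qed
  ultimately have "(\<lambda>n. a (x n + s n) / a (x n)) \<longlonglongrightarrow> exp (\<rho> * l) * 1 / 1"
    by (rule Lim_transform_eventually)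
  then show ?thesis
    by simp
qed

lemma increment_seq:
  assumes "filterlim x at_top sequentially" and "s \<longlonglongrightarrow> l"
  shows "(\<lambda>n. (f (x n + s n) - f (x n)) / a (x n)) \<longlonglongrightarrow> box_cox \<rho> l"
  by (rule regular_variation_uniform_seq[where r = "\<lambda>s. exp (\<rho> * s)"])
     (use assms a_nonzero increment a_ratio_seq in
       \<open>auto intro!: continuous_intros continuous_box_cox simp: box_cox_add\<close>)

lemma increment_uniform:
  assumes "\<epsilon> > 0"
  shows "\<forall>\<^sub>F w in at_top. \<forall>s\<in>{p..q}. \<bar>(f (w + s) - f w) / a w - box_cox \<rho> s\<bar> \<le> \<epsilon>"
proof (rule uniform_on_compact_of_seq[OF _ assms])
  fix x s :: "nat \<Rightarrow> real" and l
  assume x: "filterlim x at_top sequentially" and s: "s \<longlonglongrightarrow> l"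
  have "isCont (box_cox \<rho>) l"
    using continuous_box_cox by (simp add: continuous_on_eq_continuous_at)
  from tendsto_diff[OF increment_seq[OF x s] isCont_tendsto_compose[OF this s]]
  show "(\<lambda>n. (f (x n + s n) - f (x n)) / a (x n) - box_cox \<rho> (s n)) \<longlonglongrightarrow> 0"
    by simp
qed

text \<open>Chaining of unit steps: \<open>\<bar>a\<bar>\<close> grows by a factor of at most
  \<open>exp (1 / 8)\<close> per step, since its limiting factor is
  \<open>exp \<rho> \<le> 1\<close>, and each step contributes at most
  \<open>2 * \<bar>a\<bar>\<close>. The rate 1/8 is an arbitrary slack below the rate 1/4 of the
  next bound, which then absorbs the linear factor.\<close>

lemma increment_exp_bound:
  "\<forall>\<^sub>F w in at_top. \<forall>s\<ge>0. \<bar>f (w + s) - f w\<bar> \<le> 2 * \<bar>a w\<bar> * ((s + 1) * exp (s / 8))"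
proof -
  have "\<forall>\<^sub>F w in at_top. \<bar>a (w + 1) / a w\<bar> < exp (1 / 8)"
    by (rule order_tendstoD[OF tendsto_rabs[OF a_ratio]]) (use rho_nonpos in auto)
  with a_nonzero increment_uniform[OF zero_less_one, of 0 1]
  have "\<forall>\<^sub>F w in at_top. (\<forall>s\<in>{0..1}. \<bar>f (w + s) - f w\<bar> \<le> 2 * \<bar>a w\<bar>) \<and> \<bar>a (w + 1)\<bar> \<le> exp (1 / 8) * \<bar>a w\<bar>"
  proof (eventually_elim, safe)
    fix w s :: real
    assume nz: "a w \<noteq> 0" and s: "s \<in> {0..1}"
      and *: "\<forall>s\<in>{0..1}. \<bar>(f (w + s) - f w) / a w - box_cox \<rho> s\<bar> \<le> 1"
    have "\<bar>(f (w + s) - f w) / a w\<bar> \<le> 1 + box_cox \<rho> s"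
      using *[rule_format, OF s] box_cox_bounds(1)[OF rho_nonpos, of s] s by auto
    also have "\<dots> \<le> 2"
      using box_cox_bounds(2)[OF rho_nonpos, of s] s by auto
    finally show "\<bar>f (w + s) - f w\<bar> \<le> 2 * \<bar>a w\<bar>"
      using nz by (simp add: abs_divide field_simps)
  qed (auto simp: abs_divide field_simps)
  then obtain w0 where unit: "\<And>w s. w \<ge> w0 \<Longrightarrow> s \<in> {0..1} \<Longrightarrow> \<bar>f (w + s) - f w\<bar> \<le> 2 * \<bar>a w\<bar>"
    and step: "\<And>w. w \<ge> w0 \<Longrightarrow> \<bar>a (w + 1)\<bar> \<le> exp (1 / 8) * \<bar>a w\<bar>"
    unfolding eventually_at_top_linorder by blast
  have "\<forall>w\<ge>w0. \<forall>s\<in>{0..real n}. \<bar>f (w + s) - f w\<bar> \<le> 2 * \<bar>a w\<bar> * ((s + 1) * exp (s / 8))" for n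
  proof (induction n)
    case (Suc n)
    show ?case
    proof (intro allI impI ballI)
      fix w s assume w: "w \<ge> w0" and s: "s \<in> {0..real (Suc n)}"
      have e: "exp (s / 8) \<ge> 1"
        using s by auto
      show "\<bar>f (w + s) - f w\<bar> \<le> 2 * \<bar>a w\<bar> * ((s + 1) * exp (s / 8))"
      proof (cases "s \<le> 1")
        case True
        then have "\<bar>f (w + s) - f w\<bar> \<le> 2 * \<bar>a w\<bar> * (1 * 1)"
          using unit[OF w, of s] s by auto
        also have "\<dots> \<le> 2 * \<bar>a w\<bar> * ((s + 1) * exp (s / 8))"
          using e s by (intro mult_left_mono mult_mono) auto
        finally show ?thesis .
      next
        case False
        have "\<bar>f (w + 1 + (s - 1)) - f (w + 1)\<bar> \<le> 2 * \<bar>a (w + 1)\<bar> * ((s - 1 + 1) * exp ((s - 1) / 8))"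
          using Suc.IH[rule_format, of "w + 1" "s - 1"] w s False by auto
        also have "\<dots> \<le> 2 * (exp (1 / 8) * \<bar>a w\<bar>) * ((s - 1 + 1) * exp ((s - 1) / 8))"
          using step[OF w] False by (intro mult_right_mono mult_left_mono) auto
        also have "\<dots> = 2 * \<bar>a w\<bar> * (s * exp (s / 8))"
          by (simp add: exp_diff diff_divide_distrib)
        finally have "\<bar>f (w + 1 + (s - 1)) - f (w + 1)\<bar> \<le> 2 * \<bar>a w\<bar> * (s * exp (s / 8))" .
        moreover have "\<bar>f (w + 1) - f w\<bar> \<le> 2 * \<bar>a w\<bar> * exp (s / 8)"
        proof -
          have "\<bar>f (w + 1) - f w\<bar> \<le> 2 * \<bar>a w\<bar> * 1"
            using unit[OF w, of 1] by simp
          also have "\<dots> \<le> 2 * \<bar>a w\<bar> * exp (s / 8)"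
            using e by (intro mult_left_mono) auto
          finally show ?thesis .
        qed
        ultimately show ?thesis
          by (simp add: algebra_simps)
      qed
    qed
  qed (use unit in auto)
  then have "\<forall>w\<ge>w0. \<forall>s\<ge>0. \<bar>f (w + s) - f w\<bar> \<le> 2 * \<bar>a w\<bar> * ((s + 1) * exp (s / 8))"
    by (metis atLeastAtMost_iff real_arch_simple)
  then show ?thesis
    unfolding eventually_at_top_linorder by blast
qed

text \<open>Uniform convergence covers a compact range of \<open>s\<close>, the crude exponential
  bound everything beyond it. The rate 1/4 is admissible because \<open>exp (s / 4)\<close> is
  square integrable under the standard exponential law.\<close>

lemma increment_potter:
  assumes "\<epsilon> > 0"
  shows "\<forall>\<^sub>F w in at_top. \<forall>s\<ge>0.
    \<bar>(f (w + s) - f w) / a w - box_cox \<rho> s\<bar> \<le> \<epsilon> * exp (s / 4)"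
proof -
  have "((\<lambda>s::real. (2 * ((s + 1) * exp (s / 8)) + s) / exp (s / 4)) \<longlongrightarrow> 0) at_top"
    by real_asymp
  from order_tendstoD(2)[OF this assms] obtain S where
    S: "\<And>s. s \<ge> S \<Longrightarrow> 2 * ((s + 1) * exp (s / 8)) + s < \<epsilon> * exp (s / 4)"
    unfolding eventually_at_top_linorder by (auto simp: field_simps)
  show ?thesis
    using a_nonzero increment_exp_bound increment_uniform[OF assms, of 0 S]
  proof (eventually_elim, intro allI impI)
    fix w s :: real
    assume nz: "a w \<noteq> 0" and s: "0 \<le> s"
      and bound: "\<forall>s\<ge>0. \<bar>f (w + s) - f w\<bar> \<le> 2 * \<bar>a w\<bar> * ((s + 1) * exp (s / 8))"
      and unif: "\<forall>s\<in>{0..S}. \<bar>(f (w + s) - f w) / a w - box_cox \<rho> s\<bar> \<le> \<epsilon>"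
    show "\<bar>(f (w + s) - f w) / a w - box_cox \<rho> s\<bar> \<le> \<epsilon> * exp (s / 4)"
    proof (cases "s \<le> S")
      case True
      then have "\<bar>(f (w + s) - f w) / a w - box_cox \<rho> s\<bar> \<le> \<epsilon> * 1"
        using unif s by auto
      also have "\<dots> \<le> \<epsilon> * exp (s / 4)"
        using assms s by (intro mult_left_mono) auto
      finally show ?thesis .
    next
      case False
      have "\<bar>(f (w + s) - f w) / a w\<bar> \<le> 2 * ((s + 1) * exp (s / 8))"
        using bound[rule_format, OF s] nz by (simp add: abs_divide field_simps)
      moreover have "2 * ((s + 1) * exp (s / 8)) + s < \<epsilon> * exp (s / 4)"
        using False by (intro S) simp
      ultimately show ?thesis
        using box_cox_bounds[OF rho_nonpos s] by linarith
    qed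
  qed
qed

end

text \<open>Since the normalized ratio \<open>R\<close> tends to 1, \<open>ln R\<close> and
  \<open>R - 1\<close> are asymptotically equal, so taking logarithms keeps the second-order limit.
  Monotonicity of \<open>U\<close> serves to show that the logarithms are those of positive
  numbers.\<close>

lemma second_order_cond_log:
  assumes "second_order_cond \<gamma> \<rho> A U"
    and mono: "\<And>s t. 1 < s \<Longrightarrow> s \<le> t \<Longrightarrow> U s \<le> U t"
  shows "\<forall>\<^sub>F t in at_top. U t > 0"
    and "\<And>s. ((\<lambda>w. (ln (U (exp (w + s))) - ln (U (exp w)) - \<gamma> * s) / A (exp w)) \<longlongrightarrow>
      box_cox \<rho> s) at_top"
proof -
  have \<gamma>: "\<gamma> > 0" and A0: "(A \<longlongrightarrow> 0) at_top"
    and A_nz: "\<forall>\<^sub>F t in at_top. A t \<noteq> 0"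
    and lim: "\<And>x. x > 0 \<Longrightarrow> ((\<lambda>t. 1 / A t * (U (t * x) / U t - x powr \<gamma>)) \<longlongrightarrow>
        x powr \<gamma> * (if \<rho> = 0 then ln x else (x powr \<rho> - 1) / \<rho>)) at_top"
    using assms unfolding second_order_cond_def by (auto elim: eventually_mono)
  have first: "((\<lambda>t. U (t * x) / U t) \<longlongrightarrow> x powr \<gamma>) at_top" if "x > 0" for x
  proof -
    have "((\<lambda>t. A t * (1 / A t * (U (t * x) / U t - x powr \<gamma>)) + x powr \<gamma>) \<longlongrightarrow>
      0 * (x powr \<gamma> * (if \<rho> = 0 then ln x else (x powr \<rho> - 1) / \<rho>)) + x powr \<gamma>) at_top"
      by (intro tendsto_intros lim A0 that)
    moreover have "\<forall>\<^sub>F t in at_top. A t * (1 / A t * (U (t * x) / U t - x powr \<gamma>)) + x powr \<gamma> = U (t * x) / U t"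
      using A_nz by eventually_elim simp
    ultimately have "((\<lambda>t. U (t * x) / U t) \<longlongrightarrow>
      0 * (x powr \<gamma> * (if \<rho> = 0 then ln x else (x powr \<rho> - 1) / \<rho>)) + x powr \<gamma>) at_top"
      by (rule Lim_transform_eventually)
    then show ?thesis
      by simp
  qed
  \<comment> \<open>For nondecreasing \<open>U\<close> a ratio above 1 excludes
    \<open>U t < 0\<close>, and it excludes \<open>U t = 0\<close> because division by zero gives
    0.\<close>
  have "\<forall>\<^sub>F t in at_top. 1 < U (t * 2) / U t"
    by (rule order_tendstoD(1)[OF first]) (use \<gamma> in auto)
  from this eventually_gt_at_top[of 1]
  show U_pos: "\<forall>\<^sub>F t in at_top. U t > 0"
  proof eventually_elim
    case (elim t)
    have le: "U t \<le> U (t * 2)"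
      using elim by (intro mono) auto
    show ?case
    proof (rule ccontr)
      assume "\<not> ?case"
      then consider "U t = 0" | "U t < 0"
        by linarith
      then show False
        using elim le by cases (auto simp: less_divide_eq)
    qed
  qed
  fix s :: real
  define x where "x = exp s"
  have x: "x > 0" "ln x = s" "x powr \<rho> = exp (\<rho> * s)"
    by (auto simp: x_def powr_def)
  define R where "R t = U (t * x) / U t / x powr \<gamma>" for t
  have R1: "(R \<longlongrightarrow> 1) at_top"
    using tendsto_divide[OF first[OF x(1)] tendsto_const[of "x powr \<gamma>"]] x by (simp add: R_def[abs_def])
  have L: "((\<lambda>t. (R t - 1) / A t) \<longlongrightarrow> box_cox \<rho> s) at_top"
  proof -
    have "((\<lambda>t. (1 / A t * (U (t * x) / U t - x powr \<gamma>)) / x powr \<gamma>) \<longlongrightarrow>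
      (x powr \<gamma> * (if \<rho> = 0 then ln x else (x powr \<rho> - 1) / \<rho>)) / x powr \<gamma>) at_top"
      using x by (intro tendsto_divide lim tendsto_const) auto
    also have "(\<lambda>t. (1 / A t * (U (t * x) / U t - x powr \<gamma>)) / x powr \<gamma>) = (\<lambda>t. (R t - 1) / A t)"
    proof
      fix t
      have "R t - 1 = (U (t * x) / U t - x powr \<gamma>) / x powr \<gamma>"
        using x(1) by (simp add: R_def diff_divide_distrib)
      then show "(1 / A t * (U (t * x) / U t - x powr \<gamma>)) / x powr \<gamma> = (R t - 1) / A t"
        by simp
    qed
    finally show ?thesis
      using x by (simp add: box_cox_def split: if_splits)
  qed
  \<comment> \<open>The continuous extension of \<open>ln y / (y - 1)\<close>, so that
    \<open>ln (R t) = \<phi> (R t) * (R t - 1)\<close> also holds where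
    \<open>R t = 1\<close>.\<close>
  define \<phi> where "\<phi> y = (if y = 1 then 1 else ln y / (y - 1))" for y :: real
  have "(ln has_real_derivative 1) (at (1::real))"
    by (auto intro!: derivative_eq_intros)
  then have "((\<lambda>y. (ln y - ln 1) / (y - 1)) \<longlongrightarrow> 1) (at (1::real))"
    by (simp add: has_field_derivative_iff)
  then have "(\<phi> \<longlongrightarrow> 1) (at 1)"
    by (rule Lim_transform_eventually) (auto simp: eventually_at_filter \<phi>_def)
  then have "isCont \<phi> 1"
    by (simp add: isCont_def \<phi>_def)
  then have "((\<lambda>t. \<phi> (R t)) \<longlongrightarrow> 1) at_top"
    using isCont_tendsto_compose[of 1 \<phi> R at_top] R1 by (simp add: \<phi>_def)
  from tendsto_mult[OF this L] have "((\<lambda>t. \<phi> (R t) * ((R t - 1) / A t)) \<longlongrightarrow> box_cox \<rho> s) at_top"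
    by simp
  moreover have "\<forall>\<^sub>F t in at_top. \<phi> (R t) * ((R t - 1) / A t)
      = (ln (U (t * x)) - ln (U t) - \<gamma> * s) / A t"
  proof -
    have "filterlim (\<lambda>t. t * x) at_top at_top"
      using filterlim_at_top_mult_tendsto_pos[OF tendsto_const[of x] x(1) filterlim_ident] .
    from eventually_compose_filterlim[OF U_pos this] U_pos show ?thesis
    proof eventually_elim
      case (elim t)
      have "\<phi> (R t) * (R t - 1) = ln (R t)"
        by (simp add: \<phi>_def)
      also have "\<dots> = ln (U (t * x)) - ln (U t) - \<gamma> * s"
        using elim x by (simp add: R_def ln_div ln_powr ln_mult)
      finally show ?case
        by simp
    qed
  qed
  ultimately have "((\<lambda>t. (ln (U (t * x)) - ln (U t) - \<gamma> * s) / A t) \<longlongrightarrow> box_cox \<rho> s) at_top"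
    by (rule Lim_transform_eventually)
  from filterlim_compose[OF this exp_at_top]
  show "((\<lambda>w. (ln (U (exp (w + s))) - ln (U (exp w)) - \<gamma> * s) / A (exp w)) \<longlongrightarrow> box_cox \<rho> s) at_top"
    by (simp add: exp_add x_def)
qed

section \<open>Order statistics and the Hill estimator of a list\<close>

lemma order_stat_in_set:
  assumes "1 \<le> i" "i \<le> length xs"
  shows "order_stat xs i \<in> set xs"
proof -
  have "sort xs ! (i - 1) \<in> set (sort xs)"
    using assms by (intro nth_mem) auto
  then show ?thesis
    by (simp add: order_stat_def)
qed

text \<open>In sorted order the entries above \<open>y\<close> form a final segment. Statements on
  order statistics thereby become statements on counts, which are sums over the sample;
  measurability and the quantile expansion both rest on this.\<close>

lemma order_stat_greater_iff:
  assumes i: "1 \<le> i" "i \<le> length xs"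
  shows "y < order_stat xs i \<longleftrightarrow> length xs - i < length (filter (\<lambda>x. y < x) xs)"
proof -
  let ?s = "sort xs" and ?n = "length xs"
  have "length (filter (\<lambda>x. y < x) xs) = length (filter (\<lambda>x. y < x) ?s)"
    by (metis mset_filter mset_sort size_mset)
  also have "\<dots> = card {j. j < ?n \<and> y < ?s ! j}"
    by (simp only: length_filter_conv_card length_sort)
  finally have len: "length (filter (\<lambda>x. y < x) xs) = card {j. j < ?n \<and> y < ?s ! j}" .
  have mono: "?s ! j \<le> ?s ! j'" if "j \<le> j'" "j' < ?n" for j j'
    using that by (intro sorted_nth_mono) auto
  show ?thesis
  proof (cases "y < ?s ! (i - 1)")
    case True
    have "{i - 1..<?n} \<subseteq> {j. j < ?n \<and> y < ?s ! j}"
      using True mono[of "i - 1"] by (auto intro: less_le_trans)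
    from card_mono[OF _ this] have "?n - (i - 1) \<le> length (filter (\<lambda>x. y < x) xs)"
      by (simp add: len)
    then show ?thesis
      using True i by (simp add: order_stat_def)
  next
    case False
    have "j \<ge> i" if "j < ?n" "y < ?s ! j" for j
    proof (rule ccontr)
      assume "\<not> i \<le> j"
      then have "?s ! j \<le> ?s ! (i - 1)"
        using i by (intro mono) auto
      then show False
        using that False by simp
    qed
    then have "{j. j < ?n \<and> y < ?s ! j} \<subseteq> {i..<?n}"
      by auto
    from card_mono[OF _ this] show ?thesis
      using False by (simp add: order_stat_def len)
  qed
qed

lemma order_stat_map_mono:
  assumes "mono_on (set xs) e" "1 \<le> i" "i \<le> length xs"
  shows "order_stat (map e xs) i = e (order_stat xs i)"
proof -
  have "sorted (map e (sort xs))"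
    using assms(1) by (auto simp: sorted_map mono_on_def intro: sorted_wrt_mono_rel[OF _ sorted_sort[of xs]])
  then have "sort (map e xs) = map e (sort xs)"
    by (intro properties_for_sort) simp_all
  then show ?thesis
    using assms by (simp add: order_stat_def)
qed

text \<open>
  The terms below the threshold vanish and those equal to it contribute \<open>ln 1\<close>, so ties in
  the sample do not matter.
\<close>

lemma hill_eq_sum_list:
  assumes k: "1 \<le> k" "k < length xs" and th: "th = order_stat xs (length xs - k)" "th > 0"
  shows "real k * hill xs k = sum_list (map (\<lambda>x. if th < x then ln (x / th) else 0) xs)"
proof -
  let ?s = "sort xs" and ?n = "length xs"
  define \<phi> where "\<phi> = (\<lambda>x. if th < x then ln (x / th) else 0)"
  have mono: "?s ! j \<le> ?s ! j'" if "j \<le> j'" "j' < ?n" for j j'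
    using that by (intro sorted_nth_mono) auto
  have th': "th = ?s ! (?n - k - 1)"
    by (simp add: th order_stat_def)
  have "sum_list (map \<phi> xs) = sum_list (map \<phi> ?s)"
    by (metis mset_map mset_sort sum_mset_sum_list)
  also have "\<dots> = (\<Sum>j<?n. \<phi> (?s ! j))"
    by (simp add: sum_list_sum_nth atLeast0LessThan)
  also have "\<dots> = (\<Sum>j\<in>{?n - k..<?n}. \<phi> (?s ! j))"
  proof (rule sum.mono_neutral_right)
    show "\<forall>j\<in>{..<?n} - {?n - k..<?n}. \<phi> (?s ! j) = 0"
    proof
      fix j assume "j \<in> {..<?n} - {?n - k..<?n}"
      then have "?s ! j \<le> th"
        unfolding th' using k by (intro mono) auto
      then show "\<phi> (?s ! j) = 0"
        by (simp add: \<phi>_def)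
    qed
  qed auto
  also have "\<dots> = (\<Sum>j\<in>{?n - k..<?n}. ln (?s ! j / th))"
  proof (rule sum.cong)
    fix j assume "j \<in> {?n - k..<?n}"
    then have "th \<le> ?s ! j"
      unfolding th' by (intro mono) auto
    then show "\<phi> (?s ! j) = ln (?s ! j / th)"
      using th(2) by (cases "th = ?s ! j") (auto simp: \<phi>_def)
  qed simp
  also have "\<dots> = (\<Sum>i=1..k. ln (order_stat xs (?n - i + 1) / th))"
    by (rule sum.reindex_bij_witness[of _ "\<lambda>i. ?n - i" "\<lambda>j. ?n - j"])
       (use k in \<open>auto simp: order_stat_def\<close>)
  finally show ?thesis
    using k by (simp add: hill_def th(1)[symmetric] \<phi>_def)
qed

lemma sum_list_subsample: "sum_list (map \<phi> (subsample X N j \<omega>)) = (\<Sum>i=1..N j. \<phi> (X i j \<omega>))"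
  for \<phi> :: "real \<Rightarrow> real"
  unfolding subsample_def map_map o_def interv_sum_list_conv_sum_set_nat
  by (rule sum.cong) auto

lemma sum_list_combined_sample:
  "sum_list (map \<phi> (combined_sample X m N \<omega>)) = (\<Sum>j=1..m. \<Sum>i=1..N j. \<phi> (X i j \<omega>))"
  for \<phi> :: "real \<Rightarrow> real"
proof -
  have "sum_list (map \<phi> (combined_sample X m N \<omega>))
      = sum_list (map (\<lambda>j. sum_list (map \<phi> (subsample X N j \<omega>))) [1..<Suc m])"
  proof -
    have "sum_list (map \<phi> (concat xss)) = sum_list (map (\<lambda>xs. sum_list (map \<phi> xs)) xss)" for xss
      by (induction xss) auto
    then show ?thesis
      by (simp add: combined_sample_def o_def del: upt_Suc)
  qed
  then show ?thesis
    unfolding sum_list_subsample interv_sum_list_conv_sum_set_nat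
    by (elim trans) (rule sum.cong, auto)
qed

text \<open>\<open>xs\<close> lists, up to order, the values of \<open>x\<close> on \<open>I\<close>.\<close>

definition lists_values :: "real list \<Rightarrow> 'i set \<Rightarrow> ('i \<Rightarrow> real) \<Rightarrow> bool" where
  "lists_values xs I x \<longleftrightarrow>
    finite I \<and> (\<forall>\<phi>::real \<Rightarrow> real. sum_list (map \<phi> xs) = (\<Sum>i\<in>I. \<phi> (x i)))"

text \<open>Testing the sums against indicator functions recovers counts, and these determine the
  length and the set of entries. In this form a single sample and the combined one are treated
  alike.\<close>

lemma
  assumes "lists_values xs I x"
  shows lists_values_sum: "\<And>\<phi> :: real \<Rightarrow> real. sum_list (map \<phi> xs) = (\<Sum>i\<in>I. \<phi> (x i))"
    and lists_values_filter: "length (filter P xs) = card {i\<in>I. P (x i)}"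
    and lists_values_length: "length xs = card I"
    and lists_values_set: "set xs = x ` I"
    and lists_values_map: "lists_values (map e xs) I (\<lambda>i. e (x i))"
proof -
  have fin: "finite I" and eq: "sum_list (map \<phi> xs) = (\<Sum>i\<in>I. \<phi> (x i))" for \<phi> :: "real \<Rightarrow> real"
    using assms by (auto simp: lists_values_def)
  show "\<And>\<phi> :: real \<Rightarrow> real. sum_list (map \<phi> xs) = (\<Sum>i\<in>I. \<phi> (x i))"
    by (rule eq)
  show filter: "length (filter P xs) = card {i\<in>I. P (x i)}" for P
  proof -
    have "real (length (filter P xs)) = sum_list (map (\<lambda>v. if P v then 1 else 0) xs)"
      by (induction xs) auto
    also have "\<dots> = real (card {i\<in>I. P (x i)})"
      using fin by (simp add: eq sum.If_cases Int_def)
    finally show ?thesis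
      by simp
  qed
  show "length xs = card I"
    using filter[of "\<lambda>_. True"] by simp
  have "v \<in> set xs \<longleftrightarrow> v \<in> x ` I" for v
  proof -
    have "v \<in> set xs \<longleftrightarrow> length (filter (\<lambda>y. y = v) xs) > 0"
      by (auto simp: filter_empty_conv)
    also have "\<dots> \<longleftrightarrow> v \<in> x ` I"
      unfolding filter using fin by (auto simp: card_gt_0_iff)
    finally show ?thesis .
  qed
  then show "set xs = x ` I"
    by blast
  show "lists_values (map e xs) I (\<lambda>i. e (x i))"
    using fin by (auto simp: lists_values_def o_def eq)
qed

text \<open>
  The function \<open>v \<mapsto> k v + \<Sum> (V i - v)\<^sup>+\<close> is convex with slope \<open>k - #{V i > v}\<close>, so it hardly
  changes between the empirical quantile \<open>w\<close> and a nearby deterministic level \<open>u\<close>.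
\<close>

lemma excess_sum_threshold_change:
  fixes W :: "'i \<Rightarrow> real" and V :: "real \<Rightarrow> real"
  assumes I: "finite I" and V: "mono_on {w0..} V" and w: "w0 \<le> w" "w0 \<le> u"
    and above: "card {i\<in>I. w < W i} \<le> k" and below: "k \<le> card {i\<in>I. w \<le> W i}"
  shows "\<bar>(\<Sum>i\<in>I. if w < W i then V (W i) - V w else 0)
      - ((\<Sum>i\<in>I. if u < W i then V (W i) - V u else 0) - real k * (V w - V u))\<bar>
    \<le> \<bar>real (card {i\<in>I. u < W i}) - real k\<bar> * \<bar>V w - V u\<bar>"
proof -
  have mono: "V a \<le> V b" if "w0 \<le> a" "a \<le> b" for a b
    using V that by (auto simp: mono_on_def)
  define S where "S v = (\<Sum>i\<in>I. if v < W i then V (W i) - V v else 0)" for v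
  have count: "(\<Sum>i\<in>I. if P i then c else 0) = real (card {i\<in>I. P i}) * c" for P and c :: real
    using I by (simp add: sum.If_cases Int_def)
  have "\<bar>S w - (S u - real k * (V w - V u))\<bar> \<le> \<bar>real (card {i\<in>I. u < W i}) - real k\<bar> * \<bar>V w - V u\<bar>"
  proof (cases "u < w")
    case True
    define \<Delta> where "\<Delta> = V w - V u"
    have \<Delta>: "\<Delta> \<ge> 0"
      using True w mono[of u w] by (simp add: \<Delta>_def)
    \<comment> \<open>Raising the level from \<open>u\<close> to \<open>w\<close> costs each point
      above \<open>u\<close> at most \<open>\<Delta>\<close> and each point at or above
      \<open>w\<close> exactly \<open>\<Delta>\<close>. Points tied with \<open>w\<close> belong to
      the second kind, hence the weak inequality in \<open>below\<close>.\<close>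
    have "S u - S w \<le> (\<Sum>i\<in>I. if u < W i then \<Delta> else 0)"
      unfolding S_def sum_subtractf[symmetric] using True w
      by (intro sum_mono) (auto simp: \<Delta>_def not_less intro!: mono)
    then have 1: "S u - S w \<le> real (card {i\<in>I. u < W i}) * \<Delta>"
      by (simp add: count)
    have "(\<Sum>i\<in>I. if w \<le> W i then \<Delta> else 0) \<le> S u - S w"
      unfolding S_def sum_subtractf[symmetric] using True w
      by (intro sum_mono) (auto simp: \<Delta>_def not_less intro!: mono)
    then have "real (card {i\<in>I. w \<le> W i}) * \<Delta> \<le> S u - S w"
      by (simp add: count)
    moreover have "real k * \<Delta> \<le> real (card {i\<in>I. w \<le> W i}) * \<Delta>"
      using below \<Delta> by (intro mult_right_mono) auto
    moreover have "(real (card {i\<in>I. u < W i}) - real k) * \<Delta> \<le> \<bar>real (card {i\<in>I. u < W i}) - real k\<bar> * \<Delta>"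
      using \<Delta> by (intro mult_right_mono) auto
    ultimately show ?thesis
      using 1 \<Delta> by (simp add: \<Delta>_def[symmetric] algebra_simps abs_le_iff)
  next
    case False
    define \<Delta> where "\<Delta> = V u - V w"
    have \<Delta>: "\<Delta> \<ge> 0" and abs_\<Delta>: "\<bar>V w - V u\<bar> = \<Delta>" and \<Delta>': "V w - V u = - \<Delta>"
      using False w mono[of w u] by (auto simp: \<Delta>_def)
    have "S w - S u \<le> (\<Sum>i\<in>I. if w < W i then \<Delta> else 0)"
      unfolding S_def sum_subtractf[symmetric] using False w
      by (intro sum_mono) (auto simp: \<Delta>_def not_less intro!: mono)
    then have "S w - S u \<le> real (card {i\<in>I. w < W i}) * \<Delta>"
      by (simp add: count)
    also have "\<dots> \<le> real k * \<Delta>"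
      using above \<Delta> by (intro mult_right_mono) auto
    finally have 1: "S w - S u \<le> real k * \<Delta>" .
    have "(\<Sum>i\<in>I. if u < W i then \<Delta> else 0) \<le> S w - S u"
      unfolding S_def sum_subtractf[symmetric] using False w
      by (intro sum_mono) (auto simp: \<Delta>_def not_less intro!: mono)
    then have 2: "real (card {i\<in>I. u < W i}) * \<Delta> \<le> S w - S u"
      by (simp add: count)
    have "(real k - real (card {i\<in>I. u < W i})) * \<Delta> \<le> \<bar>real (card {i\<in>I. u < W i}) - real k\<bar> * \<Delta>"
      using \<Delta> by (intro mult_right_mono) auto
    then show ?thesis
      unfolding abs_\<Delta> \<Delta>' using 1 2 \<Delta> by (simp add: algebra_simps abs_le_iff)
  qed
  then show ?thesis
    by (simp add: S_def)
qed

section \<open>Convergence in probability\<close>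

text \<open>
  Events holding with probability tending to \<open>1\<close>, as a filter on pairs of index and outcome;
  convergence in probability becomes \<^const>\<open>tendsto\<close> along it. Requiring only an inner measurable event
  avoids measurability side conditions.
\<close>

definition whp :: "'a measure \<Rightarrow> (nat \<times> 'a) filter" where
  "whp M = Abs_filter (\<lambda>P. \<forall>\<eta>>0. \<forall>\<^sub>F n in sequentially.
     \<exists>B\<in>sets M. measure M B < \<eta> \<and> (\<forall>\<omega>\<in>space M - B. P (n, \<omega>)))"

context prob_space
begin

lemma eventually_whp:
  "eventually P (whp M) \<longleftrightarrow>
    (\<forall>\<eta>>0. \<forall>\<^sub>F n in sequentially. \<exists>B\<in>sets M. prob B < \<eta> \<and> (\<forall>\<omega>\<in>space M - B. P (n, \<omega>)))"
  unfolding whp_def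
proof (rule eventually_Abs_filter, rule is_filter.intro)
  fix P Q :: "nat \<times> 'a \<Rightarrow> bool"
  let ?F = "\<lambda>P. \<forall>\<eta>>0. \<forall>\<^sub>F n in sequentially. \<exists>B\<in>sets M. prob B < \<eta> \<and> (\<forall>\<omega>\<in>space M - B. P (n, \<omega>))"
  assume P: "?F P" and Q: "?F Q"
  show "?F (\<lambda>x. P x \<and> Q x)"
  proof (intro allI impI)
    fix \<eta> :: real assume "\<eta> > 0"
    then have "\<eta> / 2 > 0"
      by simp
    from P[rule_format, OF this] Q[rule_format, OF this]
    show "\<forall>\<^sub>F n in sequentially. \<exists>B\<in>sets M. prob B < \<eta> \<and> (\<forall>\<omega>\<in>space M - B. P (n, \<omega>) \<and> Q (n, \<omega>))"
    proof eventually_elim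
      case (elim n)
      then obtain B C where B: "B \<in> sets M" "prob B < \<eta> / 2" "\<forall>\<omega>\<in>space M - B. P (n, \<omega>)"
        and C: "C \<in> sets M" "prob C < \<eta> / 2" "\<forall>\<omega>\<in>space M - C. Q (n, \<omega>)"
        by blast
      have "prob (B \<union> C) \<le> prob B + prob C"
        using B C by (intro measure_Un_le) auto
      then show ?case
        using B C by (intro bexI[of _ "B \<union> C"]) auto
    qed
  qed
next
  fix P Q :: "nat \<times> 'a \<Rightarrow> bool"
  let ?F = "\<lambda>P. \<forall>\<eta>>0. \<forall>\<^sub>F n in sequentially. \<exists>B\<in>sets M. prob B < \<eta> \<and> (\<forall>\<omega>\<in>space M - B. P (n, \<omega>))"
  assume PQ: "\<forall>x. P x \<longrightarrow> Q x" and P: "?F P"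
  show "?F Q"
  proof (intro allI impI)
    fix \<eta> :: real assume "\<eta> > 0"
    from P[rule_format, OF this]
    show "\<forall>\<^sub>F n in sequentially. \<exists>B\<in>sets M. prob B < \<eta> \<and> (\<forall>\<omega>\<in>space M - B. Q (n, \<omega>))"
      by eventually_elim (use PQ in blast)
  qed
qed (auto intro!: always_eventually bexI[of _ "{}"])

lemma eventually_whp_fst:
  assumes "\<forall>\<^sub>F n in sequentially. P n"
  shows "\<forall>\<^sub>F p in whp M. P (fst p)"
  unfolding eventually_whp using assms
  by (auto elim!: eventually_mono intro!: bexI[of _ "{}"])

lemma filterlim_fst_whp: "filterlim fst sequentially (whp M)"
  by (auto simp: filterlim_iff intro: eventually_whp_fst)

lemma tendsto_whp_fst:
  assumes "f \<longlonglongrightarrow> l"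
  shows "((\<lambda>p. f (fst p)) \<longlongrightarrow> l) (whp M)"
  using filterlim_compose[OF assms filterlim_fst_whp] .

lemma eventually_whp_AE:
  assumes "AE \<omega> in M. P \<omega>"
  shows "\<forall>\<^sub>F p in whp M. P (snd p)"
proof -
  from AE_E[OF assms] obtain N where "{\<omega> \<in> space M. \<not> P \<omega>} \<subseteq> N" "emeasure M N = 0" "N \<in> sets M"
    by blast
  then show ?thesis
    unfolding eventually_whp by (auto intro!: always_eventually bexI[of _ N] simp: measure_def)
qed

lemma eventually_whpI:
  assumes "\<And>n. B n \<in> sets M" and "\<forall>\<^sub>F n in sequentially. prob (B n) \<le> v n" and "v \<longlonglongrightarrow> 0"
    and "\<And>n \<omega>. \<omega> \<in> space M \<Longrightarrow> \<omega> \<notin> B n \<Longrightarrow> P (n, \<omega>)"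
  shows "eventually P (whp M)"
  unfolding eventually_whp
proof (intro allI impI)
  fix \<eta> :: real assume "\<eta> > 0"
  from order_tendstoD(2)[OF assms(3) this] assms(2)
  show "\<forall>\<^sub>F n in sequentially. \<exists>B\<in>sets M. prob B < \<eta> \<and> (\<forall>\<omega>\<in>space M - B. P (n, \<omega>))"
    by eventually_elim (use assms in \<open>auto intro!: bexI[of _ "B _"]\<close>)
qed

lemma conv_to_0_in_probI:
  assumes "((\<lambda>p. Y (fst p) (snd p)) \<longlongrightarrow> 0) (whp M)"
  shows "conv_to_0_in_prob Y"
  unfolding conv_to_0_in_prob_def
proof (intro allI impI tendstoI)
  fix \<epsilon> \<eta> :: real assume "\<epsilon> > 0" "\<eta> > 0"
  from tendstoD[OF assms this(1)] this(2)
  have "\<forall>\<^sub>F n in sequentially. \<exists>B\<in>sets M. prob B < \<eta> \<and> (\<forall>\<omega>\<in>space M - B. \<bar>Y n \<omega>\<bar> < \<epsilon>)"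
    unfolding eventually_whp by (simp add: dist_norm)
  then show "\<forall>\<^sub>F n in sequentially. dist (prob {\<omega> \<in> space M. \<epsilon> < \<bar>Y n \<omega>\<bar>}) 0 < \<eta>"
  proof eventually_elim
    case (elim n)
    then obtain B where B: "B \<in> sets M" "prob B < \<eta>" "\<forall>\<omega>\<in>space M - B. \<bar>Y n \<omega>\<bar> < \<epsilon>"
      by blast
    have "prob {\<omega> \<in> space M. \<epsilon> < \<bar>Y n \<omega>\<bar>} \<le> prob B"
      using B by (intro finite_measure_mono) force+
    then show ?case
      using B by simp
  qed
qed

text \<open>Tightness. It is not a single eventual property along \<open>whp M\<close>, because the
  bound \<open>C\<close> may depend on \<open>\<eta>\<close>.\<close>

definition stochastically_bounded :: "(nat \<Rightarrow> 'a \<Rightarrow> real) \<Rightarrow> bool" where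
  "stochastically_bounded Y \<longleftrightarrow> (\<forall>\<eta>>0. \<exists>C. \<forall>\<^sub>F n in sequentially.
     \<exists>B\<in>sets M. prob B < \<eta> \<and> (\<forall>\<omega>\<in>space M - B. \<bar>Y n \<omega>\<bar> \<le> C))"

lemma stochastically_bounded_mult:
  assumes Y: "stochastically_bounded Y"
    and Z: "((\<lambda>p. Z (fst p) (snd p)) \<longlongrightarrow> 0) (whp M)"
  shows "((\<lambda>p. Y (fst p) (snd p) * Z (fst p) (snd p)) \<longlongrightarrow> 0) (whp M)"
proof (rule tendstoI, unfold eventually_whp, intro allI impI)
  fix \<epsilon> \<eta> :: real assume "\<epsilon> > 0" "\<eta> > 0"
  then have "\<eta> / 2 > 0"
    by simp
  with Y obtain C where C: "\<forall>\<^sub>F n in sequentially.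
     \<exists>B\<in>sets M. prob B < \<eta> / 2 \<and> (\<forall>\<omega>\<in>space M - B. \<bar>Y n \<omega>\<bar> \<le> C)"
    unfolding stochastically_bounded_def by blast
  define \<delta> where "\<delta> = \<epsilon> / (\<bar>C\<bar> + 1)"
  have \<delta>: "\<delta> > 0"
    using \<open>\<epsilon> > 0\<close> by (simp add: \<delta>_def add_nonneg_pos)
  have "\<bar>C\<bar> * \<delta> < (\<bar>C\<bar> + 1) * \<delta>"
    using \<delta> by simp
  then have C\<delta>: "\<bar>C\<bar> * \<delta> < \<epsilon>"
    by (simp add: \<delta>_def add_nonneg_eq_0_iff)
  from tendstoD[OF Z \<delta>, unfolded eventually_whp, rule_format, OF \<open>\<eta> / 2 > 0\<close>]
  have "\<forall>\<^sub>F n in sequentially. \<exists>B\<in>sets M. prob B < \<eta> / 2 \<and> (\<forall>\<omega>\<in>space M - B. \<bar>Z n \<omega>\<bar> < \<delta>)"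
    by (simp add: dist_norm)
  with C show "\<forall>\<^sub>F n in sequentially. \<exists>B\<in>sets M. prob B < \<eta> \<and>
      (\<forall>\<omega>\<in>space M - B. dist (Y (fst (n, \<omega>)) (snd (n, \<omega>)) * Z (fst (n, \<omega>)) (snd (n, \<omega>))) 0 < \<epsilon>)"
  proof eventually_elim
    case (elim n)
    then obtain B D where B: "B \<in> sets M" "prob B < \<eta> / 2" "\<forall>\<omega>\<in>space M - B. \<bar>Y n \<omega>\<bar> \<le> C"
      and D: "D \<in> sets M" "prob D < \<eta> / 2" "\<forall>\<omega>\<in>space M - D. \<bar>Z n \<omega>\<bar> < \<delta>"
      by blast
    have "prob (B \<union> D) \<le> prob B + prob D"
      using B D by (intro measure_Un_le) auto
    moreover have "\<bar>Y n \<omega>\<bar> * \<bar>Z n \<omega>\<bar> < \<epsilon>" if "\<omega> \<in> space M - (B \<union> D)" for \<omega>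
    proof -
      have "\<bar>Y n \<omega>\<bar> * \<bar>Z n \<omega>\<bar> \<le> \<bar>C\<bar> * \<delta>"
        using that B D by (intro mult_mono) force+
      then show ?thesis
        using C\<delta> by simp
    qed
    ultimately show ?case
      using B D by (intro bexI[of _ "B \<union> D"]) (auto simp: abs_mult)
  qed
qed

text \<open>Ghosh's argument: a tight sequence squeezes \<open>V\<close> through a finite grid of levels.\<close>

lemma tendsto_diff_whp_of_levels:
  assumes U: "stochastically_bounded U"
    and le: "\<And>t \<epsilon>. \<epsilon> > 0 \<Longrightarrow> \<forall>\<^sub>F p in whp M. V (fst p) (snd p) > t \<longrightarrow> U (fst p) (snd p) > t - \<epsilon>"
    and ge: "\<And>t \<epsilon>. \<epsilon> > 0 \<Longrightarrow> \<forall>\<^sub>F p in whp M. V (fst p) (snd p) \<le> t \<longrightarrow> U (fst p) (snd p) < t + \<epsilon>"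
  shows "((\<lambda>p. V (fst p) (snd p) - U (fst p) (snd p)) \<longlongrightarrow> 0) (whp M)"
proof (rule tendstoI, unfold eventually_whp, intro allI impI)
  fix e \<eta> :: real assume "e > 0" "\<eta> > 0"
  define \<epsilon> where "\<epsilon> = e / 4"
  have \<epsilon>: "\<epsilon> > 0"
    using \<open>e > 0\<close> by (simp add: \<epsilon>_def)
  have "\<eta> / 2 > 0"
    using \<open>\<eta> > 0\<close> by simp
  with U obtain C where C: "\<forall>\<^sub>F n in sequentially.
     \<exists>B\<in>sets M. prob B < \<eta> / 2 \<and> (\<forall>\<omega>\<in>space M - B. \<bar>U n \<omega>\<bar> \<le> C)"
    unfolding stochastically_bounded_def by blast
  \<comment> \<open>With \<open>x = U / \<epsilon>\<close> the levels used are those with index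
    \<open>\<lfloor>x\<rfloor> - 1\<close> and \<open>\<lfloor>x\<rfloor> + 2\<close>; the summand
    \<open>e / \<epsilon> = 4\<close> is the margin that keeps them in the finite grid when
    \<open>\<bar>U\<bar> \<le> C\<close>. They locate \<open>V\<close> within
    \<open>2 * \<epsilon>\<close> of \<open>U\<close>, hence the choice
    \<open>e / 4\<close>.\<close>
  define L where "L = \<lceil>(\<bar>C\<bar> + e) / \<epsilon>\<rceil>"
  have "\<forall>\<^sub>F p in whp M. \<forall>l\<in>{- L - 1..L + 1}.
      (V (fst p) (snd p) > l * \<epsilon> \<longrightarrow> U (fst p) (snd p) > l * \<epsilon> - \<epsilon>) \<and>
      (V (fst p) (snd p) \<le> l * \<epsilon> \<longrightarrow> U (fst p) (snd p) < l * \<epsilon> + \<epsilon>)"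
    using le[OF \<epsilon>] ge[OF \<epsilon>] by (intro eventually_ball_finite ballI eventually_conj) auto
  from this[unfolded eventually_whp, rule_format, OF \<open>\<eta> / 2 > 0\<close>] C
  show "\<forall>\<^sub>F n in sequentially. \<exists>B\<in>sets M. prob B < \<eta> \<and>
      (\<forall>\<omega>\<in>space M - B. dist (V (fst (n, \<omega>)) (snd (n, \<omega>)) - U (fst (n, \<omega>)) (snd (n, \<omega>))) 0 < e)"
  proof eventually_elim
    case (elim n)
    then obtain B D where B: "B \<in> sets M" "prob B < \<eta> / 2" "\<forall>\<omega>\<in>space M - B. \<bar>U n \<omega>\<bar> \<le> C"
      and D: "D \<in> sets M" "prob D < \<eta> / 2" "\<And>\<omega> l. \<omega> \<in> space M - D \<Longrightarrow> l \<in> {- L - 1..L + 1} \<Longrightarrow>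
        (V n \<omega> > l * \<epsilon> \<longrightarrow> U n \<omega> > l * \<epsilon> - \<epsilon>) \<and> (V n \<omega> \<le> l * \<epsilon> \<longrightarrow> U n \<omega> < l * \<epsilon> + \<epsilon>)"
      by force
    have "prob (B \<union> D) \<le> prob B + prob D"
      using B D by (intro measure_Un_le) auto
    moreover have "\<bar>V n \<omega> - U n \<omega>\<bar> < e" if \<omega>: "\<omega> \<in> space M - (B \<union> D)" for \<omega>
    proof -
      define x where "x = U n \<omega> / \<epsilon>"
      have U_eq: "U n \<omega> = x * \<epsilon>"
        using \<epsilon> by (simp add: x_def)
      have "\<bar>U n \<omega>\<bar> \<le> \<bar>C\<bar>"
        using B(3) \<omega> by force
      then have "\<bar>x\<bar> + 4 \<le> (\<bar>C\<bar> + e) / \<epsilon>"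
        using \<epsilon> by (simp add: x_def abs_divide field_simps) (simp add: \<epsilon>_def)
      then have xL: "\<bar>x\<bar> + 4 \<le> L"
        unfolding L_def by linarith
      have hi: "\<not> V n \<omega> > (\<lfloor>x\<rfloor> + 2) * \<epsilon>"
      proof
        assume "V n \<omega> > (\<lfloor>x\<rfloor> + 2) * \<epsilon>"
        moreover have "\<lfloor>x\<rfloor> + 2 \<in> {- L - 1..L + 1}"
          using xL by (simp; linarith)
        ultimately have "x * \<epsilon> > (\<lfloor>x\<rfloor> + 2) * \<epsilon> - \<epsilon>"
          using D(3)[of \<omega> "\<lfloor>x\<rfloor> + 2"] \<omega> U_eq by auto
        then have "x * \<epsilon> > (\<lfloor>x\<rfloor> + 1) * \<epsilon>"
          by (simp add: algebra_simps)
        then show False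
          using \<epsilon> by (simp; linarith)
      qed
      have lo: "\<not> V n \<omega> \<le> (\<lfloor>x\<rfloor> - 1) * \<epsilon>"
      proof
        assume "V n \<omega> \<le> (\<lfloor>x\<rfloor> - 1) * \<epsilon>"
        moreover have "\<lfloor>x\<rfloor> - 1 \<in> {- L - 1..L + 1}"
          using xL by (simp; linarith)
        ultimately have "x * \<epsilon> < (\<lfloor>x\<rfloor> - 1) * \<epsilon> + \<epsilon>"
          using D(3)[of \<omega> "\<lfloor>x\<rfloor> - 1"] \<omega> U_eq by auto
        then have "x * \<epsilon> < \<lfloor>x\<rfloor> * \<epsilon>"
          by (simp add: algebra_simps)
        then show False
          using \<epsilon> by (simp; linarith)
      qed
      have fl: "\<lfloor>x\<rfloor> * \<epsilon> \<le> x * \<epsilon>" "x * \<epsilon> \<le> (\<lfloor>x\<rfloor> + 1) * \<epsilon>"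
        using \<epsilon> by (auto intro!: mult_right_mono; linarith)+
      show ?thesis
      proof -
        have "V n \<omega> \<le> \<lfloor>x\<rfloor> * \<epsilon> + 2 * \<epsilon>" "V n \<omega> > \<lfloor>x\<rfloor> * \<epsilon> - \<epsilon>"
            "x * \<epsilon> \<le> \<lfloor>x\<rfloor> * \<epsilon> + \<epsilon>"
          using hi lo fl by (simp_all add: distrib_right left_diff_distrib)
        moreover have "e = 4 * \<epsilon>"
          by (simp add: \<epsilon>_def)
        ultimately show ?thesis
          unfolding U_eq using fl(1) \<epsilon> by linarith
      qed
    qed
    ultimately show ?case
      using B D by (intro bexI[of _ "B \<union> D"]) auto
  qed
qed

lemma expectation_sum_sq_indep:
  fixes Y :: "'i \<Rightarrow> 'a \<Rightarrow> real"
  assumes I: "finite I" and ind: "indep_vars (\<lambda>_. borel) Y I"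
    and sq: "\<And>i. i \<in> I \<Longrightarrow> integrable M (\<lambda>\<omega>. (Y i \<omega>)\<^sup>2)"
    and mean: "\<And>i. i \<in> I \<Longrightarrow> expectation (Y i) = 0"
  shows "integrable M (\<lambda>\<omega>. (\<Sum>i\<in>I. Y i \<omega>)\<^sup>2)"
    and "expectation (\<lambda>\<omega>. (\<Sum>i\<in>I. Y i \<omega>)\<^sup>2) = (\<Sum>i\<in>I. expectation (\<lambda>\<omega>. (Y i \<omega>)\<^sup>2))"
proof -
  have int: "integrable M (Y i)" if "i \<in> I" for i
    by (rule square_integrable_imp_integrable) (use that sq ind in \<open>auto simp: indep_vars_def\<close>)
  have mixed: "integrable M (\<lambda>\<omega>. Y i \<omega> * Y j \<omega>) \<and>
      expectation (\<lambda>\<omega>. Y i \<omega> * Y j \<omega>) = (if i = j then expectation (\<lambda>\<omega>. (Y i \<omega>)\<^sup>2) else 0)"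
    if ij: "i \<in> I" "j \<in> I" for i j
  proof (cases "i = j")
    case False
    have "indep_vars (\<lambda>_. borel) Y {i, j}"
      using ind ij by (rule_tac indep_vars_subset) auto
    from indep_vars_lebesgue_integral[OF _ this] indep_vars_integrable[OF _ this] int ij mean False
    show ?thesis
      by auto
  qed (use sq ij in \<open>simp add: power2_eq_square\<close>)
  have sq_sum: "(\<Sum>i\<in>I. Y i \<omega>)\<^sup>2 = (\<Sum>i\<in>I. \<Sum>j\<in>I. Y i \<omega> * Y j \<omega>)" for \<omega>
    by (simp add: power2_eq_square sum_product)
  show "integrable M (\<lambda>\<omega>. (\<Sum>i\<in>I. Y i \<omega>)\<^sup>2)"
    unfolding sq_sum using mixed by (intro Bochner_Integration.integrable_sum) auto
  have "expectation (\<lambda>\<omega>. (\<Sum>i\<in>I. Y i \<omega>)\<^sup>2) = (\<Sum>i\<in>I. \<Sum>j\<in>I. expectation (\<lambda>\<omega>. Y i \<omega> * Y j \<omega>))"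
    unfolding sq_sum using mixed by (simp add: Bochner_Integration.integrable_sum)
  also have "\<dots> = (\<Sum>i\<in>I. \<Sum>j\<in>I. if i = j then expectation (\<lambda>\<omega>. (Y i \<omega>)\<^sup>2) else 0)"
    using mixed by (intro sum.cong refl) auto
  finally show "expectation (\<lambda>\<omega>. (\<Sum>i\<in>I. Y i \<omega>)\<^sup>2) = (\<Sum>i\<in>I. expectation (\<lambda>\<omega>. (Y i \<omega>)\<^sup>2))"
    using I by simp
qed

end

section \<open>The standard exponential law and its moments\<close>

definition std_exp :: "real measure" where
  "std_exp = density lborel (exponential_density 1)"

lemma sets_std_exp [simp, measurable_cong]: "sets std_exp = sets borel"
  by (simp add: std_exp_def)

lemma space_std_exp [simp]: "space std_exp = UNIV"
  by (simp add: std_exp_def)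

interpretation std_exp: prob_space std_exp
  unfolding std_exp_def by (rule prob_space_exponential_density) simp

lemma AE_std_exp_pos: "AE x in std_exp. x > 0"
proof -
  have "AE x in lborel. x \<noteq> (0::real)"
    by (rule AE_lborel_singleton)
  then show ?thesis
    unfolding std_exp_def
    by (subst AE_density) (auto simp: exponential_density_def elim!: eventually_mono)
qed

text \<open>The density at \<open>u + s\<close> is \<open>exp (- u)\<close> times the density at
  \<open>s\<close>. All moments of exceedance sums are obtained from this.\<close>

lemma std_exp_memoryless:
  fixes \<phi> :: "real \<Rightarrow> real"
  assumes \<phi>: "integrable std_exp \<phi>" and u: "u \<ge> 0"
  shows "has_bochner_integral std_exp (\<lambda>x. if u < x then \<phi> (x - u) else 0)
    (exp (- u) * (\<integral>x. \<phi> x \<partial>std_exp))"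
proof -
  have [measurable]: "\<phi> \<in> borel_measurable borel"
    using borel_measurable_integrable[OF \<phi>] by (simp add: measurable_cong_sets[OF sets_std_exp refl])
  let ?D = "exponential_density 1"
  let ?g = "\<lambda>x. if u < x then \<phi> (x - u) else 0"
  \<comment> \<open>At \<open>s = 0\<close> the strict test \<open>u < x\<close> fails while
    \<open>\<phi> 0\<close> may be nonzero, so the integrands agree only almost everywhere.\<close>
  have shift: "?D (u + 1 * s) * ?g (u + 1 * s) = exp (- u) * (?D s * \<phi> s)" if "s \<noteq> 0" for s
    using that u by (auto simp: exponential_density_def exp_add[symmetric] mult.assoc[symmetric])
  have ae: "AE s in lborel. exp (- u) * (?D s * \<phi> s) = ?D (u + 1 * s) * ?g (u + 1 * s)"
    using AE_lborel_singleton[of 0] by eventually_elim (rule shift[symmetric])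
  have "integrable lborel (\<lambda>s. ?D s * \<phi> s)"
    using \<phi> unfolding std_exp_def by (subst (asm) integrable_real_density) (auto simp: exponential_density_nonneg)
  then have 1: "integrable lborel (\<lambda>s. exp (- u) * (?D s * \<phi> s))"
    by simp
  then have "integrable lborel (\<lambda>s. ?D (u + 1 * s) * ?g (u + 1 * s))"
    by (rule integrable_cong_AE_imp) (use ae in auto)
  then have 2: "integrable lborel (\<lambda>x. ?D x * ?g x)"
    by (subst (asm) lborel_integrable_real_affine_iff[of 1 "\<lambda>x. ?D x * ?g x"]) auto
  have "(\<integral>x. ?D x * ?g x \<partial>lborel) = (\<integral>s. ?D (u + 1 * s) * ?g (u + 1 * s) \<partial>lborel)"
    by (subst lborel_integral_real_affine[of 1 _ u]) auto
  also have "\<dots> = (\<integral>s. exp (- u) * (?D s * \<phi> s) \<partial>lborel)"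
    by (rule integral_cong_AE) (use ae in auto)
  finally have "(\<integral>x. ?D x * ?g x \<partial>lborel) = exp (- u) * (\<integral>s. ?D s * \<phi> s \<partial>lborel)"
    by simp
  then show ?thesis
    using 2 unfolding std_exp_def has_bochner_integral_iff
    by (simp add: integrable_real_density integral_real_density exponential_density_nonneg)
qed

lemma std_exp_moment: "has_bochner_integral std_exp (\<lambda>x. x ^ i) (fact i)"
proof -
  have "distributed std_exp lborel (\<lambda>x. x) (exponential_density 1)"
    by (auto simp: distributed_def std_exp_def exponential_density_nonneg intro!: distr_id2)
  from std_exp.has_bochner_integral_erlang_ith_moment[OF _ this, of i]
  show ?thesis
    by simp
qed

lemma std_exp_exp:
  assumes "c < 1"
  shows "has_bochner_integral std_exp (\<lambda>x. exp (c * x)) (1 / (1 - c))"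
proof -
  have eq: "exponential_density 1 x * exp (c * x) = exponential_density (1 - c) x / (1 - c)" for x
  proof -
    have "exp (- x) * exp (c * x) = exp (- x * (1 - c))"
      by (simp add: exp_add[symmetric] algebra_simps)
    then show ?thesis
      using assms by (simp add: exponential_density_def)
  qed
  have "has_bochner_integral lborel (exponential_density (1 - c)) 1"
    using nn_integral_erlang_ith_moment[of "1 - c" 0 0] assms
    by (intro has_bochner_integral_nn_integral) (auto simp: exponential_density_nonneg)
  then have "has_bochner_integral lborel (\<lambda>x. exponential_density (1 - c) x / (1 - c)) (1 / (1 - c))"
    by (rule has_bochner_integral_divide)
  then show ?thesis
    unfolding std_exp_def eq[symmetric]
    by (auto simp: has_bochner_integral_iff integrable_real_density integral_real_density exponential_density_nonneg)
qed

text \<open>The origin of the factor \<open>1 / (1 - \<rho>)\<close> in the asymptotic bias: it is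
  the mean of the second-order limit function at an exponential excess.\<close>

lemma std_exp_box_cox:
  assumes "\<rho> \<le> 0"
  shows "has_bochner_integral std_exp (box_cox \<rho>) (1 / (1 - \<rho>))"
proof (cases "\<rho> = 0")
  case True
  then show ?thesis
    using std_exp_moment[of 1] by (simp add: box_cox_def[abs_def])
next
  case False
  have "has_bochner_integral std_exp (\<lambda>x. exp (\<rho> * x) - 1) (1 / (1 - \<rho>) - 1)"
    using std_exp_moment[of 0] std_exp_exp[of \<rho>] assms
    by (intro has_bochner_integral_diff) auto
  then have "has_bochner_integral std_exp (\<lambda>x. (exp (\<rho> * x) - 1) / \<rho>) ((1 / (1 - \<rho>) - 1) / \<rho>)"
    by (rule has_bochner_integral_divide)
  moreover have "(1 / (1 - \<rho>) - 1) / \<rho> = 1 / (1 - \<rho>)"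
    using False assms by (simp add: field_simps)
  ultimately show ?thesis
    using False by (simp add: box_cox_def[abs_def])
qed

section \<open>Arrays of exponential variables\<close>

definition excess :: "(real \<Rightarrow> real) \<Rightarrow> real \<Rightarrow> real \<Rightarrow> real" where
  "excess \<phi> u x = (if u < x then \<phi> (x - u) else 0)"

lemma measurable_excess [measurable]:
  assumes [measurable]: "\<phi> \<in> borel_measurable borel"
  shows "excess \<phi> u \<in> borel_measurable borel"
  unfolding excess_def[abs_def] by measurable

lemma std_exp_excess:
  assumes "has_bochner_integral std_exp \<phi> c" "u \<ge> 0"
  shows "has_bochner_integral std_exp (excess \<phi> u) (exp (- u) * c)"
  using std_exp_memoryless[of \<phi> u] assms
  by (auto simp: excess_def[abs_def] has_bochner_integral_iff)

lemma excess_power: "n > 0 \<Longrightarrow> (excess \<phi> u x) ^ n = excess (\<lambda>s. \<phi> s ^ n) u x"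
  by (simp add: excess_def)

lemma std_exp_prob_le:
  assumes "d \<ge> 0"
  shows "has_bochner_integral std_exp (\<lambda>x. if x \<le> d then 1 else 0 :: real) (1 - exp (- d))"
proof -
  have one: "has_bochner_integral std_exp (\<lambda>_. 1 :: real) 1"
    using std_exp_moment[of 0] by simp
  have "has_bochner_integral std_exp (\<lambda>x. 1 - excess (\<lambda>_. 1) d x) (1 - exp (- d) * 1)"
    by (intro has_bochner_integral_diff one std_exp_excess assms)
  also have "(\<lambda>x. 1 - excess (\<lambda>_. 1) d x) = (\<lambda>x. if x \<le> d then 1 else 0)"
    by (auto simp: excess_def)
  finally show ?thesis
    by simp
qed

locale exponential_sample = prob_space M for M :: "'a measure" +
  fixes W :: "'i \<Rightarrow> 'a \<Rightarrow> real" and I0 :: "'i set"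
  assumes indep: "indep_vars (\<lambda>_. borel) W I0"
    and distr_W: "i \<in> I0 \<Longrightarrow> distr M borel (W i) = std_exp"
begin

lemma measurable_W [measurable]: "i \<in> I0 \<Longrightarrow> W i \<in> borel_measurable M"
  using indep by (auto simp: indep_vars_def)

lemma has_bochner_integral_W:
  assumes "i \<in> I0" and [measurable]: "\<phi> \<in> borel_measurable borel"
    and "has_bochner_integral std_exp \<phi> c"
  shows "has_bochner_integral M (\<lambda>\<omega>. \<phi> (W i \<omega>)) (c :: real)"
  using assms(3) measurable_W[OF assms(1)]
  unfolding distr_W[OF assms(1), symmetric] has_bochner_integral_iff
  by (auto simp: integrable_distr_eq integral_distr)

text \<open>The functions depend on the index because different machines have different thresholds.
  Bounds on second moments suffice, since centering only decreases them.\<close>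

lemma sum_Chebyshev:
  fixes \<phi> :: "'i \<Rightarrow> real \<Rightarrow> real"
  assumes I: "finite I" "I \<subseteq> I0" and "\<epsilon> > 0"
    and [measurable]: "\<And>i. \<phi> i \<in> borel_measurable borel"
    and mean: "\<And>i. i \<in> I \<Longrightarrow> has_bochner_integral std_exp (\<phi> i) (e i)"
    and sq: "\<And>i. i \<in> I \<Longrightarrow> integrable std_exp (\<lambda>x. (\<phi> i x)\<^sup>2)"
    and bound: "\<And>i. i \<in> I \<Longrightarrow> (\<integral>x. (\<phi> i x)\<^sup>2 \<partial>std_exp) \<le> v i"
  shows "prob {\<omega>\<in>space M. \<epsilon> \<le> \<bar>(\<Sum>i\<in>I. \<phi> i (W i \<omega>)) - (\<Sum>i\<in>I. e i)\<bar>} \<le> (\<Sum>i\<in>I. v i) / \<epsilon>\<^sup>2"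
proof -
  define Y where "Y i \<omega> = \<phi> i (W i \<omega>) - e i" for i \<omega>
  have ind: "indep_vars (\<lambda>_. borel) Y I"
    unfolding Y_def by (rule indep_vars_compose2[OF indep_vars_subset[OF indep I(2)]]) simp
  have m1: "has_bochner_integral M (\<lambda>\<omega>. \<phi> i (W i \<omega>)) (e i)" if "i \<in> I" for i
    by (rule has_bochner_integral_W) (use that I mean in auto)
  have m2: "integrable M (\<lambda>\<omega>. (\<phi> i (W i \<omega>))\<^sup>2) \<and> expectation (\<lambda>\<omega>. (\<phi> i (W i \<omega>))\<^sup>2) \<le> v i" if "i \<in> I" for i
  proof -
    have "has_bochner_integral M (\<lambda>\<omega>. (\<phi> i (W i \<omega>))\<^sup>2) (\<integral>x. (\<phi> i x)\<^sup>2 \<partial>std_exp)"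
      by (rule has_bochner_integral_W[where \<phi> = "\<lambda>x. (\<phi> i x)\<^sup>2"])
         (use that I sq in \<open>auto simp: has_bochner_integral_iff\<close>)
    then show ?thesis
      using bound[OF that] by (simp add: has_bochner_integral_iff)
  qed
  have m: "expectation (Y i) = 0" "integrable M (\<lambda>\<omega>. (Y i \<omega>)\<^sup>2)" "expectation (\<lambda>\<omega>. (Y i \<omega>)\<^sup>2) \<le> v i"
    if i: "i \<in> I" for i
  proof -
    have eq: "(Y i \<omega>)\<^sup>2 = (\<phi> i (W i \<omega>))\<^sup>2 - (2 * e i * \<phi> i (W i \<omega>) - (e i)\<^sup>2)" for \<omega>
      by (simp add: Y_def power2_eq_square algebra_simps)
    show "integrable M (\<lambda>\<omega>. (Y i \<omega>)\<^sup>2)"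
      unfolding eq using m1[OF i] m2[OF i] by (auto simp: has_bochner_integral_iff)
    show "expectation (Y i) = 0"
      unfolding Y_def using m1[OF i] prob_space by (auto simp: has_bochner_integral_iff)
    have "expectation (\<lambda>\<omega>. (Y i \<omega>)\<^sup>2) = expectation (\<lambda>\<omega>. (\<phi> i (W i \<omega>))\<^sup>2) - (e i)\<^sup>2"
      unfolding eq using m1[OF i] m2[OF i] prob_space
      by (auto simp: has_bochner_integral_iff power2_eq_square)
    then show "expectation (\<lambda>\<omega>. (Y i \<omega>)\<^sup>2) \<le> v i"
      using m2[OF i] zero_le_power2[of "e i"] by linarith
  qed
  have sum: "integrable M (\<lambda>\<omega>. (\<Sum>i\<in>I. Y i \<omega>)\<^sup>2)"
      "expectation (\<lambda>\<omega>. (\<Sum>i\<in>I. Y i \<omega>)\<^sup>2) = (\<Sum>i\<in>I. expectation (\<lambda>\<omega>. (Y i \<omega>)\<^sup>2))"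
    using expectation_sum_sq_indep[OF I(1) ind] m(1,2) by blast+
  have "prob {\<omega>\<in>space M. \<epsilon>\<^sup>2 \<le> (\<Sum>i\<in>I. Y i \<omega>)\<^sup>2} \<le> expectation (\<lambda>\<omega>. (\<Sum>i\<in>I. Y i \<omega>)\<^sup>2) / \<epsilon>\<^sup>2"
    by (rule integral_Markov_inequality_measure[where A = "{}"]) (use \<open>\<epsilon> > 0\<close> sum in auto)
  also have "\<dots> \<le> (\<Sum>i\<in>I. v i) / \<epsilon>\<^sup>2"
    unfolding sum(2) using m(3) by (intro divide_right_mono sum_mono) auto
  also have "(\<lambda>\<omega>. \<epsilon>\<^sup>2 \<le> (\<Sum>i\<in>I. Y i \<omega>)\<^sup>2) = (\<lambda>\<omega>. \<epsilon> \<le> \<bar>(\<Sum>i\<in>I. \<phi> i (W i \<omega>)) - (\<Sum>i\<in>I. e i)\<bar>)"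
    using \<open>\<epsilon> > 0\<close> by (auto simp: Y_def sum_subtractf abs_le_square_iff[symmetric])
  finally show ?thesis .
qed

lemma sum_tendsto_whp:
  fixes \<phi> :: "nat \<Rightarrow> 'i \<Rightarrow> real \<Rightarrow> real"
  assumes I: "\<And>n. finite (I n)" "\<And>n. I n \<subseteq> I0"
    and [measurable]: "\<And>n i. \<phi> n i \<in> borel_measurable borel"
    and moments: "\<forall>\<^sub>F n in sequentially. \<forall>i\<in>I n. has_bochner_integral std_exp (\<phi> n i) (e n i) \<and>
      integrable std_exp (\<lambda>x. (\<phi> n i x)\<^sup>2) \<and> (\<integral>x. (\<phi> n i x)\<^sup>2 \<partial>std_exp) \<le> v n i"
    and v: "(\<lambda>n. \<Sum>i\<in>I n. v n i) \<longlonglongrightarrow> 0"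
  shows "((\<lambda>p. (\<Sum>i\<in>I (fst p). \<phi> (fst p) i (W i (snd p))) - (\<Sum>i\<in>I (fst p). e (fst p) i)) \<longlongrightarrow> 0) (whp M)"
proof (rule tendstoI)
  fix \<epsilon> :: real assume \<epsilon>: "\<epsilon> > 0"
  let ?B = "\<lambda>n. {\<omega>\<in>space M. \<epsilon> \<le> \<bar>(\<Sum>i\<in>I n. \<phi> n i (W i \<omega>)) - (\<Sum>i\<in>I n. e n i)\<bar>}"
  show "\<forall>\<^sub>F p in whp M. dist ((\<Sum>i\<in>I (fst p). \<phi> (fst p) i (W i (snd p))) - (\<Sum>i\<in>I (fst p). e (fst p) i)) 0 < \<epsilon>"
  proof (rule eventually_whpI[where B = ?B])
    show "?B n \<in> sets M" for n
    proof -
      have [measurable]: "i \<in> I n \<Longrightarrow> W i \<in> borel_measurable M" for i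
        using I(2)[of n] by (auto intro: measurable_W)
      show ?thesis
        by measurable
    qed
    show "\<forall>\<^sub>F n in sequentially. prob (?B n) \<le> (\<Sum>i\<in>I n. v n i) / \<epsilon>\<^sup>2"
      using moments by eventually_elim (rule sum_Chebyshev, use I \<epsilon> in auto)
    show "(\<lambda>n. (\<Sum>i\<in>I n. v n i) / \<epsilon>\<^sup>2) \<longlonglongrightarrow> 0"
      using tendsto_divide[OF v tendsto_const[of "\<epsilon>\<^sup>2"]] \<epsilon> by simp
  qed (auto simp: dist_norm)
qed

end

text \<open>By \<open>card_exp\<close>, \<open>u n\<close> is the deterministic level that
  \<open>\<kappa> n\<close> of the observations exceed on average; it is the counterpart of the
  random threshold of the Hill estimator.\<close>

locale exponential_array = exponential_sample M W I0
  for M :: "'a measure" and W :: "'i \<Rightarrow> 'a \<Rightarrow> real" and I0 :: "'i set" +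
  fixes I :: "nat \<Rightarrow> 'i set" and \<kappa> :: "nat \<Rightarrow> nat" and u :: "nat \<Rightarrow> real"
  assumes finite_I: "finite (I n)" and I_subset: "I n \<subseteq> I0"
    and kappa_top: "filterlim \<kappa> at_top sequentially"
    and u_top: "filterlim u at_top sequentially"
    and card_exp: "\<forall>\<^sub>F n in sequentially. real (card (I n)) * exp (- u n) = real (\<kappa> n)"
begin

definition excess_sum :: "(real \<Rightarrow> real) \<Rightarrow> nat \<Rightarrow> 'a \<Rightarrow> real" where
  "excess_sum \<phi> n \<omega> = (\<Sum>i\<in>I n. excess \<phi> (u n) (W i \<omega>))"

definition exceedances :: "nat \<Rightarrow> 'a \<Rightarrow> real" where
  "exceedances n \<omega> = real (card {i\<in>I n. u n < W i \<omega>})"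

lemma sum_excess_one: "(\<Sum>i\<in>I n. excess (\<lambda>_. 1) x (W i \<omega>)) = real (card {i\<in>I n. x < W i \<omega>})"
  using finite_I by (simp add: excess_def sum.If_cases Int_def)

lemma kappa_real_top: "filterlim (\<lambda>n. real (\<kappa> n)) at_top sequentially"
  using filterlim_compose[OF filterlim_real_sequentially kappa_top] .

lemma sqrt_kappa_top: "filterlim (\<lambda>n. sqrt (real (\<kappa> n))) at_top sequentially"
  using filterlim_compose[OF sqrt_at_top kappa_real_top] .

lemma kappa_pos: "\<forall>\<^sub>F n in sequentially. \<kappa> n > 0"
proof -
  have "\<forall>\<^sub>F n in sequentially. 1 \<le> \<kappa> n"
    using kappa_top unfolding filterlim_at_top by blast
  then show ?thesis
    by (auto elim: eventually_mono)
qed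

lemma u_nonneg: "\<forall>\<^sub>F n in sequentially. u n \<ge> 0"
  using u_top by (simp add: filterlim_at_top)

lemma excess_sum_sets:
  assumes [measurable]: "\<phi> \<in> borel_measurable borel"
  shows "{\<omega>\<in>space M. \<epsilon> \<le> \<bar>excess_sum \<phi> n \<omega> - c\<bar>} \<in> sets M"
proof -
  have [measurable]: "i \<in> I n \<Longrightarrow> W i \<in> borel_measurable M" for i
    using I_subset[of n] by (auto intro: measurable_W)
  show ?thesis
    unfolding excess_sum_def by measurable
qed

lemma excess_sum_bounded:
  assumes \<phi>: "\<phi> \<in> borel_measurable borel"
    and mean: "has_bochner_integral std_exp \<phi> c"
    and sq: "has_bochner_integral std_exp (\<lambda>x. (\<phi> x)\<^sup>2) d"
  shows "stochastically_bounded (\<lambda>n \<omega>. (excess_sum \<phi> n \<omega> - real (\<kappa> n) * c) / sqrt (real (\<kappa> n)))"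
  unfolding stochastically_bounded_def
proof (intro allI impI)
  fix \<eta> :: real assume \<eta>: "\<eta> > 0"
  \<comment> \<open>Chebyshev's inequality will give the bound \<open>d / C\<^sup>2\<close>, which
    this choice puts below \<open>\<eta>\<close>.\<close>
  define C where "C = sqrt ((\<bar>d\<bar> + 1) / \<eta>)"
  have C2: "C\<^sup>2 = (\<bar>d\<bar> + 1) / \<eta>"
    using \<eta> by (simp add: C_def)
  have C: "C > 0"
    using \<eta> by (simp add: C_def add_nonneg_pos)
  have "\<forall>\<^sub>F n in sequentially. \<exists>B\<in>sets M. prob B < \<eta> \<and>
      (\<forall>\<omega>\<in>space M - B. \<bar>(excess_sum \<phi> n \<omega> - real (\<kappa> n) * c) / sqrt (real (\<kappa> n))\<bar> \<le> C)"
    using card_exp u_nonneg kappa_pos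
  proof eventually_elim
    case (elim n)
    define \<epsilon> where "\<epsilon> = C * sqrt (real (\<kappa> n))"
    have \<epsilon>: "\<epsilon> > 0"
      using C elim by (simp add: \<epsilon>_def)
    let ?B = "{\<omega>\<in>space M. \<epsilon> \<le> \<bar>excess_sum \<phi> n \<omega> - real (\<kappa> n) * c\<bar>}"
    have "has_bochner_integral std_exp (excess \<phi> (u n)) (exp (- u n) * c)"
      by (rule std_exp_excess[OF mean elim(2)])
    moreover have "has_bochner_integral std_exp (\<lambda>x. (excess \<phi> (u n) x)\<^sup>2) (exp (- u n) * d)"
      using std_exp_excess[OF sq elim(2)] by (simp add: excess_power)
    ultimately have "prob {\<omega>\<in>space M. \<epsilon> \<le> \<bar>(\<Sum>i\<in>I n. excess \<phi> (u n) (W i \<omega>)) - (\<Sum>i\<in>I n. exp (- u n) * c)\<bar>}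
        \<le> (\<Sum>i\<in>I n. exp (- u n) * d) / \<epsilon>\<^sup>2"
      by (intro sum_Chebyshev) (use finite_I I_subset \<epsilon> \<phi> in \<open>auto simp: has_bochner_integral_iff\<close>)
    then have "prob ?B \<le> real (\<kappa> n) * d / \<epsilon>\<^sup>2"
      using elim(1) by (simp add: excess_sum_def mult.assoc[symmetric])
    also have "\<dots> = d / C\<^sup>2"
      using elim(3) by (simp add: \<epsilon>_def power_mult_distrib)
    also have "\<dots> < \<eta>"
    proof -
      have "d < \<bar>d\<bar> + 1"
        by linarith
      also have "\<dots> = \<eta> * C\<^sup>2"
        using \<eta> by (simp add: C2)
      finally show ?thesis
        using C by (simp add: field_simps)
    qed
    finally have "prob ?B < \<eta>" .
    moreover have "\<bar>(excess_sum \<phi> n \<omega> - real (\<kappa> n) * c) / sqrt (real (\<kappa> n))\<bar> \<le> C"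
      if "\<omega> \<in> space M - ?B" for \<omega>
      using that elim(3) by (auto simp: \<epsilon>_def abs_divide field_simps)
    ultimately show ?case
      using excess_sum_sets[OF \<phi>] by blast
  qed
  then show "\<exists>C. \<forall>\<^sub>F n in sequentially. \<exists>B\<in>sets M. prob B < \<eta> \<and>
      (\<forall>\<omega>\<in>space M - B. \<bar>(excess_sum \<phi> n \<omega> - real (\<kappa> n) * c) / sqrt (real (\<kappa> n))\<bar> \<le> C)"
    by blast
qed

lemma inverse_sqrt_kappa: "((\<lambda>p. 1 / sqrt (real (\<kappa> (fst p)))) \<longlongrightarrow> 0) (whp M)"
proof (rule tendsto_whp_fst[of "\<lambda>n. 1 / sqrt (real (\<kappa> n))"])
  show "(\<lambda>n. 1 / sqrt (real (\<kappa> n))) \<longlonglongrightarrow> 0"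
    using tendsto_divide_0[OF tendsto_const filterlim_at_top_imp_at_infinity[OF sqrt_kappa_top]] .
qed

lemma excess_mean_tendsto:
  assumes "\<phi> \<in> borel_measurable borel"
    and "has_bochner_integral std_exp \<phi> c"
    and "has_bochner_integral std_exp (\<lambda>x. (\<phi> x)\<^sup>2) d"
  shows "((\<lambda>p. excess_sum \<phi> (fst p) (snd p) / real (\<kappa> (fst p))) \<longlongrightarrow> c) (whp M)"
proof -
  have "((\<lambda>p. (excess_sum \<phi> (fst p) (snd p) - real (\<kappa> (fst p)) * c) / sqrt (real (\<kappa> (fst p)))
      * (1 / sqrt (real (\<kappa> (fst p)))) + c) \<longlongrightarrow> 0 + c) (whp M)"
    by (intro tendsto_add tendsto_const
        stochastically_bounded_mult[OF excess_sum_bounded[OF assms], of "\<lambda>n _. 1 / sqrt (real (\<kappa> n))"]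
        inverse_sqrt_kappa)
  then have "((\<lambda>p. (excess_sum \<phi> (fst p) (snd p) - real (\<kappa> (fst p)) * c) / sqrt (real (\<kappa> (fst p)))
      * (1 / sqrt (real (\<kappa> (fst p)))) + c) \<longlongrightarrow> c) (whp M)"
    by simp
  then show ?thesis
  proof (rule Lim_transform_eventually)
    show "\<forall>\<^sub>F p in whp M. (excess_sum \<phi> (fst p) (snd p) - real (\<kappa> (fst p)) * c) / sqrt (real (\<kappa> (fst p)))
      * (1 / sqrt (real (\<kappa> (fst p)))) + c = excess_sum \<phi> (fst p) (snd p) / real (\<kappa> (fst p))"
      using eventually_whp_fst[OF kappa_pos] by eventually_elim (simp add: field_simps)
  qed
qed

lemma exceedances_bounded:
  "stochastically_bounded (\<lambda>n \<omega>. (exceedances n \<omega> - real (\<kappa> n)) / sqrt (real (\<kappa> n)))"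
proof -
  have "has_bochner_integral std_exp (\<lambda>_. 1 :: real) 1"
    using std_exp_moment[of 0] by simp
  then have "stochastically_bounded (\<lambda>n \<omega>. (excess_sum (\<lambda>_. 1) n \<omega> - real (\<kappa> n) * 1) / sqrt (real (\<kappa> n)))"
    by (intro excess_sum_bounded) auto
  then show ?thesis
    by (simp add: excess_sum_def sum_excess_one exceedances_def)
qed

text \<open>Stochastic equicontinuity of the tail count. The two indicators differ only on an
  interval of length of order \<open>1 / sqrt \<kappa>\<close>, so the variance of the change is
  \<open>o(\<kappa>)\<close> and the change is its mean up to \<open>o(sqrt \<kappa>)\<close> in
  probability.\<close>

lemma exceedances_shift:
  "((\<lambda>p. (real (card {i\<in>I (fst p). u (fst p) + t / sqrt (real (\<kappa> (fst p))) < W i (snd p)})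
        - real (\<kappa> (fst p)) * exp (- t / sqrt (real (\<kappa> (fst p)))) - (exceedances (fst p) (snd p) - real (\<kappa> (fst p))))
      / sqrt (real (\<kappa> (fst p)))) \<longlongrightarrow> 0) (whp M)"
proof -
  define s where "s n = sqrt (real (\<kappa> n))" for n
  define \<delta> where "\<delta> n = t / s n" for n
  have \<delta>0: "\<delta> \<longlonglongrightarrow> 0"
    unfolding \<delta>_def s_def
    using tendsto_divide_0[OF tendsto_const filterlim_at_top_imp_at_infinity[OF sqrt_kappa_top]] .
  have shifted: "\<forall>\<^sub>F n in sequentially. u n + \<delta> n \<ge> 0"
    using filterlim_tendsto_add_at_top[OF \<delta>0 u_top] by (simp add: filterlim_at_top add.commute)
  have sq0: "(\<lambda>n. \<bar>exp (- \<delta> n) - 1\<bar>) \<longlonglongrightarrow> 0"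
    using tendsto_rabs[OF tendsto_diff[OF tendsto_exp[OF tendsto_minus[OF \<delta>0]] tendsto_const[of 1]]] by simp
  define \<phi> where "\<phi> n x = (excess (\<lambda>_. 1) (u n + \<delta> n) x - excess (\<lambda>_. 1) (u n) x) / s n" for n x
  have one: "has_bochner_integral std_exp (\<lambda>_. 1 :: real) 1"
    using std_exp_moment[of 0] by simp
  have "((\<lambda>p. (\<Sum>i\<in>I (fst p). \<phi> (fst p) (W i (snd p))) -
      (\<Sum>i\<in>I (fst p). exp (- u (fst p)) * (exp (- \<delta> (fst p)) - 1) / s (fst p))) \<longlongrightarrow> 0) (whp M)"
  proof (rule sum_tendsto_whp[OF finite_I I_subset, where \<phi> = "\<lambda>n i. \<phi> n" and
      v = "\<lambda>n i. exp (- u n) * \<bar>exp (- \<delta> n) - 1\<bar> / real (\<kappa> n)"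
      and e = "\<lambda>n i. exp (- u n) * (exp (- \<delta> n) - 1) / s n"])
    show "\<phi> n \<in> borel_measurable borel" for n
      unfolding \<phi>_def by measurable
    show "\<forall>\<^sub>F n in sequentially. \<forall>i\<in>I n.
        has_bochner_integral std_exp (\<phi> n) (exp (- u n) * (exp (- \<delta> n) - 1) / s n) \<and>
        integrable std_exp (\<lambda>x. (\<phi> n x)\<^sup>2) \<and>
        (\<integral>x. (\<phi> n x)\<^sup>2 \<partial>std_exp) \<le> exp (- u n) * \<bar>exp (- \<delta> n) - 1\<bar> / real (\<kappa> n)"
      using shifted u_nonneg
    proof eventually_elim
      case (elim n)
      have e1: "has_bochner_integral std_exp (excess (\<lambda>_. 1) (u n + \<delta> n)) (exp (- (u n + \<delta> n)) * 1)"
        and e2: "has_bochner_integral std_exp (excess (\<lambda>_. 1) (u n)) (exp (- u n) * 1)"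
        by (intro std_exp_excess one elim)+
      have mean: "has_bochner_integral std_exp (\<phi> n) ((exp (- (u n + \<delta> n)) * 1 - exp (- u n) * 1) / s n)"
        unfolding \<phi>_def[abs_def] by (intro has_bochner_integral_divide has_bochner_integral_diff e1 e2)
      have sn2: "(s n)\<^sup>2 = real (\<kappa> n)"
        by (simp add: s_def)
      \<comment> \<open>The difference of the indicators takes only the values 0 and
        \<open>\<sigma>\<close>, so its square is \<open>\<sigma>\<close> times it and the second
        moment is read off from the means.\<close>
      define \<sigma> :: real where "\<sigma> = (if \<delta> n \<ge> 0 then -1 else 1)"
      have sq: "(\<phi> n x)\<^sup>2 = \<sigma> * (excess (\<lambda>_. 1) (u n + \<delta> n) x - excess (\<lambda>_. 1) (u n) x) / real (\<kappa> n)" for x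
        by (auto simp: \<phi>_def excess_def sn2 \<sigma>_def power_divide)
      have diff: "exp (- (u n + \<delta> n)) * 1 - exp (- u n) * 1 = exp (- u n) * (exp (- \<delta> n) - 1)"
        by (simp add: exp_add exp_diff exp_minus field_simps)
      have \<sigma>: "\<sigma> * (exp (- \<delta> n) - 1) = \<bar>exp (- \<delta> n) - 1\<bar>"
        by (auto simp: \<sigma>_def)
      have var: "\<sigma> * (exp (- (u n + \<delta> n)) * 1 - exp (- u n) * 1) = exp (- u n) * \<bar>exp (- \<delta> n) - 1\<bar>"
        unfolding diff \<sigma>[symmetric] by (rule mult.left_commute)
      have "has_bochner_integral std_exp (\<lambda>x. (\<phi> n x)\<^sup>2)
          (exp (- u n) * \<bar>exp (- \<delta> n) - 1\<bar> / real (\<kappa> n))"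
        unfolding sq var[symmetric] by (intro has_bochner_integral_divide has_bochner_integral_mult_right has_bochner_integral_diff e1 e2)
      then show ?case
        using mean unfolding diff by (auto simp: has_bochner_integral_iff)
    qed
    show "(\<lambda>n. \<Sum>i\<in>I n. exp (- u n) * \<bar>exp (- \<delta> n) - 1\<bar> / real (\<kappa> n)) \<longlonglongrightarrow> 0"
      using sq0
    proof (rule Lim_transform_eventually)
      show "\<forall>\<^sub>F n in sequentially. \<bar>exp (- \<delta> n) - 1\<bar> = (\<Sum>i\<in>I n. exp (- u n) * \<bar>exp (- \<delta> n) - 1\<bar> / real (\<kappa> n))"
        using card_exp kappa_pos by eventually_elim (simp add: mult.assoc[symmetric])
    qed
  qed
  then show ?thesis
  proof (rule Lim_transform_eventually)
    show "\<forall>\<^sub>F p in whp M. (\<Sum>i\<in>I (fst p). \<phi> (fst p) (W i (snd p))) -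
      (\<Sum>i\<in>I (fst p). exp (- u (fst p)) * (exp (- \<delta> (fst p)) - 1) / s (fst p)) =
      (real (card {i\<in>I (fst p). u (fst p) + t / sqrt (real (\<kappa> (fst p))) < W i (snd p)})
        - real (\<kappa> (fst p)) * exp (- t / sqrt (real (\<kappa> (fst p)))) - (exceedances (fst p) (snd p) - real (\<kappa> (fst p))))
      / sqrt (real (\<kappa> (fst p)))"
      using eventually_whp_fst[OF card_exp]
      by eventually_elim
        (simp add: \<phi>_def sum_divide_distrib[symmetric] sum_subtractf sum_excess_one exceedances_def s_def \<delta>_def
          mult.assoc[symmetric] diff_divide_distrib add_divide_distrib algebra_simps)
  qed
qed

lemma sqrt_kappa_exp_tendsto: "(\<lambda>n. sqrt (real (\<kappa> n)) * (1 - exp (- t / sqrt (real (\<kappa> n))))) \<longlonglongrightarrow> t"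
proof -
  have "((\<lambda>x::real. x * (1 - exp (- t / x))) \<longlongrightarrow> t) at_top"
    by real_asymp
  from filterlim_compose[OF this sqrt_kappa_top] show ?thesis .
qed

text \<open>A Bahadur representation of the empirical quantile \<open>w\<close>.\<close>

lemma empirical_quantile_expansion:
  assumes w: "\<forall>\<^sub>F p in whp M. \<forall>x. x < w (fst p) (snd p) \<longleftrightarrow> \<kappa> (fst p) < card {i\<in>I (fst p). x < W i (snd p)}"
  shows "((\<lambda>p. sqrt (real (\<kappa> (fst p))) * (w (fst p) (snd p) - u (fst p))
      - (exceedances (fst p) (snd p) - real (\<kappa> (fst p))) / sqrt (real (\<kappa> (fst p)))) \<longlongrightarrow> 0) (whp M)"
proof (rule tendsto_diff_whp_of_levels[where V = "\<lambda>n \<omega>. sqrt (real (\<kappa> n)) * (w n \<omega> - u n)", OF exceedances_bounded])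
  fix t \<epsilon> :: real assume \<epsilon>: "\<epsilon> > 0"
  let ?s = "\<lambda>p. sqrt (real (\<kappa> (fst p)))"
  let ?N = "\<lambda>p. real (card {i\<in>I (fst p). u (fst p) + t / ?s p < W i (snd p)})"
  let ?U = "\<lambda>p. (exceedances (fst p) (snd p) - real (\<kappa> (fst p))) / ?s p"
  have "\<epsilon> / 2 > 0"
    using \<epsilon> by simp
  have close: "\<forall>\<^sub>F p in whp M. \<bar>(?N p - real (\<kappa> (fst p)) * exp (- t / ?s p) - (exceedances (fst p) (snd p) - real (\<kappa> (fst p)))) / ?s p\<bar> < \<epsilon> / 2"
    using tendstoD[OF exceedances_shift[of t] \<open>\<epsilon> / 2 > 0\<close>] by (simp add: dist_norm)
  have c: "\<forall>\<^sub>F p in whp M. \<bar>?s p * (1 - exp (- t / ?s p)) - t\<bar> < \<epsilon> / 2"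
    using eventually_whp_fst[OF tendstoD[OF sqrt_kappa_exp_tendsto[of t] \<open>\<epsilon> / 2 > 0\<close>]] by (simp add: dist_norm)
  have split: "\<forall>\<^sub>F p in whp M. \<bar>(?N p - real (\<kappa> (fst p))) / ?s p + ?s p * (1 - exp (- t / ?s p)) - ?U p\<bar> < \<epsilon> / 2"
    using close eventually_whp_fst[OF kappa_pos]
  proof eventually_elim
    case (elim p)
    have "real (\<kappa> (fst p)) / ?s p = ?s p"
      by (simp add: real_div_sqrt)
    then have eq: "(?N p - real (\<kappa> (fst p)) * exp (- t / ?s p) - (exceedances (fst p) (snd p) - real (\<kappa> (fst p)))) / ?s p
      = (?N p - real (\<kappa> (fst p))) / ?s p + ?s p * (1 - exp (- t / ?s p)) - ?U p"
      by (simp add: diff_divide_distrib right_diff_distrib times_divide_eq_left[symmetric] del: times_divide_eq_left)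
    show ?case
      using elim(1) unfolding eq .
  qed
  \<comment> \<open>This makes Ghosh's argument applicable: the position of the quantile relative to
    a level is the sign of the centered count above that level, and by \<open>split\<close> and
    \<open>c\<close> this count equals \<open>U - t\<close> up to \<open>\<epsilon>\<close>.\<close>
  have level: "\<forall>\<^sub>F p in whp M. t < ?s p * (w (fst p) (snd p) - u (fst p)) \<longleftrightarrow> (?N p - real (\<kappa> (fst p))) / ?s p > 0"
    using w eventually_whp_fst[OF kappa_pos]
  proof eventually_elim
    case (elim p)
    have "t < ?s p * (w (fst p) (snd p) - u (fst p)) \<longleftrightarrow> u (fst p) + t / ?s p < w (fst p) (snd p)"
      using elim(2) by (simp add: field_simps)
    also have "\<dots> \<longleftrightarrow> real (\<kappa> (fst p)) < ?N p"
      using elim(1) by simp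
    finally show ?case
      using elim(2) by (simp add: zero_less_divide_iff)
  qed
  show "\<forall>\<^sub>F p in whp M. ?s p * (w (fst p) (snd p) - u (fst p)) > t \<longrightarrow> ?U p > t - \<epsilon>"
    using level split c by eventually_elim linarith
  show "\<forall>\<^sub>F p in whp M. ?s p * (w (fst p) (snd p) - u (fst p)) \<le> t \<longrightarrow> ?U p < t + \<epsilon>"
    using level split c by eventually_elim linarith
qed

end

lemma std_exp_box_cox_sq:
  assumes "\<rho> \<le> 0"
  shows "integrable std_exp (\<lambda>x. (box_cox \<rho> x)\<^sup>2)"
proof (rule Bochner_Integration.integrable_bound)
  show "integrable std_exp (\<lambda>x. x ^ 2)"
    using std_exp_moment[of 2] by (simp add: has_bochner_integral_iff)
  have [measurable]: "box_cox \<rho> \<in> borel_measurable borel"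
    by (intro borel_measurable_continuous_onI continuous_box_cox)
  show "(\<lambda>x. (box_cox \<rho> x)\<^sup>2) \<in> borel_measurable std_exp"
    by measurable
  show "AE x in std_exp. norm ((box_cox \<rho> x)\<^sup>2) \<le> norm (x ^ 2)"
    using AE_std_exp_pos
    by eventually_elim (use box_cox_bounds[OF assms] in \<open>auto intro!: power_mono\<close>)
qed

context exponential_array
begin

text \<open>A law of large numbers. The Potter bound replaces each increment by
  \<open>box_cox \<rho>\<close> of the excess at the cost of
  \<open>\<epsilon> / 4 * exp (s / 4)\<close>. The mean of \<open>exp (s / 4)\<close> is
  \<open>4 / 3 < 2\<close>, so the total cost is at most \<open>\<epsilon> / 2\<close> with high
  probability.\<close>

lemma second_order_excess_tendsto:
  assumes "second_order_variation f a \<rho>"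
  shows "((\<lambda>p. (\<Sum>i\<in>I (fst p). if u (fst p) < W i (snd p) then (f (W i (snd p)) - f (u (fst p))) / a (u (fst p)) else 0)
      / real (\<kappa> (fst p))) \<longlongrightarrow> 1 / (1 - \<rho>)) (whp M)" (is "(?T \<longlongrightarrow> _) _")
proof -
  interpret second_order_variation f a \<rho> by fact
  let ?h = "box_cox \<rho>"
  let ?e = "\<lambda>x::real. exp (x / 4)"
  have [measurable]: "?h \<in> borel_measurable borel"
    by (intro borel_measurable_continuous_onI continuous_box_cox)
  have H: "((\<lambda>p. excess_sum ?h (fst p) (snd p) / real (\<kappa> (fst p))) \<longlongrightarrow> 1 / (1 - \<rho>)) (whp M)"
    by (rule excess_mean_tendsto[OF _ std_exp_box_cox[OF rho_nonpos]
          has_bochner_integral_integrable[OF std_exp_box_cox_sq[OF rho_nonpos]]]) simp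
  have E: "((\<lambda>p. excess_sum ?e (fst p) (snd p) / real (\<kappa> (fst p))) \<longlongrightarrow> 4 / 3) (whp M)"
  proof (rule excess_mean_tendsto)
    show "has_bochner_integral std_exp ?e (4 / 3)"
      using std_exp_exp[of "1 / 4"] by (simp add: mult.commute)
    have "has_bochner_integral std_exp (\<lambda>x. exp ((1 / 2) * x)) (1 / (1 - 1 / 2))"
      by (rule std_exp_exp) simp
    moreover have "exp ((1 / 2) * x) = (exp (x / 4))\<^sup>2" for x :: real
      by (simp add: power2_eq_square exp_add[symmetric])
    ultimately show "has_bochner_integral std_exp (\<lambda>x. (?e x)\<^sup>2) (1 / (1 - 1 / 2))"
      by simp
  qed measurable
  show ?thesis
  proof (rule tendstoI)
    fix \<epsilon> :: real assume \<epsilon>: "\<epsilon> > 0"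
    have "\<epsilon> / 4 > 0"
      using \<epsilon> by simp
    have close: "\<forall>\<^sub>F p in whp M. \<forall>s\<ge>0.
        \<bar>(f (u (fst p) + s) - f (u (fst p))) / a (u (fst p)) - ?h s\<bar> \<le> \<epsilon> / 4 * exp (s / 4)"
      using eventually_whp_fst[OF eventually_compose_filterlim[OF increment_potter[OF \<open>\<epsilon> / 4 > 0\<close>] u_top]] .
    have "\<forall>\<^sub>F p in whp M. excess_sum ?e (fst p) (snd p) / real (\<kappa> (fst p)) < 2"
      by (rule order_tendstoD[OF E]) simp
    moreover have "\<epsilon> / 2 > 0"
      using \<epsilon> by simp
    note tendstoD[OF H this]
    ultimately show "\<forall>\<^sub>F p in whp M. dist (?T p) (1 / (1 - \<rho>)) < \<epsilon>"
      using close eventually_whp_fst[OF kappa_pos]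
    proof eventually_elim
      case (elim p)
      have "\<bar>(\<Sum>i\<in>I (fst p). if u (fst p) < W i (snd p) then (f (W i (snd p)) - f (u (fst p))) / a (u (fst p)) else 0)
          - excess_sum ?h (fst p) (snd p)\<bar>
        \<le> (\<Sum>i\<in>I (fst p). \<epsilon> / 4 * excess ?e (u (fst p)) (W i (snd p)))"
        unfolding excess_sum_def sum_subtractf[symmetric]
      proof (rule order.trans[OF sum_abs sum_mono])
        fix i
        show "\<bar>(if u (fst p) < W i (snd p) then (f (W i (snd p)) - f (u (fst p))) / a (u (fst p)) else 0)
            - excess ?h (u (fst p)) (W i (snd p))\<bar> \<le> \<epsilon> / 4 * excess ?e (u (fst p)) (W i (snd p))"
          using elim(3)[rule_format, of "W i (snd p) - u (fst p)"] by (simp add: excess_def)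
      qed
      also have "\<dots> = \<epsilon> / 4 * excess_sum ?e (fst p) (snd p)"
        by (simp add: excess_sum_def sum_distrib_left)
      finally have "\<bar>(\<Sum>i\<in>I (fst p). if u (fst p) < W i (snd p) then (f (W i (snd p)) - f (u (fst p))) / a (u (fst p)) else 0)
          - excess_sum ?h (fst p) (snd p)\<bar> \<le> \<epsilon> / 4 * excess_sum ?e (fst p) (snd p)" .
      from divide_right_mono[OF this, of "real (\<kappa> (fst p))"]
      have "\<bar>?T p - excess_sum ?h (fst p) (snd p) / real (\<kappa> (fst p))\<bar>
          \<le> \<epsilon> / 4 * (excess_sum ?e (fst p) (snd p) / real (\<kappa> (fst p)))"
        by (simp add: diff_divide_distrib[symmetric] abs_divide)
      also have "\<dots> \<le> \<epsilon> / 4 * 2"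
        using elim(1) \<epsilon> by (intro mult_left_mono) auto
      finally show ?case
        using elim(2) unfolding dist_real_def by linarith
    qed
  qed
qed

lemma empirical_quantile_counts:
  assumes "finite J" and w: "\<And>x. x < w \<longleftrightarrow> k < card {i\<in>J. x < V i}"
  shows "card {i\<in>J. w < V i} \<le> k" and "k \<le> card {i\<in>J. w \<le> (V i :: real)}"
proof -
  show "card {i\<in>J. w < V i} \<le> k"
    using w[of w] by simp
  \<comment> \<open>No observation lies strictly between \<open>Max T\<close> and \<open>w\<close>,
    so counting above \<open>Max T\<close> counts from \<open>w\<close> on. The element
    \<open>w - 1\<close> makes the set nonempty.\<close>
  define T where "T = insert (w - 1) {V i |i. i \<in> J \<and> V i < w}"
  have T: "finite T" "T \<noteq> {}"
    using \<open>finite J\<close> by (auto simp: T_def)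
  have "Max T < w"
    using T by (subst Max_less_iff) (auto simp: T_def)
  then have "k < card {i\<in>J. Max T < V i}"
    by (simp add: w)
  also have "\<dots> \<le> card {i\<in>J. w \<le> V i}"
  proof (rule card_mono)
    show "{i\<in>J. Max T < V i} \<subseteq> {i\<in>J. w \<le> V i}"
    proof safe
      fix i assume i: "i \<in> J" "Max T < V i"
      show "w \<le> V i"
      proof (rule ccontr)
        assume "\<not> w \<le> V i"
        with i have "V i \<in> T"
          by (auto simp: T_def)
        then show False
          using Max_ge[OF T(1)] i(2) by force
      qed
    qed
  qed (use \<open>finite J\<close> in simp)
  finally show "k \<le> card {i\<in>J. w \<le> V i}"
    by simp
qed

text \<open>Moving the threshold from \<open>u\<close> to \<open>w\<close> changes the sum by
  \<open>\<kappa> * (\<gamma> * d + D)\<close> up to a remainder. The Bahadur representation turns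
  \<open>\<kappa> * d\<close> into the surplus of exceedances over \<open>\<kappa>\<close>, and
  subtracting it replaces the excess \<open>s\<close> by the centered \<open>s - 1\<close>. The
  function \<open>f\<close> contributes only the deterministic bias.\<close>

theorem hill_expansion:
  assumes "second_order_variation f a \<rho>"
    and V: "mono_on {w0..} (\<lambda>x. f x + \<gamma> * x)"
    and bias: "(\<lambda>n. sqrt (real (\<kappa> n)) * a (u n)) \<longlonglongrightarrow> lam"
    and w: "\<forall>\<^sub>F p in whp M. \<forall>x. x < w (fst p) (snd p) \<longleftrightarrow> \<kappa> (fst p) < card {i\<in>I (fst p). x < W i (snd p)}"
    and H: "\<forall>\<^sub>F p in whp M. w0 \<le> w (fst p) (snd p) \<longrightarrow> real (\<kappa> (fst p)) * H (fst p) (snd p) =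
      (\<Sum>i\<in>I (fst p). if w (fst p) (snd p) < W i (snd p)
        then (f (W i (snd p)) + \<gamma> * W i (snd p)) - (f (w (fst p) (snd p)) + \<gamma> * w (fst p) (snd p)) else 0)"
  shows "((\<lambda>p. sqrt (real (\<kappa> (fst p))) * (H (fst p) (snd p) - \<gamma>)
      - \<gamma> * excess_sum (\<lambda>s. s - 1) (fst p) (snd p) / sqrt (real (\<kappa> (fst p)))) \<longlongrightarrow> lam / (1 - \<rho>)) (whp M)"
proof -
  interpret second_order_variation f a \<rho> by fact
  define s where "s p = sqrt (real (\<kappa> (fst p)))" for p :: "nat \<times> 'a"
  define d where "d p = w (fst p) (snd p) - u (fst p)" for p
  define U where "U p = (exceedances (fst p) (snd p) - real (\<kappa> (fst p))) / s p" for p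
  define D where "D p = f (w (fst p) (snd p)) - f (u (fst p))" for p
  define T where "T p = (\<Sum>i\<in>I (fst p). if u (fst p) < W i (snd p) then (f (W i (snd p)) - f (u (fst p))) / a (u (fst p)) else 0)
      / real (\<kappa> (fst p))" for p
  define S where "S p = (\<Sum>i\<in>I (fst p). if u (fst p) < W i (snd p)
      then (f (W i (snd p)) + \<gamma> * W i (snd p)) - (f (u (fst p)) + \<gamma> * u (fst p)) else 0)" for p
  define R where "R p = real (\<kappa> (fst p)) * H (fst p) (snd p) - (S p - real (\<kappa> (fst p)) * (\<gamma> * d p + D p))" for p
  let ?F = "whp M"
  have s_pos: "\<forall>\<^sub>F p in ?F. s p > 0"
    using eventually_whp_fst[OF kappa_pos] by eventually_elim (simp add: s_def)
  have ss: "s p * s p = real (\<kappa> (fst p))" for p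
    by (simp add: s_def)
  have is0: "((\<lambda>p. 1 / s p) \<longlongrightarrow> 0) ?F"
    using inverse_sqrt_kappa by (simp add: s_def)
  have vU: "((\<lambda>p. s p * d p - U p) \<longlongrightarrow> 0) ?F"
    using empirical_quantile_expansion[OF w] by (simp add: s_def d_def U_def)
  have UZ: "((\<lambda>p. U p * Z p) \<longlongrightarrow> 0) ?F" if "(Z \<longlongrightarrow> 0) ?F" for Z
    using stochastically_bounded_mult[OF exceedances_bounded, of "\<lambda>n \<omega>. Z (n, \<omega>)"] that
    by (simp add: U_def s_def)
  have d0: "(d \<longlongrightarrow> 0) ?F"
  proof -
    have "((\<lambda>p. (s p * d p - U p) * (1 / s p) + U p * (1 / s p)) \<longlongrightarrow> 0 * 0 + 0) ?F"
      by (intro tendsto_add tendsto_mult vU is0 UZ)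
    moreover have "\<forall>\<^sub>F p in ?F. (s p * d p - U p) * (1 / s p) + U p * (1 / s p) = d p"
      using s_pos by eventually_elim (simp add: field_simps)
    ultimately have "(d \<longlongrightarrow> 0 * 0 + 0) ?F"
      by (rule Lim_transform_eventually)
    then show ?thesis
      by simp
  qed
  have u_whp: "filterlim (\<lambda>p. u (fst p)) at_top ?F"
    using filterlim_compose[OF u_top filterlim_fst_whp] .
  have sa: "((\<lambda>p. s p * a (u (fst p))) \<longlongrightarrow> lam) ?F"
    using tendsto_whp_fst[OF bias] by (simp add: s_def)
  have Da: "((\<lambda>p. D p / a (u (fst p))) \<longlongrightarrow> 0) ?F"
  proof -
    have "((\<lambda>p. D p / a (u (fst p)) - box_cox \<rho> (d p)) \<longlongrightarrow> 0) ?F"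
    proof (rule tendstoI)
      fix \<epsilon> :: real assume \<epsilon>: "\<epsilon> > 0"
      then have "\<epsilon> / 2 > 0"
        by simp
      from eventually_compose_filterlim[OF increment_uniform[OF this, of "-1" 1] u_whp] tendstoD[OF d0 zero_less_one]
      show "\<forall>\<^sub>F p in ?F. dist (D p / a (u (fst p)) - box_cox \<rho> (d p)) 0 < \<epsilon>"
      proof eventually_elim
        case (elim p)
        have "d p \<in> {-1..1}"
          using elim(2) by (auto simp: dist_real_def)
        from bspec[OF elim(1) this] show ?case
          using \<epsilon> by (simp add: D_def d_def)
      qed
    qed
    moreover have "((\<lambda>p. box_cox \<rho> (d p)) \<longlongrightarrow> box_cox \<rho> 0) ?F"
      by (rule isCont_tendsto_compose[OF _ d0])
         (use continuous_box_cox in \<open>simp add: continuous_on_eq_continuous_at\<close>)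
    ultimately show ?thesis
      using tendsto_add by fastforce
  qed
  have a_nz: "\<forall>\<^sub>F p in ?F. a (u (fst p)) \<noteq> 0"
    using eventually_compose_filterlim[OF a_nonzero u_whp] .
  \<comment> \<open>\<open>sqrt \<kappa> * a (u n)\<close> converges, while \<open>D\<close> is of
    smaller order than \<open>a (u n)\<close> because \<open>d\<close> tends to 0.\<close>
  have sD: "((\<lambda>p. s p * D p) \<longlongrightarrow> 0) ?F"
  proof -
    have "((\<lambda>p. (s p * a (u (fst p))) * (D p / a (u (fst p)))) \<longlongrightarrow> lam * 0) ?F"
      by (intro tendsto_mult sa Da)
    moreover have "\<forall>\<^sub>F p in ?F. (s p * a (u (fst p))) * (D p / a (u (fst p))) = s p * D p"
      using a_nz by eventually_elim simp
    ultimately have "((\<lambda>p. s p * D p) \<longlongrightarrow> lam * 0) ?F"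
      by (rule Lim_transform_eventually)
    then show ?thesis
      by simp
  qed
  have VD: "((\<lambda>p. \<gamma> * d p + D p) \<longlongrightarrow> 0) ?F"
  proof -
    have "((\<lambda>p. \<gamma> * d p + (s p * D p) * (1 / s p)) \<longlongrightarrow> \<gamma> * 0 + 0 * 0) ?F"
      by (intro tendsto_intros d0 sD is0)
    moreover have "\<forall>\<^sub>F p in ?F. \<gamma> * d p + (s p * D p) * (1 / s p) = \<gamma> * d p + D p"
      using s_pos by eventually_elim simp
    ultimately have "((\<lambda>p. \<gamma> * d p + D p) \<longlongrightarrow> \<gamma> * 0 + 0 * 0) ?F"
      by (rule Lim_transform_eventually)
    then show ?thesis
      by simp
  qed
  \<comment> \<open>The remainder of the threshold change is a product of the count error, of order
    \<open>sqrt \<kappa>\<close>, with \<open>V w - V u\<close>, which tends to 0.\<close>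
  have Rs: "((\<lambda>p. R p / s p) \<longlongrightarrow> 0) ?F"
  proof (rule Lim_null_comparison)
    show "((\<lambda>p. \<bar>U p * (\<gamma> * d p + D p)\<bar>) \<longlongrightarrow> 0) ?F"
      using tendsto_rabs[OF UZ[OF VD]] by simp
    have "\<forall>\<^sub>F p in ?F. u (fst p) \<ge> w0 + 1"
      using u_whp by (simp add: filterlim_at_top)
    from this tendstoD[OF d0 zero_less_one] w H s_pos
    show "\<forall>\<^sub>F p in ?F. norm (R p / s p) \<le> \<bar>U p * (\<gamma> * d p + D p)\<bar>"
    proof eventually_elim
      case (elim p)
      have w0: "w0 \<le> w (fst p) (snd p)" "w0 \<le> u (fst p)"
        using elim(1,2) by (auto simp: dist_real_def d_def)
      have wn: "\<And>x. x < w (fst p) (snd p) \<longleftrightarrow> \<kappa> (fst p) < card {i\<in>I (fst p). x < W i (snd p)}"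
        using elim(3) by blast
      have VD_eq: "(f (w (fst p) (snd p)) + \<gamma> * w (fst p) (snd p)) - (f (u (fst p)) + \<gamma> * u (fst p)) = \<gamma> * d p + D p"
        by (simp add: d_def D_def algebra_simps)
      have "\<bar>R p\<bar> \<le> \<bar>exceedances (fst p) (snd p) - real (\<kappa> (fst p))\<bar> * \<bar>\<gamma> * d p + D p\<bar>"
        using excess_sum_threshold_change[OF finite_I V w0 empirical_quantile_counts[OF finite_I wn]]
          elim(4)[rule_format, OF w0(1)]
        unfolding VD_eq by (simp add: R_def S_def exceedances_def)
      then show ?case
        using elim(5) by (simp add: U_def abs_mult abs_divide divide_right_mono)
    qed
  qed
  have T: "(T \<longlongrightarrow> 1 / (1 - \<rho>)) ?F"
    unfolding T_def using second_order_excess_tendsto[OF assms(1)] .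
  have "((\<lambda>p. R p / s p + (s p * a (u (fst p))) * T p - s p * D p - \<gamma> * (s p * d p - U p))
      \<longlongrightarrow> 0 + lam * (1 / (1 - \<rho>)) - 0 - \<gamma> * 0) ?F"
    by (intro tendsto_intros Rs sa T sD vU)
  then have "((\<lambda>p. R p / s p + (s p * a (u (fst p))) * T p - s p * D p - \<gamma> * (s p * d p - U p))
      \<longlongrightarrow> lam / (1 - \<rho>)) ?F"
    by simp
  then show ?thesis
  proof (rule Lim_transform_eventually)
    show "\<forall>\<^sub>F p in ?F. R p / s p + (s p * a (u (fst p))) * T p - s p * D p - \<gamma> * (s p * d p - U p) =
      sqrt (real (\<kappa> (fst p))) * (H (fst p) (snd p) - \<gamma>)
      - \<gamma> * excess_sum (\<lambda>s. s - 1) (fst p) (snd p) / sqrt (real (\<kappa> (fst p)))"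
      using s_pos a_nz eventually_whp_fst[OF kappa_pos]
    proof eventually_elim
      case (elim p)
      let ?G = "excess_sum (\<lambda>s. s - 1) (fst p) (snd p)" and ?N = "exceedances (fst p) (snd p)"
      have "S p = \<gamma> * (?G + ?N) + a (u (fst p)) * (real (\<kappa> (fst p)) * T p)"
      proof -
        have \<kappa>T: "real (\<kappa> (fst p)) * T p = (\<Sum>i\<in>I (fst p).
            if u (fst p) < W i (snd p) then (f (W i (snd p)) - f (u (fst p))) / a (u (fst p)) else 0)"
          using elim(3) by (simp add: T_def)
        have "a (u (fst p)) * (real (\<kappa> (fst p)) * T p) =
            (\<Sum>i\<in>I (fst p). if u (fst p) < W i (snd p) then f (W i (snd p)) - f (u (fst p)) else 0)"
          unfolding \<kappa>T sum_distrib_left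
          using elim(2) by (intro sum.cong) auto
        moreover have "\<gamma> * (?G + ?N) = (\<Sum>i\<in>I (fst p). if u (fst p) < W i (snd p) then \<gamma> * (W i (snd p) - u (fst p)) else 0)"
          unfolding exceedances_def sum_excess_one[symmetric] excess_sum_def sum.distrib[symmetric] sum_distrib_left
          by (intro sum.cong) (auto simp: excess_def)
        ultimately show ?thesis
          unfolding S_def by (auto simp: sum.distrib[symmetric] algebra_simps intro!: sum.cong)
      qed
      then have "R p = s p * s p * (H (fst p) (snd p) + \<gamma> * d p + D p - a (u (fst p)) * T p) - \<gamma> * (?G + ?N)"
        by (simp add: R_def ss algebra_simps)
      moreover have "?N = s p * U p + s p * s p"
        using elim(1) by (simp add: U_def ss)
      ultimately show ?case
        using elim(1) unfolding s_def[symmetric] by (simp add: field_simps)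
    qed
  qed
qed

end

section \<open>Asymptotic normality\<close>

text \<open>The bound 7 is \<open>fact 0 + fact 3\<close>, from
  \<open>\<bar>s - 1\<bar> ^ 3 \<le> 1 + s ^ 3\<close> for \<open>s > 0\<close>. The third moment
  controls the Taylor remainder of the characteristic function.\<close>

lemma std_exp_centered:
  shows "has_bochner_integral std_exp (\<lambda>s. s - 1) 0"
    and "has_bochner_integral std_exp (\<lambda>s. (s - 1)\<^sup>2) 1"
    and "integrable std_exp (\<lambda>s. \<bar>s - 1\<bar> ^ 3)"
    and "(\<integral>s. \<bar>s - 1\<bar> ^ 3 \<partial>std_exp) \<le> 7"
proof -
  note moment = std_exp_moment
  have "has_bochner_integral std_exp (\<lambda>s. s ^ 1 - s ^ 0) (fact 1 - fact 0)"
    by (intro has_bochner_integral_diff moment)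
  then show "has_bochner_integral std_exp (\<lambda>s. s - 1) 0"
    by simp
  have "has_bochner_integral std_exp (\<lambda>s. s ^ 2 - 2 * s ^ 1 + s ^ 0) (fact 2 - 2 * fact 1 + fact 0)"
    by (intro has_bochner_integral_diff has_bochner_integral_add has_bochner_integral_mult_right moment)
  moreover have "(\<lambda>s::real. s ^ 2 - 2 * s ^ 1 + s ^ 0) = (\<lambda>s. (s - 1)\<^sup>2)"
    by (auto simp: power2_eq_square algebra_simps)
  ultimately show "has_bochner_integral std_exp (\<lambda>s. (s - 1)\<^sup>2) 1"
    by (simp add: fact_2)
  have bound: "has_bochner_integral std_exp (\<lambda>s. s ^ 0 + s ^ 3) (fact 0 + fact 3)"
    by (intro has_bochner_integral_add moment)
  have le: "AE s in std_exp. \<bar>s - 1\<bar> ^ 3 \<le> s ^ 0 + s ^ 3"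
    using AE_std_exp_pos
  proof eventually_elim
    case (elim s)
    show ?case
    proof (cases "s \<le> 1")
      case True
      then have "\<bar>s - 1\<bar> ^ 3 \<le> 1 ^ 3"
        using elim by (intro power_mono) auto
      moreover have "0 \<le> s ^ 3"
        using elim by simp
      ultimately show ?thesis
        unfolding power_0 power_one by linarith
    next
      case False
      then have "\<bar>s - 1\<bar> ^ 3 \<le> s ^ 3"
        by (intro power_mono) auto
      then show ?thesis
        by simp
    qed
  qed
  show int: "integrable std_exp (\<lambda>s. \<bar>s - 1\<bar> ^ 3)"
  proof (rule Bochner_Integration.integrable_bound)
    show "integrable std_exp (\<lambda>s. s ^ 0 + s ^ 3)"
      using bound by (simp add: has_bochner_integral_iff)
    show "AE s in std_exp. norm (\<bar>s - 1\<bar> ^ 3) \<le> norm (s ^ 0 + s ^ 3)"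
      using le by eventually_elim simp
  qed measurable
  have "(\<integral>s. \<bar>s - 1\<bar> ^ 3 \<partial>std_exp) \<le> (\<integral>s. s ^ 0 + s ^ 3 \<partial>std_exp)"
    by (rule integral_mono_AE) (use int bound le in \<open>auto simp: has_bochner_integral_iff\<close>)
  also have "\<dots> = 7"
    using bound by (simp add: has_bochner_integral_iff fact_numeral)
  finally show "(\<integral>s. \<bar>s - 1\<bar> ^ 3 \<partial>std_exp) \<le> 7" .
qed

lemma exp_minus_bound:
  fixes x :: real
  assumes "x \<ge> 0"
  shows "\<bar>1 - x - exp (- x)\<bar> \<le> x\<^sup>2"
proof -
  have "exp (- x) \<ge> 1 - x"
    using exp_ge_add_one_self[of "- x"] by simp
  moreover have "exp (- x) \<le> 1 - x + x\<^sup>2"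
  proof -
    have "(1 + x) * exp (- x) \<le> exp x * exp (- x)"
      by (intro mult_right_mono exp_ge_add_one_self) simp
    then have "(1 + x) * exp (- x) \<le> 1"
      by (simp add: exp_minus)
    \<comment> \<open>The product equals \<open>1 + x ^ 3\<close>.\<close>
    also have "1 \<le> (1 + x) * (1 - x + x\<^sup>2)"
      using assms by (simp add: algebra_simps power2_eq_square)
    finally show ?thesis
      using assms by (simp add: mult_le_cancel_left)
  qed
  ultimately show ?thesis
    by (simp add: abs_le_iff)
qed

text \<open>Measured from the lower level, the difference is up to sign \<open>s - 1\<close> for
  \<open>s \<le> \<delta>\<close> and the constant \<open>\<delta>\<close> beyond. The jump of
  height 1 at the threshold makes the second moment of order \<open>d\<close>, not
  \<open>d\<^sup>2\<close>: it is at most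
  \<open>\<delta>\<^sup>2 + 4 * (1 - exp (- \<delta>)) \<le> 5 * d\<close>, and
  \<open>exp (- l) \<le> 3 * exp (- u)\<close> accounts for the 15.\<close>

lemma excess_threshold_change_sq:
  assumes u: "u \<ge> 0" "v \<ge> 0" and d: "\<bar>u - v\<bar> \<le> d" "d \<le> 1"
  shows "integrable std_exp (\<lambda>x. (excess (\<lambda>s. s - 1) u x - excess (\<lambda>s. s - 1) v x)\<^sup>2)"
    and "(\<integral>x. (excess (\<lambda>s. s - 1) u x - excess (\<lambda>s. s - 1) v x)\<^sup>2 \<partial>std_exp) \<le> exp (- u) * (15 * d)"
proof -
  define l where "l = min u v"
  define \<delta> where "\<delta> = \<bar>u - v\<bar>"
  define \<psi> where "\<psi> s = (if s \<le> \<delta> then s - 1 else \<delta>)" for s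
  have [measurable]: "\<psi> \<in> borel_measurable borel"
    unfolding \<psi>_def by measurable
  have l: "l \<ge> 0" and \<delta>: "\<delta> \<ge> 0" "\<delta> \<le> d"
    using u d by (auto simp: l_def \<delta>_def)
  have eq: "(excess (\<lambda>s. s - 1) u x - excess (\<lambda>s. s - 1) v x)\<^sup>2 = excess (\<lambda>s. (\<psi> s)\<^sup>2) l x" for x
    by (auto simp: excess_def l_def \<delta>_def \<psi>_def min_def power2_eq_square algebra_simps)
  have bound: "has_bochner_integral std_exp (\<lambda>s. \<delta>\<^sup>2 * s ^ 0 + 4 * (if s \<le> \<delta> then 1 else 0))
      (\<delta>\<^sup>2 * fact 0 + 4 * (1 - exp (- \<delta>)))"
    by (intro has_bochner_integral_add has_bochner_integral_mult_right std_exp_moment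
        std_exp_prob_le \<delta>)
  have le: "AE s in std_exp. (\<psi> s)\<^sup>2 \<le> \<delta>\<^sup>2 * s ^ 0 + 4 * (if s \<le> \<delta> then 1 else 0)"
    using AE_std_exp_pos
  proof eventually_elim
    case (elim s)
    have "(s - 1)\<^sup>2 \<le> 2\<^sup>2" if "s \<le> \<delta>"
      using elim \<delta> d that by (subst abs_le_square_iff[symmetric]) auto
    moreover have "0 \<le> \<delta>\<^sup>2"
      by (rule zero_le_power2)
    ultimately show ?case
    proof (cases "s \<le> \<delta>")
      case True
      then have "(\<psi> s)\<^sup>2 \<le> 4"
        using \<open>s \<le> \<delta> \<Longrightarrow> (s - 1)\<^sup>2 \<le> 2\<^sup>2\<close> by (simp add: \<psi>_def)
      then show ?thesis
        using True \<open>0 \<le> \<delta>\<^sup>2\<close> by (simp only: power_0 if_True mult_1_right)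
    qed (simp add: \<psi>_def)
  qed
  have int: "integrable std_exp (\<lambda>s. (\<psi> s)\<^sup>2)"
  proof (rule Bochner_Integration.integrable_bound)
    show "integrable std_exp (\<lambda>s. \<delta>\<^sup>2 * s ^ 0 + 4 * (if s \<le> \<delta> then 1 else 0))"
      using bound by (simp add: has_bochner_integral_iff)
    show "AE s in std_exp. norm ((\<psi> s)\<^sup>2) \<le> norm (\<delta>\<^sup>2 * s ^ 0 + 4 * (if s \<le> \<delta> then 1 else 0))"
      using le by eventually_elim simp
  qed measurable
  have "(\<integral>s. (\<psi> s)\<^sup>2 \<partial>std_exp) \<le> (\<integral>s. \<delta>\<^sup>2 * s ^ 0 + 4 * (if s \<le> \<delta> then 1 else 0) \<partial>std_exp)"
    by (rule integral_mono_AE) (use int bound le in \<open>auto simp: has_bochner_integral_iff\<close>)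
  also have "\<dots> = \<delta>\<^sup>2 + 4 * (1 - exp (- \<delta>))"
    using bound by (simp add: has_bochner_integral_iff)
  also have "\<dots> \<le> 5 * d"
  proof -
    define e where "e = 1 - exp (- \<delta>)"
    have "\<delta>\<^sup>2 \<le> \<delta>"
      using \<delta> d mult_left_mono[of \<delta> 1 \<delta>] by (simp add: power2_eq_square)
    moreover have "e \<le> \<delta>"
      using exp_ge_add_one_self[of "- \<delta>"] by (simp add: e_def)
    ultimately show ?thesis
      unfolding e_def[symmetric] using \<delta> by linarith
  qed
  finally have E: "(\<integral>s. (\<psi> s)\<^sup>2 \<partial>std_exp) \<le> 5 * d" .
  note ex = std_exp_excess[OF has_bochner_integral_integrable[OF int] l]
  show "integrable std_exp (\<lambda>x. (excess (\<lambda>s. s - 1) u x - excess (\<lambda>s. s - 1) v x)\<^sup>2)"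
    unfolding eq using ex by (simp add: has_bochner_integral_iff)
  have "exp (- l) \<le> exp (1 - u)"
    using d by (auto simp: l_def)
  also have "\<dots> \<le> 3 * exp (- u)"
    using exp_le by (simp add: exp_diff exp_minus field_simps)
  finally have "exp (- l) * (\<integral>s. (\<psi> s)\<^sup>2 \<partial>std_exp) \<le> (3 * exp (- u)) * (5 * d)"
    using E by (intro mult_mono) auto
  then show "(\<integral>x. (excess (\<lambda>s. s - 1) u x - excess (\<lambda>s. s - 1) v x)\<^sup>2 \<partial>std_exp) \<le> exp (- u) * (15 * d)"
    unfolding eq using ex by (simp add: has_bochner_integral_iff)
qed

context exponential_sample
begin

text \<open>Both excesses are centered whatever their levels, so only the variance counts; divided
  by \<open>k\<close> it is at most \<open>15 * d n\<close>, because the weights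
  \<open>exp (- u n i)\<close> add up to \<open>k\<close>.\<close>

lemma excess_threshold_change:
  assumes I: "\<And>n. finite (I n)" "\<And>n. I n \<subseteq> I0"
    and k: "filterlim k at_top sequentially"
    and total: "\<forall>\<^sub>F n in sequentially. (\<Sum>i\<in>I n. exp (- u n i)) = real (k n)"
    and u: "\<forall>\<^sub>F n in sequentially. \<forall>i\<in>I n. u n i \<ge> 0 \<and> v n i \<ge> 0 \<and> \<bar>u n i - v n i\<bar> \<le> d n"
    and d: "d \<longlonglongrightarrow> 0"
  shows "((\<lambda>p. (\<Sum>i\<in>I (fst p). excess (\<lambda>s. s - 1) (u (fst p) i) (W i (snd p))
      - excess (\<lambda>s. s - 1) (v (fst p) i) (W i (snd p))) / sqrt (real (k (fst p)))) \<longlongrightarrow> 0) (whp M)"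
proof -
  define \<phi> where "\<phi> n i x = (excess (\<lambda>s. s - 1) (u n i) x - excess (\<lambda>s. s - 1) (v n i) x) / sqrt (real (k n))" for n i x
  have k_pos: "\<forall>\<^sub>F n in sequentially. k n > 0"
    using k eventually_compose_filterlim[OF eventually_gt_at_top[of 0]] by blast
  have d1: "\<forall>\<^sub>F n in sequentially. d n \<le> 1"
    using order_tendstoD(2)[OF d, of 1] by (auto elim: eventually_mono)
  have "((\<lambda>p. (\<Sum>i\<in>I (fst p). \<phi> (fst p) i (W i (snd p))) - (\<Sum>i\<in>I (fst p). 0)) \<longlongrightarrow> 0) (whp M)"
  proof (rule sum_tendsto_whp[OF I, where v = "\<lambda>n i. exp (- u n i) * (15 * d n) / real (k n)"])
    show "\<phi> n i \<in> borel_measurable borel" for n i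
      unfolding \<phi>_def by measurable
    show "\<forall>\<^sub>F n in sequentially. \<forall>i\<in>I n. has_bochner_integral std_exp (\<phi> n i) 0 \<and>
        integrable std_exp (\<lambda>x. (\<phi> n i x)\<^sup>2) \<and>
        (\<integral>x. (\<phi> n i x)\<^sup>2 \<partial>std_exp) \<le> exp (- u n i) * (15 * d n) / real (k n)"
      using u k_pos d1
    proof (eventually_elim, intro ballI conjI)
      fix n i
      assume *: "\<forall>i\<in>I n. 0 \<le> u n i \<and> 0 \<le> v n i \<and> \<bar>u n i - v n i\<bar> \<le> d n" and k: "k n > 0"
        and d: "d n \<le> 1" and i: "i \<in> I n"
      have uv: "u n i \<ge> 0" "v n i \<ge> 0" "\<bar>u n i - v n i\<bar> \<le> d n"
        using * i by auto
      note sq = excess_threshold_change_sq[OF uv d]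
      have "has_bochner_integral std_exp (\<phi> n i) ((exp (- u n i) * 0 - exp (- v n i) * 0) / sqrt (real (k n)))"
        unfolding \<phi>_def
        by (intro has_bochner_integral_divide has_bochner_integral_diff std_exp_excess
            std_exp_centered uv)
      then show "has_bochner_integral std_exp (\<phi> n i) 0"
        by simp
      show "integrable std_exp (\<lambda>x. (\<phi> n i x)\<^sup>2)"
        unfolding \<phi>_def power_divide using sq(1) by simp
      show "(\<integral>x. (\<phi> n i x)\<^sup>2 \<partial>std_exp) \<le> exp (- u n i) * (15 * d n) / real (k n)"
        unfolding \<phi>_def power_divide using divide_right_mono[OF sq(2), of "real (k n)"] by simp
    qed
    have "(\<lambda>n. 15 * d n) \<longlonglongrightarrow> 15 * 0"
      by (intro tendsto_intros d)
    then have "(\<lambda>n. 15 * d n) \<longlonglongrightarrow> 0"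
      by simp
    then show "(\<lambda>n. \<Sum>i\<in>I n. exp (- u n i) * (15 * d n) / real (k n)) \<longlonglongrightarrow> 0"
    proof (rule Lim_transform_eventually)
      show "\<forall>\<^sub>F n in sequentially. 15 * d n = (\<Sum>i\<in>I n. exp (- u n i) * (15 * d n) / real (k n))"
        using total k_pos
        by eventually_elim (simp add: sum_divide_distrib[symmetric] sum_distrib_right[symmetric])
    qed
  qed
  then show ?thesis
    by (simp add: \<phi>_def sum_divide_distrib[symmetric])
qed

text \<open>Second-order Taylor expansion with mean 0 and variance
  \<open>c\<^sup>2 * exp (- u)\<close>. The error keeps the factor \<open>exp (- u)\<close>, so that
  errors can be summed over all observations although only about \<open>k\<close> of them exceed
  their levels.\<close>

lemma char_excess_approx:
  assumes i: "i \<in> I0" and u: "u \<ge> 0" and c: "c \<ge> 0"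
  shows "cmod (char (distr M borel (\<lambda>\<omega>. c * excess (\<lambda>s. s - 1) u (W i \<omega>))) t
      - (1 - t\<^sup>2 * (c\<^sup>2 * exp (- u)) / 2)) \<le> 2 * \<bar>t\<bar> ^ 3 * c ^ 3 * exp (- u)"
proof -
  define Y where "Y = (\<lambda>\<omega>. c * excess (\<lambda>s. s - 1) u (W i \<omega>))"
  have [measurable]: "W i \<in> borel_measurable M"
    using i by simp
  have [measurable]: "Y \<in> borel_measurable M"
    unfolding Y_def by measurable
  have excess_W: "has_bochner_integral M (\<lambda>\<omega>. excess \<phi> u (W i \<omega>)) (exp (- u) * b)"
    if "\<phi> \<in> borel_measurable borel" "has_bochner_integral std_exp \<phi> b" for \<phi> b
    by (rule has_bochner_integral_W[OF i]) (use that u std_exp_excess in auto)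
  have m1: "has_bochner_integral M Y (c * (exp (- u) * 0))"
    unfolding Y_def by (intro has_bochner_integral_mult_right excess_W std_exp_centered) auto
  have "has_bochner_integral M (\<lambda>\<omega>. c\<^sup>2 * excess (\<lambda>s. (s - 1)\<^sup>2) u (W i \<omega>)) (c\<^sup>2 * (exp (- u) * 1))"
    by (intro has_bochner_integral_mult_right excess_W std_exp_centered) auto
  then have m2: "has_bochner_integral M (\<lambda>\<omega>. (Y \<omega>)\<^sup>2) (c\<^sup>2 * (exp (- u) * 1))"
    by (simp add: Y_def power_mult_distrib excess_power)
  define b where "b = (\<integral>s. \<bar>s - 1\<bar> ^ 3 \<partial>std_exp)"
  have "has_bochner_integral M (\<lambda>\<omega>. c ^ 3 * excess (\<lambda>s. \<bar>s - 1\<bar> ^ 3) u (W i \<omega>)) (c ^ 3 * (exp (- u) * b))"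
    unfolding b_def by (intro has_bochner_integral_mult_right excess_W has_bochner_integral_integrable std_exp_centered) auto
  moreover have "c ^ 3 * excess (\<lambda>s. \<bar>s - 1\<bar> ^ 3) u x = \<bar>c * excess (\<lambda>s. s - 1) u x\<bar> ^ 3" for x
    using c by (simp add: excess_def abs_mult power_mult_distrib)
  ultimately have m3: "has_bochner_integral M (\<lambda>\<omega>. \<bar>Y \<omega>\<bar> ^ 3) (c ^ 3 * (exp (- u) * b))"
    by (simp add: Y_def)
  have "cmod (char (distr M borel Y) t - (1 - t\<^sup>2 * (c\<^sup>2 * exp (- u)) / 2))
      \<le> (t\<^sup>2 / 6) * expectation (\<lambda>x. min (6 * (Y x)\<^sup>2) (\<bar>t\<bar> * \<bar>Y x\<bar> ^ 3))"
    by (rule char_approx3') (use m1 m2 in \<open>auto simp: has_bochner_integral_iff\<close>)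
  also have "\<dots> \<le> (t\<^sup>2 / 6) * expectation (\<lambda>x. \<bar>t\<bar> * \<bar>Y x\<bar> ^ 3)"
  proof (intro mult_left_mono integral_mono)
    have m3': "integrable M (\<lambda>x. \<bar>t\<bar> * \<bar>Y x\<bar> ^ 3)"
      using m3 by (auto simp: has_bochner_integral_iff)
    then show "integrable M (\<lambda>x. \<bar>t\<bar> * \<bar>Y x\<bar> ^ 3)" .
    show "integrable M (\<lambda>x. min (6 * (Y x)\<^sup>2) (\<bar>t\<bar> * \<bar>Y x\<bar> ^ 3))"
      by (rule Bochner_Integration.integrable_bound[OF m3']) auto
  qed auto
  also have "\<dots> = (t\<^sup>2 / 6) * (\<bar>t\<bar> * (c ^ 3 * (exp (- u) * b)))"
    using m3 by (simp add: has_bochner_integral_iff)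
  \<comment> \<open>The moment bound 7 is rounded up to 12 to cancel the denominator 6.\<close>
  also have "\<dots> \<le> (t\<^sup>2 / 6) * (\<bar>t\<bar> * (c ^ 3 * (exp (- u) * 12)))"
    using std_exp_centered(4) c unfolding b_def by (intro mult_left_mono) auto
  also have "\<dots> = 2 * \<bar>t\<bar> ^ 3 * c ^ 3 * exp (- u)"
  proof -
    have "t\<^sup>2 * \<bar>t\<bar> = \<bar>t\<bar> ^ 3"
      by (simp add: power3_eq_cube power2_eq_square)
    then have "(t\<^sup>2 * \<bar>t\<bar>) * (2 * (c ^ 3 * exp (- u))) = \<bar>t\<bar> ^ 3 * (2 * (c ^ 3 * exp (- u)))"
      by (rule arg_cong)
    then show ?thesis
      by (simp only: mult_ac times_divide_eq_right times_divide_eq_left)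
  qed
  finally show ?thesis
    by (simp add: Y_def)
qed

text \<open>A central limit theorem for rows whose summands are not identically distributed, since
  the levels vary within a row. Each factor of the characteristic function is compared with that of
  a centered normal law of the same variance; the variances add up to exactly 1, and the errors to
  order \<open>c n\<close>.\<close>

lemma excess_char_tendsto:
  assumes I: "\<And>n. finite (I n)" "\<And>n. I n \<subseteq> I0"
    and k: "filterlim k at_top sequentially"
    and total: "\<forall>\<^sub>F n in sequentially. (\<Sum>i\<in>I n. exp (- u n i)) = real (k n)"
    and u: "\<forall>\<^sub>F n in sequentially. \<forall>i\<in>I n. u n i \<ge> 0"
  shows "(\<lambda>n. char (distr M borel (\<lambda>\<omega>. \<Sum>i\<in>I n. 1 / sqrt (real (k n)) * excess (\<lambda>s. s - 1) (u n i) (W i \<omega>))) t)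
    \<longlonglongrightarrow> complex_of_real (exp (- t\<^sup>2 / 2))"
proof -
  define c where "c n = 1 / sqrt (real (k n))" for n
  let ?Y = "\<lambda>n i \<omega>. c n * excess (\<lambda>s. s - 1) (u n i) (W i \<omega>)"
  have k_pos: "\<forall>\<^sub>F n in sequentially. k n > 0"
    using k eventually_compose_filterlim[OF eventually_gt_at_top[of 0]] by blast
  have c0: "c \<longlonglongrightarrow> 0"
    unfolding c_def
    by (intro tendsto_divide_0[OF tendsto_const] filterlim_at_top_imp_at_infinity
        filterlim_compose[OF sqrt_at_top] filterlim_compose[OF filterlim_real_sequentially k])
  have "\<forall>\<^sub>F n in sequentially. cmod (char (distr M borel (\<lambda>\<omega>. \<Sum>i\<in>I n. ?Y n i \<omega>)) t - exp (- t\<^sup>2 / 2))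
      \<le> 2 * \<bar>t\<bar> ^ 3 * c n + t ^ 4 * (c n)\<^sup>2"
    using total u k_pos
  proof eventually_elim
    case (elim n)
    have c: "c n > 0" "(c n)\<^sup>2 * real (k n) = 1"
      using elim(3) by (simp_all add: c_def power_divide)
    \<comment> \<open>\<open>exp (- x i)\<close> is the normal factor for summand \<open>i\<close>;
      by \<open>total\<close> the \<open>x i\<close> add up to \<open>t\<^sup>2 / 2\<close>.\<close>
    define x where "x i = t\<^sup>2 * ((c n)\<^sup>2 * exp (- u n i)) / 2" for i
    have x0: "x i \<ge> 0" for i
      by (simp add: x_def)
    have prod: "char (distr M borel (\<lambda>\<omega>. \<Sum>i\<in>I n. ?Y n i \<omega>)) t = (\<Prod>i\<in>I n. char (distr M borel (?Y n i)) t)"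
    proof (rule char_distr_sum)
      have "indep_vars (\<lambda>_. borel) (\<lambda>i \<omega>. (\<lambda>y. c n * excess (\<lambda>s. s - 1) (u n i) y) (W i \<omega>)) (I n)"
        by (rule indep_vars_compose2[OF indep_vars_subset[OF indep I(2)]]) measurable
      then show "indep_vars (\<lambda>_. borel) (?Y n) (I n)" .
    qed
    have "(\<Sum>i\<in>I n. x i) = t\<^sup>2 / 2 * ((c n)\<^sup>2 * (\<Sum>i\<in>I n. exp (- u n i)))"
      by (simp add: x_def sum_distrib_left sum_divide_distrib)
    also have "\<dots> = t\<^sup>2 / 2"
      using c elim(1) by simp
    finally have expo: "complex_of_real (exp (- t\<^sup>2 / 2)) = (\<Prod>i\<in>I n. complex_of_real (exp (- x i)))"
      using I(1) by (simp add: exp_sum[symmetric] sum_negf of_real_prod[symmetric] del: of_real_prod)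
    have "cmod ((\<Prod>i\<in>I n. char (distr M borel (?Y n i)) t) - (\<Prod>i\<in>I n. complex_of_real (exp (- x i))))
        \<le> (\<Sum>i\<in>I n. cmod (char (distr M borel (?Y n i)) t - complex_of_real (exp (- x i))))"
    proof (rule norm_prod_diff)
      fix i assume "i \<in> I n"
      then have [measurable]: "W i \<in> borel_measurable M"
        using I(2)[of n] by (auto intro: measurable_W)
      have "real_distribution (distr M borel (?Y n i))"
        by (rule real_distribution_distr) measurable
      then show "cmod (char (distr M borel (?Y n i)) t) \<le> 1"
        by (rule real_distribution.cmod_char_le_1)
      show "cmod (complex_of_real (exp (- x i))) \<le> 1"
        using x0[of i] by simp
    qed
    also have "\<dots> \<le> (\<Sum>i\<in>I n. (2 * \<bar>t\<bar> ^ 3 * (c n) ^ 3 + t ^ 4 * (c n) ^ 4) * exp (- u n i))"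
    proof (rule sum_mono)
      fix i assume i: "i \<in> I n"
      have "cmod (char (distr M borel (?Y n i)) t - complex_of_real (exp (- x i)))
          \<le> cmod (char (distr M borel (?Y n i)) t - (1 - x i)) + cmod (complex_of_real (1 - x i) - complex_of_real (exp (- x i)))"
        by (rule order.trans[OF _ norm_triangle_ineq]) simp
      also have "cmod (char (distr M borel (?Y n i)) t - (1 - x i)) \<le> 2 * \<bar>t\<bar> ^ 3 * (c n) ^ 3 * exp (- u n i)"
        using char_excess_approx[of i "u n i" "c n" t] i I(2)[of n] elim(2) c(1) by (auto simp: x_def)
      also have "cmod (complex_of_real (1 - x i) - complex_of_real (exp (- x i))) \<le> (x i)\<^sup>2"
      proof -
        have "\<bar>(1 - x i) - exp (- x i)\<bar> \<le> (x i)\<^sup>2"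
          by (rule exp_minus_bound[OF x0])
        then show ?thesis
          by (simp add: of_real_diff[symmetric] del: of_real_diff)
      qed
      also have "(x i)\<^sup>2 \<le> t ^ 4 * (c n) ^ 4 * exp (- u n i)"
      proof -
        have "exp (- u n i) * exp (- u n i) \<le> exp (- u n i) * 1"
          using elim(2) i by (intro mult_left_mono) auto
        then have "t ^ 4 * (c n) ^ 4 / 4 * (exp (- u n i) * exp (- u n i)) \<le> t ^ 4 * (c n) ^ 4 / 4 * (exp (- u n i) * 1)"
          using c(1) by (intro mult_left_mono) auto
        also have "\<dots> \<le> t ^ 4 * (c n) ^ 4 * exp (- u n i)"
          using c(1) by simp
        finally show ?thesis
          by (simp add: x_def power2_eq_square power4_eq_xxxx algebra_simps)
      qed
      finally show "cmod (char (distr M borel (?Y n i)) t - complex_of_real (exp (- x i)))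
          \<le> (2 * \<bar>t\<bar> ^ 3 * (c n) ^ 3 + t ^ 4 * (c n) ^ 4) * exp (- u n i)"
        by (simp add: distrib_right)
    qed
    also have "\<dots> = (2 * \<bar>t\<bar> ^ 3 * (c n) ^ 3 + t ^ 4 * (c n) ^ 4) * real (k n)"
      by (simp add: sum_distrib_left[symmetric] elim(1))
    also have "\<dots> = 2 * \<bar>t\<bar> ^ 3 * c n * ((c n)\<^sup>2 * real (k n)) + t ^ 4 * (c n)\<^sup>2 * ((c n)\<^sup>2 * real (k n))"
      by (simp add: power2_eq_square power3_eq_cube power4_eq_xxxx algebra_simps)
    finally show ?case
      unfolding prod expo c(2) by simp
  qed
  moreover have "(\<lambda>n. 2 * \<bar>t\<bar> ^ 3 * c n + t ^ 4 * (c n)\<^sup>2) \<longlonglongrightarrow> 2 * \<bar>t\<bar> ^ 3 * 0 + t ^ 4 * 0\<^sup>2"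
    by (intro tendsto_intros c0)
  then have "(\<lambda>n. 2 * \<bar>t\<bar> ^ 3 * c n + t ^ 4 * (c n)\<^sup>2) \<longlonglongrightarrow> 0"
    by simp
  ultimately have "(\<lambda>n. char (distr M borel (\<lambda>\<omega>. \<Sum>i\<in>I n. ?Y n i \<omega>)) t - exp (- t\<^sup>2 / 2)) \<longlonglongrightarrow> 0"
    by (rule Lim_null_comparison)
  then show ?thesis
    unfolding c_def by (simp only: LIM_zero_iff)
qed

end

section \<open>Normal limits through characteristic functions\<close>

lemma char_normal_density:
  assumes "\<sigma> > 0"
  shows "char (density lborel (normal_density \<mu> \<sigma>)) t = iexp (t * \<mu>) * complex_of_real (exp (- (\<sigma> * t)\<^sup>2 / 2))"
proof -
  interpret N: real_distribution std_normal_distribution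
    by (rule real_dist_normal_dist)
  have "distributed std_normal_distribution lborel (\<lambda>x. x) std_normal_density"
    by (auto simp: distributed_def intro!: distr_id2)
  from N.normal_density_affine[OF this, of \<sigma> \<mu>] assms
  have "distributed std_normal_distribution lborel (\<lambda>x. \<mu> + \<sigma> * x) (normal_density \<mu> \<sigma>)"
    by simp
  then have eq: "density lborel (normal_density \<mu> \<sigma>) = distr std_normal_distribution lborel (\<lambda>x. \<mu> + \<sigma> * x)"
    by (simp add: distributed_distr_eq_density)
  have "char (density lborel (normal_density \<mu> \<sigma>)) t = (CLINT x|std_normal_distribution. iexp (t * (\<mu> + \<sigma> * x)))"
    unfolding eq char_def by (subst integral_distr) auto
  also have "\<dots> = (CLINT x|std_normal_distribution. iexp (t * \<mu>) * iexp ((\<sigma> * t) * x))"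
  proof (intro Bochner_Integration.integral_cong refl)
    fix x :: real
    have "t * (\<mu> + \<sigma> * x) = t * \<mu> + (\<sigma> * t) * x"
      by (simp add: algebra_simps)
    then show "iexp (t * (\<mu> + \<sigma> * x)) = iexp (t * \<mu>) * iexp ((\<sigma> * t) * x)"
      by (simp only: of_real_add distrib_left exp_add)
  qed
  also have "\<dots> = iexp (t * \<mu>) * char std_normal_distribution (\<sigma> * t)"
    by (simp add: char_def)
  finally show ?thesis
    by (simp add: char_std_normal_distribution)
qed

lemma real_distribution_normal_density: "\<sigma> > 0 \<Longrightarrow> real_distribution (density lborel (normal_density \<mu> \<sigma>))"
  by (auto simp: real_distribution_def real_distribution_axioms_def prob_space_normal_density)

context prob_space
begin

lemma char_distr: "Y \<in> borel_measurable M \<Longrightarrow> char (distr M borel Y) t = (CLINT \<omega>|M. iexp (t * Y \<omega>))"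
  unfolding char_def by (subst integral_distr) auto

text \<open>Writing \<open>Y = \<mu> + \<sigma> * Z + D\<close>, the integrands of the two
  characteristic functions differ by at most \<open>\<bar>t\<bar> * \<epsilon>\<close> where
  \<open>\<bar>D\<bar> < \<epsilon>\<close> and by at most 2 on the exceptional event. Levy's
  continuity theorem then gives the weak limit.\<close>

lemma Slutsky_normal:
  assumes [measurable]: "\<And>n. Y n \<in> borel_measurable M" "\<And>n. Z n \<in> borel_measurable M"
    and char_Z: "\<And>t. (\<lambda>n. char (distr M borel (Z n)) t) \<longlonglongrightarrow> complex_of_real (exp (- t\<^sup>2 / 2))"
    and diff: "((\<lambda>p. Y (fst p) (snd p) - \<sigma> * Z (fst p) (snd p)) \<longlongrightarrow> \<mu>) (whp M)" and "\<sigma> > 0"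
  shows "weak_conv_m (\<lambda>n. distr M borel (Y n)) (density lborel (normal_density \<mu> \<sigma>))"
proof (rule levy_continuity)
  show "real_distribution (distr M borel (Y n))" for n
    by (rule real_distribution_distr) simp
  show "real_distribution (density lborel (normal_density \<mu> \<sigma>))"
    using \<open>\<sigma> > 0\<close> by (rule real_distribution_normal_density)
  fix t :: real
  define D where "D n \<omega> = Y n \<omega> - \<sigma> * Z n \<omega> - \<mu>" for n \<omega>
  have "(\<lambda>n. char (distr M borel (Y n)) t - iexp (t * \<mu>) * char (distr M borel (Z n)) (\<sigma> * t)) \<longlonglongrightarrow> 0"
  proof (rule tendstoI)
    fix e :: real assume e: "e > 0"
    define \<epsilon> where "\<epsilon> = e / (2 * (\<bar>t\<bar> + 1))"
    have \<epsilon>: "\<epsilon> > 0"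
      using e by (simp add: \<epsilon>_def add_nonneg_pos)
    have te: "\<bar>t\<bar> * \<epsilon> < e / 2"
    proof -
      have "\<bar>t\<bar> * \<epsilon> < (\<bar>t\<bar> + 1) * \<epsilon>"
        using \<epsilon> by simp
      also have "\<dots> = e / 2"
        by (simp add: \<epsilon>_def field_simps add_nonneg_eq_0_iff)
      finally show ?thesis .
    qed
    have "e / 4 > 0"
      using e by simp
    from tendstoD[OF diff \<epsilon>, unfolded eventually_whp, rule_format, OF this]
    show "\<forall>\<^sub>F n in sequentially. dist (char (distr M borel (Y n)) t - iexp (t * \<mu>) * char (distr M borel (Z n)) (\<sigma> * t)) 0 < e"
    proof eventually_elim
      case (elim n)
      then obtain B where [measurable]: "B \<in> sets M" and B: "prob B < e / 4"
        and small: "\<And>\<omega>. \<omega> \<in> space M \<Longrightarrow> \<omega> \<notin> B \<Longrightarrow> \<bar>D n \<omega>\<bar> < \<epsilon>"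
        by (auto simp: dist_real_def D_def)
      have int: "integrable M (\<lambda>\<omega>. iexp (g \<omega>))" if "g \<in> borel_measurable M" for g
        using that by (intro integrable_const_bound[where B = 1]) auto
      have iB: "integrable M (\<lambda>\<omega>. 2 * indicator B \<omega> + \<bar>t\<bar> * \<epsilon>)"
        by (intro integrable_const_bound[where B = "2 + \<bar>t\<bar> * \<epsilon>"]) (use \<epsilon> in \<open>auto simp: indicator_def\<close>)
      have iY: "integrable M (\<lambda>\<omega>. iexp (t * Y n \<omega>))"
        by (rule int) measurable
      have iZ: "integrable M (\<lambda>\<omega>. iexp (t * \<mu>) * iexp ((\<sigma> * t) * Z n \<omega>))"
        by (intro integrable_mult_right int) measurable
      have "char (distr M borel (Y n)) t - iexp (t * \<mu>) * char (distr M borel (Z n)) (\<sigma> * t)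
          = (CLINT \<omega>|M. iexp (t * Y n \<omega>) - iexp (t * \<mu>) * iexp ((\<sigma> * t) * Z n \<omega>))"
        unfolding Bochner_Integration.integral_diff[OF iY iZ] integral_mult_right_zero
        by (simp only: char_distr assms(1,2))
      also have "cmod \<dots> \<le> (\<integral>\<omega>. 2 * indicator B \<omega> + \<bar>t\<bar> * \<epsilon> \<partial>M)"
      proof (rule order.trans[OF integral_norm_bound integral_mono])
        show "integrable M (\<lambda>\<omega>. cmod (iexp (t * Y n \<omega>) - iexp (t * \<mu>) * iexp ((\<sigma> * t) * Z n \<omega>)))"
          by (rule integrable_norm, rule Bochner_Integration.integrable_diff[OF iY iZ])
        show "integrable M (\<lambda>\<omega>. 2 * indicator B \<omega> + \<bar>t\<bar> * \<epsilon>)"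
          by (rule iB)
        fix \<omega> assume \<omega>: "\<omega> \<in> space M"
        have eq: "iexp (t * \<mu>) * iexp ((\<sigma> * t) * Z n \<omega>) = iexp (t * (Y n \<omega> - D n \<omega>))"
        proof -
          have "t * (Y n \<omega> - D n \<omega>) = t * \<mu> + (\<sigma> * t) * Z n \<omega>"
            by (simp add: D_def algebra_simps)
          then show ?thesis
            by (simp only: of_real_add distrib_left exp_add)
        qed
        show "cmod (iexp (t * Y n \<omega>) - iexp (t * \<mu>) * iexp ((\<sigma> * t) * Z n \<omega>)) \<le> 2 * indicator B \<omega> + \<bar>t\<bar> * \<epsilon>"
        proof (cases "\<omega> \<in> B")
          case True
          have "cmod (iexp (t * Y n \<omega>) - iexp (t * (Y n \<omega> - D n \<omega>))) \<le> 1 + 1"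
            by (rule order.trans[OF norm_triangle_ineq4]) (simp add: norm_exp_i_times)
          then show ?thesis
            unfolding eq using True \<epsilon> by (simp add: add_increasing2)
        next
          case False
          have "iexp (t * Y n \<omega>) - iexp (t * (Y n \<omega> - D n \<omega>)) = iexp (t * (Y n \<omega> - D n \<omega>)) * (iexp (t * D n \<omega>) - 1)"
          proof -
            have "iexp (x + y) - iexp x = iexp x * (iexp y - 1)" for x y :: real
              by (simp add: distrib_left exp_add right_diff_distrib)
            from this[of "t * (Y n \<omega> - D n \<omega>)" "t * D n \<omega>"] show ?thesis
              by (simp only: distrib_left[symmetric] diff_add_cancel)
          qed
          then have "cmod (iexp (t * Y n \<omega>) - iexp (t * (Y n \<omega> - D n \<omega>))) = cmod (iexp (t * D n \<omega>) - 1)"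
            by (simp add: norm_mult del: of_real_mult of_real_diff)
          also have "\<dots> \<le> \<bar>t * D n \<omega>\<bar>"
            using iexp_approx1[of "t * D n \<omega>" 0] by simp
          also have "\<dots> \<le> \<bar>t\<bar> * \<epsilon>"
            using small[OF \<omega> False] by (simp add: abs_mult mult_left_mono)
          finally show ?thesis
            unfolding eq using False by simp
        qed
      qed
      also have "\<dots> = 2 * prob B + \<bar>t\<bar> * \<epsilon>"
        using prob_space by (simp add: integrable_real_indicator emeasure_eq_measure)
      also have "\<dots> < e"
        using B te by simp
      finally show ?case
        by (simp add: dist_norm)
    qed
  qed
  from tendsto_add[OF this tendsto_mult[OF tendsto_const[of "iexp (t * \<mu>)"] char_Z[of "\<sigma> * t"]]]
  show "(\<lambda>n. char (distr M borel (Y n)) t) \<longlonglongrightarrow> char (density lborel (normal_density \<mu> \<sigma>)) t"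
    unfolding char_normal_density[OF \<open>\<sigma> > 0\<close>] by simp
qed

end

lemma weak_conv_normal_unique:
  assumes "\<And>n. real_distribution (\<nu> n)" and "\<sigma> > 0"
    and "weak_conv_m \<nu> (density lborel (normal_density \<mu>1 \<sigma>))"
    and "weak_conv_m \<nu> (density lborel (normal_density \<mu>2 \<sigma>))"
  shows "\<mu>1 = \<mu>2"
proof (rule ccontr)
  assume ne: "\<mu>1 \<noteq> \<mu>2"
  \<comment> \<open>At this argument the phase factors of the two means differ by the factor
    \<open>iexp pi = -1\<close>.\<close>
  define t where "t = pi / (\<mu>1 - \<mu>2)"
  have "char (density lborel (normal_density \<mu>1 \<sigma>)) t = char (density lborel (normal_density \<mu>2 \<sigma>)) t"
    by (rule LIMSEQ_unique[OF
          levy_continuity1[OF assms(1) real_distribution_normal_density[OF assms(2)] assms(3)]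
          levy_continuity1[OF assms(1) real_distribution_normal_density[OF assms(2)] assms(4)]])
  then have "iexp (t * \<mu>1) * complex_of_real (exp (- (\<sigma> * t)\<^sup>2 / 2)) =
      iexp (t * \<mu>2) * complex_of_real (exp (- (\<sigma> * t)\<^sup>2 / 2))"
    by (simp only: char_normal_density[OF assms(2)])
  moreover have "complex_of_real (exp (- (\<sigma> * t)\<^sup>2 / 2)) \<noteq> 0"
    by (simp only: of_real_eq_0_iff exp_not_eq_zero not_False_eq_True)
  ultimately have eq: "iexp (t * \<mu>1) = iexp (t * \<mu>2)"
    by (metis mult_right_cancel)
  have "iexp (t * (\<mu>1 - \<mu>2)) = iexp (t * \<mu>1) / iexp (t * \<mu>2)"
    by (simp only: of_real_diff right_diff_distrib exp_diff)
  also have "\<dots> = 1"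
    unfolding eq by simp
  also have "t * (\<mu>1 - \<mu>2) = pi"
    using ne by (simp add: t_def)
  finally show False
    by simp
qed

section \<open>Reduction to exponential variables\<close>

text \<open>The cumulative hazard function. Where \<open>F x = 1\<close> its value is only the
  default of \<open>ln\<close> at 0, so arguments about the sample restrict to the almost sure event
  \<open>F x < 1\<close>.\<close>

definition exponential_transform :: "(real \<Rightarrow> real) \<Rightarrow> real \<Rightarrow> real" where
  "exponential_transform F x = - ln (1 - F x)"

context real_distribution
begin

context
  assumes cont: "continuous_on UNIV (cdf M)"
begin

text \<open>The cdf may have flat pieces, so the right end point of the level set is chosen:
  continuity makes the sublevel set closed, and hence its supremum belongs to it.\<close>

lemma cdf_le_eq_atMost:
  assumes "0 < y" "y < 1"
  obtains x where "cdf M x = y" "{z. cdf M z \<le> y} = {..x}"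
proof -
  from order_tendstoD(2)[OF cdf_lim_at_bot \<open>0 < y\<close>]
  obtain l where l: "cdf M l < y"
    unfolding eventually_at_bot_linorder by blast
  from order_tendstoD(1)[OF cdf_lim_at_top_prob \<open>y < 1\<close>]
  obtain r where r: "\<And>z. z \<ge> r \<Longrightarrow> y < cdf M z"
    unfolding eventually_at_top_linorder by blast
  have "l \<le> r"
    using l r[of l] by (cases "r \<le> l") auto
  then obtain x0 where x0: "cdf M x0 = y"
    using IVT'[of "cdf M" l y r] l r[of r] continuous_on_subset[OF cont, of "{l..r}"]
    by (meson less_imp_le order_refl subset_UNIV)
  let ?S = "{z. cdf M z \<le> y}"
  have bdd: "bdd_above ?S"
  proof (rule bdd_aboveI[of _ r])
    fix z assume "z \<in> ?S"
    then show "z \<le> r"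
      using r[of z] by (cases "r \<le> z") auto
  qed
  have "closed ?S"
    by (intro closed_Collect_le cont continuous_on_const)
  then have mem: "Sup ?S \<in> ?S"
    using x0 by (intro closed_contains_Sup bdd) auto
  have "x0 \<le> Sup ?S"
    using x0 by (intro cSup_upper bdd) simp
  then have "y \<le> cdf M (Sup ?S)"
    using cdf_nondecreasing[of x0] x0 by simp
  with mem have eq: "cdf M (Sup ?S) = y"
    by simp
  have "?S = {..Sup ?S}"
  proof (intro equalityI subsetI)
    fix z assume "z \<in> ?S"
    then show "z \<in> {..Sup ?S}"
      using cSup_upper[OF _ bdd] by simp
  next
    fix z assume "z \<in> {..Sup ?S}"
    then show "z \<in> ?S"
      using cdf_nondecreasing[of z "Sup ?S"] eq by simp
  qed
  with eq show thesis
    by (rule that)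
qed

lemma prob_cdf_le:
  assumes "0 \<le> y" "y \<le> 1"
  shows "prob {x. cdf M x \<le> y} = y"
proof -
  have [measurable]: "cdf M \<in> borel_measurable borel"
    using cont by (rule borel_measurable_continuous_onI)
  have pos: "prob {x. cdf M x \<le> y} = y" if y: "0 < y" "y < 1" for y
  proof -
    obtain x where "cdf M x = y" "{z. cdf M z \<le> y} = {..x}"
      using cdf_le_eq_atMost[OF y] .
    then show ?thesis
      by (simp add: cdf_def)
  qed
  consider "y = 0" | "0 < y" "y < 1" | "y = 1"
    using assms by linarith
  then show ?thesis
  proof cases
    case 1
    \<comment> \<open>The level 0 need not be attained, so its sublevel set is squeezed below those
      of small positive levels.\<close>
    have "prob {x. cdf M x \<le> 0} \<le> \<epsilon>" if "0 < \<epsilon>" for \<epsilon>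
    proof -
      have "prob {x. cdf M x \<le> 0} \<le> prob {x. cdf M x \<le> min \<epsilon> (1 / 2)}"
        using that by (intro finite_measure_mono) auto
      also have "\<dots> = min \<epsilon> (1 / 2)"
        using that by (intro pos) auto
      finally show ?thesis
        by simp
    qed
    then have "prob {x. cdf M x \<le> 0} \<le> 0"
      by (rule field_le_epsilon) simp
    then show ?thesis
      using 1 by (simp add: measure_le_0_iff)
  next
    case 3
    have "{x. cdf M x \<le> 1} = UNIV"
      using cdf_bounded_prob by auto
    then show ?thesis
      using 3 prob_space by simp
  qed (rule pos)
qed

lemma AE_cdf_less_1: "AE x in M. cdf M x < 1"
proof -
  have [measurable]: "cdf M \<in> borel_measurable borel"
    using cont by (rule borel_measurable_continuous_onI)
  have "1 \<le> prob {x. cdf M x < 1} + \<epsilon>" if "\<epsilon> > 0" for \<epsilon>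
  proof -
    define y where "y = max 0 (1 - \<epsilon>)"
    have "1 - \<epsilon> \<le> prob {x. cdf M x \<le> y}"
      using that by (subst prob_cdf_le) (auto simp: y_def)
    also have "\<dots> \<le> prob {x. cdf M x < 1}"
      using that by (intro finite_measure_mono) (auto simp: y_def)
    finally show ?thesis
      by simp
  qed
  then have "1 \<le> prob {x. cdf M x < 1}"
    by (rule field_le_epsilon)
  then have "prob {x. cdf M x < 1} = 1"
    by (rule antisym[OF prob_le_1])
  then show ?thesis
    by (subst (asm) prob_eq_1) simp_all
qed

lemma distr_exponential_transform: "distr M borel (exponential_transform (cdf M)) = std_exp"
proof -
  have [measurable]: "cdf M \<in> borel_measurable borel"
    using cont by (rule borel_measurable_continuous_onI)
  have meas: "exponential_transform (cdf M) \<in> borel_measurable M"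
    unfolding exponential_transform_def[abs_def] by measurable
  have "prob {x \<in> space M. exponential_transform (cdf M) x \<le> a} = 1 - exp (- a * 1)" if "a \<ge> 0" for a
  proof -
    have "prob {x. exponential_transform (cdf M) x \<le> a} = prob {x. cdf M x \<le> 1 - exp (- a)}"
    proof (rule finite_measure_eq_AE)
      show "AE x in M. x \<in> {x. exponential_transform (cdf M) x \<le> a} \<longleftrightarrow> x \<in> {x. cdf M x \<le> 1 - exp (- a)}"
        using AE_cdf_less_1
      proof eventually_elim
        case (elim x)
        have "exponential_transform (cdf M) x \<le> a \<longleftrightarrow> - a \<le> ln (1 - cdf M x)"
          by (auto simp: exponential_transform_def)
        also have "\<dots> \<longleftrightarrow> exp (- a) \<le> 1 - cdf M x"
          using elim by (subst ln_ge_iff) auto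
        finally show ?case
          by auto
      qed
      show "{x. exponential_transform (cdf M) x \<le> a} \<in> sets M"
        using meas by simp
    qed simp
    also have "\<dots> = 1 - exp (- a)"
      using that by (intro prob_cdf_le) auto
    finally show ?thesis
      by simp
  qed
  then have "distributed M lborel (exponential_transform (cdf M)) (exponential_density 1)"
    using meas by (subst exponential_distributed_iff) auto
  then have "distr M lborel (exponential_transform (cdf M)) = std_exp"
    by (simp add: distributed_distr_eq_density std_exp_def)
  moreover have "distr M lborel (exponential_transform (cdf M)) = distr M borel (exponential_transform (cdf M))"
    by (rule distr_cong) simp_all
  ultimately show ?thesis
    by simp
qed

text \<open>The inversion can fail only at points where the cdf is flat immediately to the left.
  Such a flat piece contains a rational \<open>q\<close>, and for each \<open>q\<close> the points
  above \<open>q\<close> at which the cdf has not increased form a null set. Elsewhere the defining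
  infimum is attained at \<open>x\<close>.\<close>

lemma AE_tail_quantile_inverse:
  "AE x in M. tail_quantile (cdf M) (exp (exponential_transform (cdf M) x)) = x"
proof -
  have [measurable]: "cdf M \<in> borel_measurable borel"
    using cont by (rule borel_measurable_continuous_onI)
  have "AE x in M. \<forall>q\<in>\<rat>. \<not> (q < x \<and> cdf M x \<le> cdf M q)"
  proof (subst AE_ball_countable[OF countable_rat], rule ballI)
    fix q :: real
    have "prob ({x. cdf M x \<le> cdf M q} - {..q}) = prob {x. cdf M x \<le> cdf M q} - prob {..q}"
      by (rule finite_measure_Diff) (auto intro: cdf_nondecreasing)
    also have "\<dots> = 0"
      using prob_cdf_le[of "cdf M q"] cdf_nonneg[of q] cdf_bounded_prob[of q] by (simp add: cdf_def)
    finally have "{x. cdf M x \<le> cdf M q} - {..q} \<in> null_sets M"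
      by (auto simp: null_sets_def emeasure_eq_measure)
    from AE_not_in[OF this] show "AE x in M. \<not> (q < x \<and> cdf M x \<le> cdf M q)"
      by eventually_elim auto
  qed
  then show ?thesis
    using AE_cdf_less_1
  proof eventually_elim
    case (elim x)
    have t: "exp (exponential_transform (cdf M) x) = 1 / (1 - cdf M x)"
      using elim(2) by (simp add: exponential_transform_def exp_minus inverse_eq_divide)
    have set: "cdf M z = 1 \<or> 1 / (1 - cdf M z) \<ge> 1 / (1 - cdf M x) \<longleftrightarrow> cdf M x \<le> cdf M z" for z
      using cdf_bounded_prob[of z] elim(2) by (cases "cdf M z = 1") (auto simp: field_simps)
    show ?case
      unfolding tail_quantile_def t set
    proof (rule cInf_eq_minimum)
      fix z assume "z \<in> {z. cdf M x \<le> cdf M z}"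
      then have z: "cdf M x \<le> cdf M z"
        by simp
      show "x \<le> z"
      proof (rule ccontr)
        assume "\<not> x \<le> z"
        then obtain q where q: "q \<in> \<rat>" "z < q" "q < x"
          using Rats_dense_in_real[of z x] by auto
        then have "cdf M x \<le> cdf M q"
          using z cdf_nondecreasing[of z q] by simp
        then show False
          using elim(1) q by blast
      qed
    qed simp
  qed
qed

end

text \<open>For arguments up to 1 the defining set is the whole line and its \<open>Inf\<close>
  carries no meaning; above 1 the set is nonempty and bounded below, by the limits of the
  cdf.\<close>

lemma tail_quantile_mono:
  assumes "1 < s" "s \<le> t"
  shows "tail_quantile (cdf M) s \<le> tail_quantile (cdf M) t"
proof -
  let ?S = "\<lambda>t. {x. cdf M x = 1 \<or> 1 / (1 - cdf M x) \<ge> t}"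
  have S: "?S t = {x. cdf M x \<ge> 1 - 1 / t}" if "t > 1" for t
  proof -
    have "cdf M x = 1 \<or> 1 / (1 - cdf M x) \<ge> t \<longleftrightarrow> cdf M x \<ge> 1 - 1 / t" for x
    proof (cases "cdf M x = 1")
      case True
      then show ?thesis
        using that by simp
    next
      case False
      then have "1 - cdf M x > 0"
        using cdf_bounded_prob[of x] by simp
      then have "t \<le> 1 / (1 - cdf M x) \<longleftrightarrow> 1 - cdf M x \<le> 1 / t"
        using that by (simp add: pos_le_divide_eq mult.commute)
      then show ?thesis
        using False by linarith
    qed
    then show ?thesis
      by blast
  qed
  have "\<forall>\<^sub>F x in at_top. 1 - 1 / t < cdf M x"
    by (rule order_tendstoD[OF cdf_lim_at_top_prob]) (use assms in auto)
  then have ne: "?S t \<noteq> {}"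
    using assms unfolding S[of t, OF less_le_trans[OF assms]] eventually_at_top_linorder by (auto intro: less_imp_le)
  have "\<forall>\<^sub>F x in at_bot. cdf M x < 1 - 1 / s"
    by (rule order_tendstoD[OF cdf_lim_at_bot]) (use assms in auto)
  then obtain l where l: "cdf M l < 1 - 1 / s"
    unfolding eventually_at_bot_linorder by blast
  have "bdd_below (?S s)"
    unfolding S[OF assms(1)]
  proof (rule bdd_belowI[of _ l])
    fix x assume "x \<in> {x. 1 - 1 / s \<le> cdf M x}"
    then show "l \<le> x"
      using l cdf_nondecreasing[of x l] by (cases "l \<le> x") auto
  qed
  moreover have "?S t \<subseteq> ?S s"
    using assms by auto
  ultimately show ?thesis
    unfolding tail_quantile_def by (intro cInf_superset_mono[OF ne])
qed

end

section \<open>Measurability of the estimators\<close>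

lemma (in prob_space) order_stat_measurable:
  assumes xs: "\<And>\<omega>. lists_values (xs \<omega>) I (\<lambda>i. X i \<omega>)"
    and [measurable]: "\<And>i. i \<in> I \<Longrightarrow> X i \<in> borel_measurable M"
    and i: "1 \<le> i" "i \<le> card I"
  shows "(\<lambda>\<omega>. order_stat (xs \<omega>) i) \<in> borel_measurable M"
proof (rule borel_measurableI_greater)
  fix y
  have I: "finite I"
    using xs by (auto simp: lists_values_def)
  have "{\<omega>\<in>space M. y < order_stat (xs \<omega>) i}
      = {\<omega>\<in>space M. real (card I - i) < (\<Sum>i\<in>I. indicator {y<..} (X i \<omega>))}"
  proof -
    have "y < order_stat (xs \<omega>) i \<longleftrightarrow> real (card I - i) < (\<Sum>i\<in>I. indicator {y<..} (X i \<omega>))" for \<omega>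
    proof -
      have "(\<Sum>i\<in>I. indicator {y<..} (X i \<omega>)) = real (card {i\<in>I. y < X i \<omega>})"
        using I by (simp add: indicator_def sum.If_cases Int_def)
      then show ?thesis
        using order_stat_greater_iff[of i "xs \<omega>" y] i
        unfolding lists_values_length[OF xs] lists_values_filter[OF xs] by (simp only: of_nat_less_iff)
    qed
    then show ?thesis
      by simp
  qed
  also have "\<dots> \<in> sets M"
    by measurable
  finally show "{\<omega>\<in>space M. y < order_stat (xs \<omega>) i} \<in> sets M" .
qed

lemma (in prob_space) hill_measurable:
  assumes xs: "\<And>\<omega>. lists_values (xs \<omega>) I (\<lambda>i. X i \<omega>)"
    and X: "\<And>i. i \<in> I \<Longrightarrow> X i \<in> borel_measurable M"
    and k: "k < card I"
  shows "(\<lambda>\<omega>. hill (xs \<omega>) k) \<in> borel_measurable M"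
  unfolding hill_def lists_values_length[OF xs]
  by (intro borel_measurable_times borel_measurable_const borel_measurable_sum borel_measurable_ln
      borel_measurable_divide order_stat_measurable[OF xs X]) (use k in auto)

locale tail_sample = prob_space M for M :: "'a measure" +
  fixes X :: "'i \<Rightarrow> 'a \<Rightarrow> real" and I0 :: "'i set" and F A :: "real \<Rightarrow> real" and \<gamma> \<rho> :: real
  assumes indep_X: "indep_vars (\<lambda>_. borel) X I0"
    and countable_I0: "countable I0" and I0_nonempty: "I0 \<noteq> {}"
    and cdf_X: "i \<in> I0 \<Longrightarrow> cdf (distr M borel (X i)) = F"
    and F_cont: "continuous_on UNIV F"
    and second_order: "second_order_cond \<gamma> \<rho> A (tail_quantile F)"
begin

definition W :: "'i \<Rightarrow> 'a \<Rightarrow> real" where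
  "W i \<omega> = exponential_transform F (X i \<omega>)"

lemma measurable_X [measurable]: "i \<in> I0 \<Longrightarrow> X i \<in> borel_measurable M"
  using indep_X by (auto simp: indep_vars_def)

lemma measurable_transform [measurable]: "exponential_transform F \<in> borel_measurable borel"
proof -
  have [measurable]: "F \<in> borel_measurable borel"
    using F_cont by (rule borel_measurable_continuous_onI)
  show ?thesis
    unfolding exponential_transform_def[abs_def] by measurable
qed

lemma real_distribution_X: "i \<in> I0 \<Longrightarrow> real_distribution (distr M borel (X i))"
  by (rule real_distribution_distr) simp

lemma F_mono: "x \<le> y \<Longrightarrow> F x \<le> F y"
proof -
  obtain i where i: "i \<in> I0"
    using I0_nonempty by blast
  note X = real_distribution_X[OF i]
  show "x \<le> y \<Longrightarrow> F x \<le> F y"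
    using finite_borel_measure.cdf_nondecreasing[OF real_distribution.finite_borel_measure_M[OF X], of x y]
    by (simp add: cdf_X[OF i])
qed

sublocale exponential_sample M W I0
proof
  show "indep_vars (\<lambda>_. borel) W I0"
    unfolding W_def by (rule indep_vars_compose2[OF indep_X]) simp
  fix i assume i: "i \<in> I0"
  note X = real_distribution_X[OF i]
  have "distr (distr M borel (X i)) borel (exponential_transform F) = std_exp"
    using real_distribution.distr_exponential_transform[OF X] F_cont unfolding cdf_X[OF i] by blast
  then show "distr M borel (W i) = std_exp"
    using i by (subst (asm) distr_distr) (auto simp: W_def[abs_def] o_def)
qed

text \<open>Invertibility is asked for all observations at once, so that one null set serves every
  sample size; countability of \<open>I0\<close> makes this possible.\<close>

definition regular_outcome :: "'a \<Rightarrow> bool" where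
  "regular_outcome \<omega> \<longleftrightarrow> (\<forall>i\<in>I0. F (X i \<omega>) < 1 \<and> tail_quantile F (exp (W i \<omega>)) = X i \<omega>)"

lemma AE_regular_outcome: "AE \<omega> in M. regular_outcome \<omega>"
  unfolding regular_outcome_def
proof (subst AE_ball_countable[OF countable_I0], rule ballI)
  fix i assume i: "i \<in> I0"
  note X = real_distribution_X[OF i]
  have "AE x in distr M borel (X i). F x < 1 \<and> tail_quantile F (exp (exponential_transform F x)) = x"
    using real_distribution.AE_cdf_less_1[OF X] real_distribution.AE_tail_quantile_inverse[OF X] F_cont unfolding cdf_X[OF i]
    by (intro AE_conjI)
  from AE_distrD[OF measurable_X[OF i] this]
  show "AE \<omega> in M. F (X i \<omega>) < 1 \<and> tail_quantile F (exp (W i \<omega>)) = X i \<omega>"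
    by (simp add: W_def)
qed

lemma tail_quantile_F_mono: "1 < s \<Longrightarrow> s \<le> t \<Longrightarrow> tail_quantile F s \<le> tail_quantile F t"
proof -
  obtain i where i: "i \<in> I0"
    using I0_nonempty by blast
  note X = real_distribution_X[OF i]
  show "1 < s \<Longrightarrow> s \<le> t \<Longrightarrow> tail_quantile F s \<le> tail_quantile F t"
    using real_distribution.tail_quantile_mono[OF X] unfolding cdf_X[OF i] .
qed

text \<open>The log-quantile function is frozen below \<open>w0\<close>. It is then monotone on the
  whole line and therefore Borel measurable, while increments near infinity are unaffected.\<close>

lemma log_quantile_variation:
  obtains f w0 where "second_order_variation f (\<lambda>w. A (exp w)) \<rho>"
    "\<And>w. w \<ge> w0 \<Longrightarrow> tail_quantile F (exp w) > 0 \<and> f w + \<gamma> * w = ln (tail_quantile F (exp w))"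
    "mono_on {w0..} (\<lambda>w. f w + \<gamma> * w)"
proof -
  let ?U = "tail_quantile F"
  note log = second_order_cond_log[OF second_order tail_quantile_F_mono]
  have "\<forall>\<^sub>F w in at_top. ?U (exp w) > 0"
    using eventually_compose_filterlim[OF log(1) exp_at_top] .
  then obtain w1 where w1: "\<And>w. w \<ge> w1 \<Longrightarrow> ?U (exp w) > 0"
    unfolding eventually_at_top_linorder by blast
  \<comment> \<open>The lower bound 1 ensures \<open>exp w > 1\<close>, the range on which the tail
    quantile function is monotone.\<close>
  define w0 where "w0 = max w1 1"
  have w0: "w0 > 0" and pos: "\<And>w. w \<ge> w0 \<Longrightarrow> ?U (exp w) > 0"
    using w1 by (auto simp: w0_def)
  have mono: "ln (?U (exp v)) \<le> ln (?U (exp w))" if "w0 \<le> v" "v \<le> w" for v w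
    using that pos[of v] pos[of w] w0 tail_quantile_F_mono[of "exp v" "exp w"] by simp
  define V where "V w = ln (?U (exp (max w0 w)))" for w
  have "mono V"
    unfolding V_def by (intro monoI mono) auto
  then have [measurable]: "V \<in> borel_measurable borel"
    by (rule borel_measurable_mono)
  define f where "f w = V w - \<gamma> * w" for w
  have V: "f w + \<gamma> * w = ln (?U (exp w))" if "w \<ge> w0" for w
    using that by (simp add: f_def V_def max_def)
  have "second_order_variation f (\<lambda>w. A (exp w)) \<rho>"
  proof
    show "f \<in> borel_measurable borel"
      unfolding f_def by measurable
    show "\<rho> \<le> 0"
      using second_order by (simp add: second_order_cond_def)
    show "(\<forall>\<^sub>F w in at_top. 0 < A (exp w)) \<or> (\<forall>\<^sub>F w in at_top. A (exp w) < 0)"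
      using second_order eventually_compose_filterlim[OF _ exp_at_top]
      unfolding second_order_cond_def by blast
    fix s
    show "((\<lambda>w. (f (w + s) - f w) / A (exp w)) \<longlongrightarrow> box_cox \<rho> s) at_top"
    proof (rule Lim_transform_eventually[OF log(2)])
      show "\<forall>\<^sub>F w in at_top. (ln (?U (exp (w + s))) - ln (?U (exp w)) - \<gamma> * s) / A (exp w)
          = (f (w + s) - f w) / A (exp w)"
        using eventually_ge_at_top[of w0] eventually_ge_at_top[of "w0 - s"]
      proof eventually_elim
        case (elim w)
        then show ?case
          using V[of w] V[of "w + s"] by (simp add: algebra_simps)
      qed
    qed
  qed
  moreover have "mono_on {w0..} (\<lambda>w. f w + \<gamma> * w)"
    using \<open>mono V\<close> by (auto simp: f_def mono_on_def mono_def)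
  ultimately show thesis
    using that pos V by blast
qed

text \<open>The transform is monotone on the observed values, so it maps the empirical threshold of
  the sample to that of the exponential variables, and logarithms of ratios become differences of
  \<open>V\<close>.\<close>

lemma hill_eq_excess_sum:
  assumes reg: "regular_outcome \<omega>" and I: "I \<subseteq> I0" and xs: "lists_values xs I (\<lambda>i. X i \<omega>)"
    and k: "1 \<le> k" "k < card I"
    and V: "\<And>w. w \<ge> w0 \<Longrightarrow> tail_quantile F (exp w) > 0 \<and> V w = ln (tail_quantile F (exp w))"
    and w: "w = order_stat (map (exponential_transform F) xs) (card I - k)" "w \<ge> w0"
  shows "real k * hill xs k = (\<Sum>i\<in>I. if w < W i \<omega> then V (W i \<omega>) - V w else 0)"
proof -
  let ?e = "exponential_transform F"
  define th where "th = order_stat xs (length xs - k)"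
  have len: "length xs = card I" and set: "set xs = (\<lambda>i. X i \<omega>) ` I"
    using lists_values_length[OF xs] lists_values_set[OF xs] .
  have reg': "F (X i \<omega>) < 1" "tail_quantile F (exp (W i \<omega>)) = X i \<omega>" if "i \<in> I" for i
    using reg that I by (auto simp: regular_outcome_def)
  have e_mono: "?e x \<le> ?e y" if "x \<le> y" "F y < 1" for x y
    using F_mono[OF that(1)] that(2) by (simp add: exponential_transform_def)
  have w_th: "w = ?e th"
    unfolding w(1) th_def len[symmetric]
  proof (rule order_stat_map_mono)
    show "mono_on (set xs) ?e"
      using e_mono reg' by (auto simp: set mono_on_def)
  qed (use k len in auto)
  have "th \<in> set xs"
    unfolding th_def using k len by (intro order_stat_in_set) auto
  then obtain q where q: "q \<in> I" "th = X q \<omega>"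
    by (auto simp: set)
  then have wq: "w = W q \<omega>" and th_eq: "th = tail_quantile F (exp w)"
    using w_th reg'[of q] by (auto simp: W_def)
  have th_pos: "th > 0"
    using V[OF w(2)] th_eq by simp
  \<comment> \<open>Monotonicity alone gives weak inequalities. Equal transforms force equal
    observations, because the tail quantile function recovers each observation from its
    transform.\<close>
  have less: "th < X i \<omega> \<longleftrightarrow> w < W i \<omega>" if i: "i \<in> I" for i
  proof
    assume *: "th < X i \<omega>"
    then have "w \<le> W i \<omega>"
      using e_mono[of th "X i \<omega>"] reg'[OF i] by (simp add: w_th W_def)
    moreover have "w \<noteq> W i \<omega>"
      using * reg'(2)[OF i] th_eq by auto
    ultimately show "w < W i \<omega>"
      by simp
  next
    assume "w < W i \<omega>"
    then show "th < X i \<omega>"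
      using e_mono[of "X i \<omega>" th] reg'(1)[OF q(1)] q(2) by (force simp: w_th W_def not_less[symmetric])
  qed
  have "real k * hill xs k = (\<Sum>i\<in>I. if th < X i \<omega> then ln (X i \<omega> / th) else 0)"
    using hill_eq_sum_list[OF k(1) _ th_def th_pos] k len by (simp add: lists_values_sum[OF xs])
  also have "\<dots> = (\<Sum>i\<in>I. if w < W i \<omega> then V (W i \<omega>) - V w else 0)"
  proof (rule sum.cong)
    fix i assume i: "i \<in> I"
    show "(if th < X i \<omega> then ln (X i \<omega> / th) else 0) = (if w < W i \<omega> then V (W i \<omega>) - V w else 0)"
      using less[OF i] V[of "W i \<omega>"] V[OF w(2)] w(2) th_pos th_eq reg'(2)[OF i]
      by (auto simp: ln_div)
  qed simp
  finally show ?thesis .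
qed

text \<open>Stated for arbitrary index sets and counts so that it applies to every machine and to
  the combined sample with the same variables \<open>W\<close>; the resulting sums can then be added
  and compared on one probability space.\<close>

theorem hill_linearization:
  fixes I :: "nat \<Rightarrow> 'i set" and \<kappa> :: "nat \<Rightarrow> nat" and xs :: "nat \<Rightarrow> 'a \<Rightarrow> real list"
  assumes I: "\<And>n. I n \<subseteq> I0" and xs: "\<And>n \<omega>. lists_values (xs n \<omega>) (I n) (\<lambda>i. X i \<omega>)"
    and \<kappa>: "filterlim \<kappa> at_top sequentially"
    and ratio: "filterlim (\<lambda>n. real (card (I n)) / real (\<kappa> n)) at_top sequentially"
    and bias: "(\<lambda>n. sqrt (real (\<kappa> n)) * A (real (card (I n)) / real (\<kappa> n))) \<longlonglongrightarrow> lam"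
  shows "((\<lambda>p. sqrt (real (\<kappa> (fst p))) * (hill (xs (fst p) (snd p)) (\<kappa> (fst p)) - \<gamma>)
      - \<gamma> * (\<Sum>i\<in>I (fst p). excess (\<lambda>s. s - 1) (ln (real (card (I (fst p))) / real (\<kappa> (fst p)))) (W i (snd p)))
        / sqrt (real (\<kappa> (fst p)))) \<longlongrightarrow> lam / (1 - \<rho>)) (whp M)"
proof -
  define u where "u n = ln (real (card (I n)) / real (\<kappa> n))" for n
  have big: "\<forall>\<^sub>F n in sequentially. real (card (I n)) / real (\<kappa> n) > 1"
    using ratio by (simp add: filterlim_at_top_dense)
  have exp_u: "\<forall>\<^sub>F n in sequentially. exp (u n) = real (card (I n)) / real (\<kappa> n)"
    using big by eventually_elim (simp add: u_def)
  have k_less: "\<forall>\<^sub>F n in sequentially. 1 \<le> \<kappa> n \<and> \<kappa> n < card (I n)"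
    using big
  proof eventually_elim
    case (elim n)
    then have "\<kappa> n > 0"
      by (cases "\<kappa> n") auto
    then show ?case
      using elim by (simp add: less_divide_eq)
  qed
  interpret E: exponential_array M W I0 I \<kappa> u
  proof
    show "finite (I n)" "I n \<subseteq> I0" for n
      using xs I by (auto simp: lists_values_def)
    show "filterlim u at_top sequentially"
      unfolding u_def using filterlim_compose[OF ln_at_top ratio] .
    show "\<forall>\<^sub>F n in sequentially. real (card (I n)) * exp (- u n) = real (\<kappa> n)"
      using exp_u k_less by eventually_elim (simp add: exp_minus inverse_eq_divide)
  qed (rule \<kappa>)
  obtain f w0 where f: "second_order_variation f (\<lambda>w. A (exp w)) \<rho>"
    and V: "\<And>w. w \<ge> w0 \<Longrightarrow> tail_quantile F (exp w) > 0 \<and> f w + \<gamma> * w = ln (tail_quantile F (exp w))"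
    and mono: "mono_on {w0..} (\<lambda>w. f w + \<gamma> * w)"
    by (rule log_quantile_variation) blast
  define w where "w n \<omega> = order_stat (map (exponential_transform F) (xs n \<omega>)) (card (I n) - \<kappa> n)" for n \<omega>
  have bias': "(\<lambda>n. sqrt (real (\<kappa> n)) * A (exp (u n))) \<longlonglongrightarrow> lam"
    by (rule Lim_transform_eventually[OF bias]) (use exp_u in \<open>auto elim: eventually_mono\<close>)
  \<comment> \<open>The rank from below is \<open>card (I n) - \<kappa> n\<close>, so the threshold
    exceeds \<open>x\<close> exactly when strictly more than \<open>\<kappa> n\<close> observations
    do.\<close>
  have w_iff: "\<forall>\<^sub>F p in whp M. \<forall>x. x < w (fst p) (snd p) \<longleftrightarrow> \<kappa> (fst p) < card {i\<in>I (fst p). x < W i (snd p)}"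
    using eventually_whp_fst[OF k_less]
  proof (eventually_elim, intro allI)
    fix p :: "nat \<times> 'a" and x assume k: "1 \<le> \<kappa> (fst p) \<and> \<kappa> (fst p) < card (I (fst p))"
    have l: "lists_values (map (exponential_transform F) (xs (fst p) (snd p))) (I (fst p)) (\<lambda>i. W i (snd p))"
      unfolding W_def by (rule lists_values_map[OF xs])
    show "x < w (fst p) (snd p) \<longleftrightarrow> \<kappa> (fst p) < card {i\<in>I (fst p). x < W i (snd p)}"
      unfolding w_def using k
      by (subst order_stat_greater_iff) (simp_all only: lists_values_length[OF l] lists_values_filter[OF l], auto)
  qed
  have H: "\<forall>\<^sub>F p in whp M. w0 \<le> w (fst p) (snd p) \<longrightarrow>
      real (\<kappa> (fst p)) * hill (xs (fst p) (snd p)) (\<kappa> (fst p)) =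
      (\<Sum>i\<in>I (fst p). if w (fst p) (snd p) < W i (snd p)
        then (f (W i (snd p)) + \<gamma> * W i (snd p)) - (f (w (fst p) (snd p)) + \<gamma> * w (fst p) (snd p)) else 0)"
    using eventually_whp_fst[OF k_less] eventually_whp_AE[OF AE_regular_outcome]
  proof eventually_elim
    case (elim p)
    then show ?case
      using hill_eq_excess_sum[OF elim(2) I xs _ _ V w_def] by auto
  qed
  have "((\<lambda>p. sqrt (real (\<kappa> (fst p))) * (hill (xs (fst p) (snd p)) (\<kappa> (fst p)) - \<gamma>)
      - \<gamma> * E.excess_sum (\<lambda>s. s - 1) (fst p) (snd p) / sqrt (real (\<kappa> (fst p)))) \<longlongrightarrow> lam / (1 - \<rho>)) (whp M)"
    by (rule E.hill_expansion[OF f mono bias' w_iff H])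
  then show ?thesis
    by (simp add: E.excess_sum_def u_def)
qed

lemma auxiliary_ratio:
  assumes t: "filterlim t at_top sequentially" and y: "y \<longlonglongrightarrow> l" "l > 0"
  shows "(\<lambda>n. A (t n * y n) / A (t n)) \<longlonglongrightarrow> l powr \<rho>"
proof -
  obtain f w0 where "second_order_variation f (\<lambda>w. A (exp w)) \<rho>"
    using log_quantile_variation by blast
  then interpret second_order_variation f "\<lambda>w. A (exp w)" \<rho> .
  have "(\<lambda>n. A (exp (ln (t n) + ln (y n))) / A (exp (ln (t n)))) \<longlonglongrightarrow> exp (\<rho> * ln l)"
    by (rule a_ratio_seq[OF filterlim_compose[OF ln_at_top t] tendsto_ln[OF y(1)]]) (use y in auto)
  moreover have "\<forall>\<^sub>F n in sequentially. A (exp (ln (t n) + ln (y n))) / A (exp (ln (t n))) = A (t n * y n) / A (t n)"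
    using eventually_compose_filterlim[OF eventually_gt_at_top[of 0] t] order_tendstoD(1)[OF y]
    by eventually_elim (simp add: exp_add)
  ultimately have "(\<lambda>n. A (t n * y n) / A (t n)) \<longlonglongrightarrow> exp (\<rho> * ln l)"
    by (rule Lim_transform_eventually)
  then show ?thesis
    using y(2) by (simp add: powr_def)
qed

end

section \<open>The pooled estimator\<close>

text \<open>The hypotheses compare everything with machine 1; normalizing the reciprocals
  \<open>1 / c j\<close> turns them into limiting proportions.\<close>

lemma fractions_tendsto:
  fixes a :: "nat \<Rightarrow> 'j \<Rightarrow> real"
  assumes J: "finite J" "j1 \<in> J"
    and c: "\<And>j. j \<in> J \<Longrightarrow> c j > 0 \<and> (\<lambda>n. a n j1 / a n j) \<longlonglongrightarrow> c j"
  obtains p where "\<And>j. j \<in> J \<Longrightarrow> p j > 0" "(\<Sum>j\<in>J. p j) = 1"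
    "\<And>j. j \<in> J \<Longrightarrow> (\<lambda>n. a n j / (\<Sum>j\<in>J. a n j)) \<longlonglongrightarrow> p j"
proof -
  have inv: "(\<lambda>n. a n j / a n j1) \<longlonglongrightarrow> 1 / c j" if "j \<in> J" for j
  proof -
    have "(\<lambda>n. 1 / (a n j1 / a n j)) \<longlonglongrightarrow> 1 / c j"
      using c[OF that] by (intro tendsto_divide) auto
    then show ?thesis
      by simp
  qed
  define C where "C = (\<Sum>j\<in>J. 1 / c j)"
  have C: "C > 0"
    unfolding C_def using J c by (intro sum_pos) auto
  have total: "(\<lambda>n. (\<Sum>j\<in>J. a n j) / a n j1) \<longlonglongrightarrow> C"
    unfolding C_def sum_divide_distrib by (intro tendsto_sum inv)
  \<comment> \<open>A zero denominator would make the quotient 0, against its positive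
    limit.\<close>
  have nz: "\<forall>\<^sub>F n in sequentially. a n j1 \<noteq> 0"
    using order_tendstoD(1)[OF total C] by (auto elim: eventually_mono)
  show thesis
  proof (rule that[of "\<lambda>j. 1 / c j / C"])
    show "1 / c j / C > 0" if "j \<in> J" for j
      using c[OF that] C by simp
    show "(\<Sum>j\<in>J. 1 / c j / C) = 1"
      unfolding sum_divide_distrib[symmetric] C_def[symmetric] using C by simp
    fix j assume j: "j \<in> J"
    have "(\<lambda>n. (a n j / a n j1) / ((\<Sum>j\<in>J. a n j) / a n j1)) \<longlonglongrightarrow> 1 / c j / C"
      using C by (intro tendsto_divide inv total j) auto
    then show "(\<lambda>n. a n j / (\<Sum>j\<in>J. a n j)) \<longlonglongrightarrow> 1 / c j / C"
      by (rule Lim_transform_eventually) (use nz in \<open>auto elim!: eventually_mono\<close>)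
  qed
qed

lemma powr_neg_gt_tangent:
  fixes x \<rho> :: real
  assumes "x > 0" "x \<noteq> 1" "\<rho> < 0"
  shows "1 + \<rho> * (x - 1) < x powr \<rho>"
proof -
  have "ln x < x - 1"
    using assms ln_le_minus_one[of x] ln_eq_minus_one[of x] by force
  then have "1 + \<rho> * (x - 1) < 1 + \<rho> * ln x"
    using assms(3) by simp
  also have "\<dots> \<le> exp (\<rho> * ln x)"
    by (rule exp_ge_add_one_self)
  finally show ?thesis
    using assms(1) by (simp add: powr_def)
qed

text \<open>Strict Jensen inequality for \<open>x powr \<rho>\<close>, through its tangent at \<open>1\<close>.\<close>

lemma weighted_powr_sum_eq_1_iff:
  fixes p q :: "'j \<Rightarrow> real"
  assumes J: "finite J" and pq: "\<And>j. j \<in> J \<Longrightarrow> p j > 0 \<and> q j > 0"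
    and sums: "(\<Sum>j\<in>J. p j) = 1" "(\<Sum>j\<in>J. q j) = 1" and "\<rho> \<le> 0"
  shows "(\<Sum>j\<in>J. p j * (q j / p j) powr \<rho>) = 1 \<longleftrightarrow> \<rho> = 0 \<or> (\<forall>j\<in>J. p j = q j)"
proof (cases "\<rho> = 0")
  case True
  have "(\<Sum>j\<in>J. p j * (q j / p j) powr \<rho>) = (\<Sum>j\<in>J. p j)"
    using pq True by (intro sum.cong) (auto simp: less_le)
  then show ?thesis
    using True sums by simp
next
  case False
  then have \<rho>: "\<rho> < 0"
    using assms by simp
  \<comment> \<open>The weighted gap between the power function and its tangent at 1. The linear
    parts cancel in the sum because \<open>p\<close> and \<open>q\<close> have the same
    total.\<close>
  define g where "g j = p j * ((q j / p j) powr \<rho> - (1 + \<rho> * (q j / p j - 1)))" for j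
  have g: "g j \<ge> 0 \<and> (g j = 0 \<longleftrightarrow> p j = q j)" if "j \<in> J" for j
  proof (cases "p j = q j")
    case True
    then show ?thesis
      using pq[OF that] by (simp add: g_def)
  next
    case False
    then have "1 + \<rho> * (q j / p j - 1) < (q j / p j) powr \<rho>"
      using pq[OF that] \<rho> by (intro powr_neg_gt_tangent) auto
    then have "g j > 0"
      using pq[OF that] by (simp add: g_def)
    then show ?thesis
      using False by simp
  qed
  have "g j = p j * (q j / p j) powr \<rho> - (p j + \<rho> * (q j - p j))" if "j \<in> J" for j
    using pq[OF that] by (simp add: g_def field_simps)
  then have "(\<Sum>j\<in>J. g j) = (\<Sum>j\<in>J. p j * (q j / p j) powr \<rho> - (p j + \<rho> * (q j - p j)))"
    by (rule sum.cong[OF refl])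
  also have "\<dots> = (\<Sum>j\<in>J. p j * (q j / p j) powr \<rho>) - 1"
    by (simp add: sum_subtractf sum.distrib sum_distrib_left[symmetric] sums)
  finally have "(\<Sum>j\<in>J. p j * (q j / p j) powr \<rho>) = 1 \<longleftrightarrow> (\<Sum>j\<in>J. g j) = 0"
    by linarith
  also have "\<dots> \<longleftrightarrow> (\<forall>j\<in>J. g j = 0)"
    using g J by (intro sum_nonneg_eq_0_iff) auto
  finally show ?thesis
    using g False by auto
qed

lemma weak_conv_m_cong_eventually:
  assumes "\<forall>\<^sub>F n in sequentially. \<mu> n = \<nu> n"
  shows "weak_conv_m \<mu> L \<longleftrightarrow> weak_conv_m \<nu> L"
proof -
  have "(\<lambda>n. cdf (\<mu> n) x) \<longlonglongrightarrow> y \<longleftrightarrow> (\<lambda>n. cdf (\<nu> n) x) \<longlonglongrightarrow> y" for x y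
    by (rule tendsto_cong) (use assms in \<open>auto elim: eventually_mono\<close>)
  then show ?thesis
    by (simp add: weak_conv_m_def weak_conv_def)
qed

theorem theorem3:
  fixes M :: "'a measure"
    and m :: nat
    and X :: "nat \<Rightarrow> nat \<Rightarrow> 'a \<Rightarrow> real"
    and F A :: "real \<Rightarrow> real"
    and \<gamma> \<rho> lam :: real
    and N K :: "nat \<Rightarrow> nat \<Rightarrow> nat"
    and k :: "nat \<Rightarrow> nat"
    and b c :: "nat \<Rightarrow> real"
    and w :: "nat \<Rightarrow> nat \<Rightarrow> real"
  assumes "prob_space M"
    and "m \<ge> 1"
    and indep: "prob_space.indep_vars M (\<lambda>_. borel) (\<lambda>(i, j). X i j) ({1..} \<times> {1..m})"
    and ident: "\<And>i j. i \<ge> 1 \<Longrightarrow> j \<in> {1..m} \<Longrightarrow> cdf (distr M borel (X i j)) = F"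
    and F_cont: "continuous_on UNIV F"
    and C2: "second_order_cond \<gamma> \<rho> A (tail_quantile F)"
    and N_sum: "\<And>n. n = (\<Sum>j=1..m. N n j)"
    and K_pos: "\<And>n j. j \<in> {1..m} \<Longrightarrow> K n j \<ge> 1"
    and k_def: "\<And>n. k n = (\<Sum>j=1..m. K n j)"
    and b: "\<And>j. j \<in> {1..m} \<Longrightarrow> b j > 0 \<and> (\<lambda>n. real (N n 1) / real (N n j)) \<longlonglongrightarrow> b j"
    and c: "\<And>j. j \<in> {1..m} \<Longrightarrow> c j > 0 \<and> (\<lambda>n. real (K n 1) / real (K n j)) \<longlonglongrightarrow> c j"
    and k_top: "filterlim k at_top sequentially"
    and k_over_n: "(\<lambda>n. real (k n) / real n) \<longlonglongrightarrow> 0"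
    and bias: "(\<lambda>n. sqrt (real (k n)) * A (real n / real (k n))) \<longlonglongrightarrow> lam"
    and "lam \<noteq> 0"
    and w_def: "\<And>n j. w n j = real (K n j) / real (k n)"
  shows
    "(weak_conv_m
        (\<lambda>n. distr M borel (\<lambda>\<omega>. sqrt (real (k n)) * (pooled_hill X m (N n) (K n) (w n) \<omega> - \<gamma>)))
        (density lborel (normal_density (lam / (1 - \<rho>)) \<gamma>))
      \<longleftrightarrow>
      \<rho> = 0 \<or>
      (\<forall>j\<in>{1..m}. \<exists>\<epsilon>. \<epsilon> \<in> o(\<lambda>n. 1 :: real) \<and>
         (\<forall>\<^sub>F n in sequentially.
            real (K n j) / real (N n j) = real (k n) / real n * (1 + \<epsilon> n))))
     \<and>
     ((\<forall>j\<in>{1..m}. \<exists>\<epsilon>. \<epsilon> \<in> O(\<lambda>n. 1 / sqrt (real (k n))) \<and>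
         (\<forall>\<^sub>F n in sequentially.
            real (K n j) / real (N n j) = real (k n) / real n * (1 + \<epsilon> n)))
      \<longrightarrow>
      prob_space.conv_to_0_in_prob M
        (\<lambda>n \<omega>. sqrt (real (k n)) *
           (pooled_hill X m (N n) (K n) (w n) \<omega> - hill (combined_sample X m (N n) \<omega>) (k n))))"
proof -
  interpret prob_space M
    by fact
  define J where "J = {1..m}"
  have J: "finite J" "1 \<in> J"
    using \<open>m \<ge> 1\<close> by (auto simp: J_def)
  \<comment> \<open>Indexing by pairs makes all machines one independent family, with subsamples and
    combined sample as index subsets.\<close>
  define Xp where "Xp p = X (fst p) (snd p)" for p
  interpret tail_sample M Xp "{1..} \<times> {1..m}" F A \<gamma> \<rho>
  proof
    show "indep_vars (\<lambda>_. borel) Xp ({1..} \<times> {1..m})"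
      using indep by (simp add: Xp_def[abs_def] case_prod_beta')
    show "({1..} \<times> {1..m} :: (nat \<times> nat) set) \<noteq> {}"
      using \<open>m \<ge> 1\<close> by auto
    show "cdf (distr M borel (Xp p)) = F" if "p \<in> {1..} \<times> {1..m}" for p
      unfolding Xp_def using ident that by auto
  qed (auto intro: F_cont C2)
  have \<gamma>: "\<gamma> > 0" and \<rho>: "\<rho> \<le> 0" and A_nz: "\<forall>\<^sub>F t in at_top. A t \<noteq> 0"
    using C2 by (auto simp: second_order_cond_def elim: eventually_mono)

  \<comment> \<open>Index sets of the subsamples and of the combined sample\<close>
  define Ij where "Ij n j = {1..N n j} \<times> {j}" for n j
  define I where "I n = (\<Union>j\<in>J. Ij n j)" for n
  have Ij_sub: "Ij n j \<subseteq> {1..} \<times> {1..m}" if "j \<in> J" for n j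
    using that by (auto simp: Ij_def J_def)
  then have I_sub: "I n \<subseteq> {1..} \<times> {1..m}" for n
    unfolding I_def by blast
  have I_fin: "finite (I n)" for n
    using J by (auto simp: I_def Ij_def)
  have card_Ij: "card (Ij n j) = N n j" for n j
    by (simp add: Ij_def card_cartesian_product)
  have sum_Ij: "(\<Sum>p\<in>Ij n j. \<phi> p) = (\<Sum>i=1..N n j. \<phi> (i, j))" for n j and \<phi> :: "nat \<times> nat \<Rightarrow> real"
  proof -
    have "Ij n j = (\<lambda>i. (i, j)) ` {1..N n j}"
      by (auto simp: Ij_def)
    then show ?thesis
      by (simp add: sum.reindex inj_on_def)
  qed
  have sum_I: "(\<Sum>p\<in>I n. \<phi> p) = (\<Sum>j\<in>J. \<Sum>p\<in>Ij n j. \<phi> p)" for n and \<phi> :: "nat \<times> nat \<Rightarrow> real"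
    unfolding I_def using J by (intro sum.UNION_disjoint) (auto simp: Ij_def)
  have card_I: "card (I n) = n" for n
  proof -
    have "real (card (I n)) = (\<Sum>j\<in>J. \<Sum>p\<in>Ij n j. 1)"
      using sum_I[of "\<lambda>_. 1" n] by simp
    also have "\<dots> = real (\<Sum>j=1..m. N n j)"
      by (simp add: card_Ij J_def)
    also have "\<dots> = real n"
      using N_sum[of n] by simp
    finally show ?thesis
      by simp
  qed
  have sub_list: "lists_values (subsample X (N n) j \<omega>) (Ij n j) (\<lambda>p. Xp p \<omega>)" for n j \<omega>
    by (simp add: lists_values_def sum_list_subsample sum_Ij Xp_def) (simp add: Ij_def)
  have comb_list: "lists_values (combined_sample X m (N n) \<omega>) (I n) (\<lambda>p. Xp p \<omega>)" for n \<omega>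
    by (simp add: lists_values_def sum_list_combined_sample sum_I sum_Ij Xp_def I_fin) (simp add: J_def)

  \<comment> \<open>Limiting proportions and the bias on each machine\<close>
  have Kp: "K n j > 0" if "j \<in> J" for n j
    using K_pos[of j n] that by (simp add: J_def)
  have kp: "k n > 0" for n
    unfolding k_def J_def[symmetric] using J Kp by (intro sum_pos) auto
  obtain p where p: "\<And>j. j \<in> J \<Longrightarrow> p j > 0" "(\<Sum>j\<in>J. p j) = 1"
    and p_lim': "\<And>j. j \<in> J \<Longrightarrow> (\<lambda>n. real (K n j) / (\<Sum>j\<in>J. real (K n j))) \<longlonglongrightarrow> p j"
    by (rule fractions_tendsto[OF J, of c "\<lambda>n j. real (K n j)"]) (use c in \<open>auto simp: J_def\<close>)
  have p_lim: "(\<lambda>n. real (K n j) / real (k n)) \<longlonglongrightarrow> p j" if "j \<in> J" for j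
    using p_lim'[OF that] by (simp add: k_def J_def)
  obtain q where q: "\<And>j. j \<in> J \<Longrightarrow> q j > 0" "(\<Sum>j\<in>J. q j) = 1"
    and q_lim': "\<And>j. j \<in> J \<Longrightarrow> (\<lambda>n. real (N n j) / (\<Sum>j\<in>J. real (N n j))) \<longlonglongrightarrow> q j"
    by (rule fractions_tendsto[OF J, of b "\<lambda>n j. real (N n j)"]) (use b in \<open>auto simp: J_def\<close>)
  have q_lim: "(\<lambda>n. real (N n j) / real n) \<longlonglongrightarrow> q j" if "j \<in> J" for j
  proof -
    have "(\<Sum>j\<in>J. real (N n j)) = real n" for n
      using arg_cong[OF N_sum[of n], of real] by (simp add: J_def)
    then show ?thesis
      using q_lim'[OF that] by simp
  qed
  define t where "t n = real n / real (k n)" for n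
  have t_top: "filterlim t at_top sequentially"
  proof -
    have "\<forall>\<^sub>F n in sequentially. 0 < real (k n) / real n"
      using eventually_gt_at_top[of 0] by eventually_elim (use kp in simp)
    with k_over_n have "filterlim (\<lambda>n. inverse (real (k n) / real n)) at_top sequentially"
      by (rule filterlim_inverse_at_top)
    then show ?thesis
      by (simp add: t_def[abs_def])
  qed
  have k_real: "filterlim (\<lambda>n. real (k n)) at_top sequentially"
    using filterlim_compose[OF filterlim_real_sequentially k_top] .
  have K_top: "filterlim (\<lambda>n. K n j) at_top sequentially" if j: "j \<in> J" for j
  proof -
    have "filterlim (\<lambda>n. real (K n j) / real (k n) * real (k n)) at_top sequentially"
      by (rule filterlim_tendsto_pos_mult_at_top[OF p_lim[OF j] p(1)[OF j] k_real])
    then have "filterlim (\<lambda>n. real (K n j)) at_top sequentially"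
      using kp by simp
    then show ?thesis
      by (simp add: filterlim_sequentially_iff_filterlim_real)
  qed
  \<comment> \<open>The ratio of \<open>n_j / k_j\<close> to \<open>n / k\<close>; its logarithm is
    the distance between the threshold of machine \<open>j\<close> and the common one.\<close>
  define y where "y j n = (real (N n j) / real n) / (real (K n j) / real (k n))" for j n
  have y_lim: "y j \<longlonglongrightarrow> q j / p j" if "j \<in> J" for j
    unfolding y_def[abs_def] using p(1)[OF that] by (intro tendsto_divide p_lim q_lim that) auto
  have ty: "real (N n j) / real (K n j) = t n * y j n" if "j \<in> J" "n > 0" for j n
    using Kp[OF that(1), of n] kp[of n] that(2) by (simp add: t_def y_def)
  have N_over_K: "filterlim (\<lambda>n. real (card (Ij n j)) / real (K n j)) at_top sequentially" if j: "j \<in> J" for j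
  proof -
    have top: "filterlim (\<lambda>n. y j n * t n) at_top sequentially"
      by (rule filterlim_tendsto_pos_mult_at_top[OF y_lim[OF j] _ t_top]) (use p q j in auto)
    have "\<forall>\<^sub>F n in sequentially. y j n * t n = real (card (Ij n j)) / real (K n j)"
      using eventually_gt_at_top[of 0] by eventually_elim (use ty[OF j] in \<open>simp add: card_Ij mult.commute\<close>)
    from filterlim_cong[OF refl refl this] top show ?thesis
      by (rule iffD1)
  qed
  \<comment> \<open>Regular variation of \<open>A\<close> with index \<open>\<rho>\<close> produces
    the factor \<open>(q j / p j) powr \<rho>\<close>, and the smaller normalization
    \<open>sqrt k_j\<close> the factor \<open>sqrt (p j)\<close>.\<close>
  have bias_j: "(\<lambda>n. sqrt (real (K n j)) * A (real (card (Ij n j)) / real (K n j)))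
      \<longlonglongrightarrow> sqrt (p j) * lam * (q j / p j) powr \<rho>" if j: "j \<in> J" for j
  proof -
    have "(\<lambda>n. sqrt (real (K n j) / real (k n)) * (sqrt (real (k n)) * A (t n)) * (A (t n * y j n) / A (t n)))
        \<longlonglongrightarrow> sqrt (p j) * lam * (q j / p j) powr \<rho>"
      by (intro tendsto_mult tendsto_real_sqrt p_lim j bias[folded t_def] auxiliary_ratio t_top y_lim)
         (use p q j in auto)
    then show ?thesis
    proof (rule Lim_transform_eventually)
      show "\<forall>\<^sub>F n in sequentially. sqrt (real (K n j) / real (k n)) * (sqrt (real (k n)) * A (t n)) * (A (t n * y j n) / A (t n))
          = sqrt (real (K n j)) * A (real (card (Ij n j)) / real (K n j))"
        using eventually_gt_at_top[of 0] eventually_compose_filterlim[OF A_nz t_top]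
      proof eventually_elim
        case (elim n)
        then show ?case
          using ty[OF j elim(1)] kp[of n] by (simp add: card_Ij real_sqrt_divide)
      qed
    qed
  qed

  \<comment> \<open>Linearization of the pooled estimator\<close>
  define u where "u n p = ln (real (N n (snd p)) / real (K n (snd p)))" for n and p :: "nat \<times> nat"
  let ?g = "excess (\<lambda>s. s - 1)"
  define D where "D j p = sqrt (real (K (fst p) j)) * (hill (subsample X (N (fst p)) j (snd p)) (K (fst p) j) - \<gamma>)
      - \<gamma> * (\<Sum>i\<in>Ij (fst p) j. ?g (u (fst p) i) (W i (snd p))) / sqrt (real (K (fst p) j))" for j p
  have D_lim: "(D j \<longlongrightarrow> sqrt (p j) * lam * (q j / p j) powr \<rho> / (1 - \<rho>)) (whp M)" if j: "j \<in> J" for j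
  proof -
    have u_eq: "(\<Sum>i\<in>Ij n j. ?g (ln (real (card (Ij n j)) / real (K n j))) (W i \<omega>)) = (\<Sum>i\<in>Ij n j. ?g (u n i) (W i \<omega>))" for n \<omega>
      unfolding card_Ij by (intro sum.cong) (auto simp: u_def Ij_def)
    show ?thesis
      using hill_linearization[OF Ij_sub[OF j] sub_list K_top[OF j] N_over_K[OF j] bias_j[OF j]]
      unfolding D_def[abs_def] u_eq .
  qed
  define Y where "Y n \<omega> = sqrt (real (k n)) * (pooled_hill X m (N n) (K n) (w n) \<omega> - \<gamma>)" for n \<omega>
  define Z where "Z n \<omega> = (\<Sum>i\<in>I n. 1 / sqrt (real (k n)) * ?g (u n i) (W i \<omega>))" for n \<omega>
  define \<mu> where "\<mu> = lam / (1 - \<rho>) * (\<Sum>j\<in>J. p j * (q j / p j) powr \<rho>)"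
  have YZ: "((\<lambda>p. Y (fst p) (snd p) - \<gamma> * Z (fst p) (snd p)) \<longlongrightarrow> \<mu>) (whp M)"
  proof -
    \<comment> \<open>With the weights \<open>k_j / k\<close>, machine \<open>j\<close> enters with
      \<open>k_j / sqrt k = sqrt (k_j / k) * sqrt k_j\<close>. Hence all observations enter
      \<open>Z\<close> with the same factor \<open>1 / sqrt k\<close>, and the bias acquires a
      second factor \<open>sqrt (p j)\<close>.\<close>
    have "((\<lambda>x. \<Sum>j\<in>J. sqrt (real (K (fst x) j) / real (k (fst x))) * D j x)
        \<longlongrightarrow> (\<Sum>j\<in>J. sqrt (p j) * (sqrt (p j) * lam * (q j / p j) powr \<rho> / (1 - \<rho>)))) (whp M)"
      by (intro tendsto_sum tendsto_mult tendsto_real_sqrt D_lim tendsto_whp_fst[OF p_lim])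
    also have "(\<Sum>j\<in>J. sqrt (p j) * (sqrt (p j) * lam * (q j / p j) powr \<rho> / (1 - \<rho>))) = \<mu>"
      unfolding \<mu>_def sum_distrib_left
    proof (rule sum.cong)
      fix j assume "j \<in> J"
      then have "sqrt (p j) * sqrt (p j) = p j"
        using p(1)[of j] by simp
      then show "sqrt (p j) * (sqrt (p j) * lam * (q j / p j) powr \<rho> / (1 - \<rho>)) = lam / (1 - \<rho>) * (p j * (q j / p j) powr \<rho>)"
        by (simp add: mult.assoc[symmetric])
    qed simp
    also have "(\<lambda>x. \<Sum>j\<in>J. sqrt (real (K (fst x) j) / real (k (fst x))) * D j x)
        = (\<lambda>x. Y (fst x) (snd x) - \<gamma> * Z (fst x) (snd x))"
    proof
      fix x :: "nat \<times> 'a"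
      obtain n \<omega> where x: "x = (n, \<omega>)"
        by (cases x)
      let ?s = "sqrt (real (k n))"
      have s: "?s > 0" "?s * ?s = real (k n)"
        using kp[of n] by auto
      have D_eq: "sqrt (real (K n j) / real (k n)) * D j x
          = (real (K n j) * (hill (subsample X (N n) j \<omega>) (K n j) - \<gamma>) - \<gamma> * (\<Sum>i\<in>Ij n j. ?g (u n i) (W i \<omega>))) / ?s"
        if j: "j \<in> J" for j
      proof -
        have r: "sqrt (real (K n j)) > 0" "sqrt (real (K n j)) * sqrt (real (K n j)) = real (K n j)"
          using Kp[OF j, of n] by auto
        have scale: "x / ?s * (x * h - g / x) = (x * x * h - g) / ?s" if "x > 0" for x h g :: real
        proof -
          have "x * (x * h - g / x) = x * x * h - g"
            using that by (simp add: right_diff_distrib)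
          then show ?thesis
            by (simp only: times_divide_eq_left)
        qed
        show ?thesis
          using scale[OF r(1)] unfolding D_def x fst_conv snd_conv real_sqrt_divide r(2) .
      qed
      have "(\<Sum>j\<in>J. sqrt (real (K (fst x) j) / real (k (fst x))) * D j x)
          = (\<Sum>j\<in>J. (real (K n j) * (hill (subsample X (N n) j \<omega>) (K n j) - \<gamma>) - \<gamma> * (\<Sum>i\<in>Ij n j. ?g (u n i) (W i \<omega>))) / ?s)"
        by (rule sum.cong[OF refl]) (simp only: x fst_conv D_eq[unfolded x])
      also have "\<dots> = (\<Sum>j\<in>J. real (K n j) * (hill (subsample X (N n) j \<omega>) (K n j) - \<gamma>)) / ?s - \<gamma> * Z n \<omega>"
      proof -
        have "Z n \<omega> = (\<Sum>j\<in>J. \<Sum>i\<in>Ij n j. ?g (u n i) (W i \<omega>)) / ?s"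
          unfolding Z_def sum_I by (simp add: sum_divide_distrib)
        then show ?thesis
          by (simp only: sum_divide_distrib[symmetric] sum_subtractf sum_distrib_left[symmetric]
              diff_divide_distrib times_divide_eq_right)
      qed
      also have "(\<Sum>j\<in>J. real (K n j) * (hill (subsample X (N n) j \<omega>) (K n j) - \<gamma>)) / ?s = Y n \<omega>"
      proof -
        have kJ: "real (k n) = (\<Sum>j\<in>J. real (K n j))"
          by (simp add: k_def J_def)
        have "pooled_hill X m (N n) (K n) (w n) \<omega> = (\<Sum>j\<in>J. real (K n j) * hill (subsample X (N n) j \<omega>) (K n j)) / real (k n)"
          by (simp add: pooled_hill_def w_def J_def sum_divide_distrib)
        moreover have "(\<Sum>j\<in>J. real (K n j) * (hill (subsample X (N n) j \<omega>) (K n j) - \<gamma>))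
            = (\<Sum>j\<in>J. real (K n j) * hill (subsample X (N n) j \<omega>) (K n j)) - real (k n) * \<gamma>"
          by (simp only: right_diff_distrib sum_subtractf sum_distrib_right[symmetric] kJ[symmetric])
        ultimately have "pooled_hill X m (N n) (K n) (w n) \<omega> - \<gamma>
            = (\<Sum>j\<in>J. real (K n j) * (hill (subsample X (N n) j \<omega>) (K n j) - \<gamma>)) / real (k n)"
          using kp[of n] by (simp add: diff_divide_distrib)
        moreover have "?s * (x / real (k n)) = x / ?s" for x
        proof -
          have "r * (x / (r * r)) = x / r" if "r > 0" for r :: real
            using that by simp
          from this[OF s(1)] show ?thesis
            unfolding s(2) .
        qed
        ultimately show ?thesis
          unfolding Y_def by simp
      qed
      finally show "(\<Sum>j\<in>J. sqrt (real (K (fst x) j) / real (k (fst x))) * D j x) = Y (fst x) (snd x) - \<gamma> * Z (fst x) (snd x)"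
        by (simp add: x)
    qed
    finally show ?thesis .
  qed

  \<comment> \<open>The weak limit and its mean\<close>
  have K_less_N: "\<forall>\<^sub>F n in sequentially. \<forall>j\<in>J. K n j < N n j"
  proof (intro eventually_ball_finite J ballI)
    fix j assume j: "j \<in> J"
    have "\<forall>\<^sub>F n in sequentially. 1 < real (card (Ij n j)) / real (K n j)"
      using N_over_K[OF j] by (simp add: filterlim_at_top_dense)
    then show "\<forall>\<^sub>F n in sequentially. K n j < N n j"
      by eventually_elim (use Kp[OF j] in \<open>simp add: card_Ij less_divide_eq\<close>)
  qed
  have total: "\<forall>\<^sub>F n in sequentially. (\<Sum>i\<in>I n. exp (- u n i)) = real (k n)"
    using K_less_N
  proof eventually_elim
    case (elim n)
    have "(\<Sum>i\<in>Ij n j. exp (- u n i)) = real (K n j)" if j: "j \<in> J" for j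
    proof -
      have "exp (- u n i) = real (K n j) / real (N n j)" if "i \<in> Ij n j" for i
        using that elim j Kp[OF j, of n] by (auto simp: u_def Ij_def exp_minus)
      moreover have "N n j > 0"
        using bspec[OF elim j] by simp
      ultimately show ?thesis
        by (simp add: card_Ij)
    qed
    then show ?case
      by (simp add: sum_I k_def J_def)
  qed
  have u_nonneg: "\<forall>\<^sub>F n in sequentially. \<forall>i\<in>I n. u n i \<ge> 0"
    using K_less_N
  proof (eventually_elim, intro ballI)
    fix n i assume *: "\<forall>j\<in>J. K n j < N n j" and "i \<in> I n"
    then have "snd i \<in> J"
      by (auto simp: I_def Ij_def)
    then have "K n (snd i) < N n (snd i)" "K n (snd i) > 0"
      using * Kp by auto
    then show "u n i \<ge> 0"
      by (simp add: u_def)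
  qed
  \<comment> \<open>Measurability is established only when every \<open>K n j < N n j\<close>. The
    finitely many other terms are replaced, so that the continuity theorem for random variables
    applies to the whole sequence.\<close>
  define Y' where "Y' n = (if \<forall>j\<in>J. K n j < N n j then Y n else (\<lambda>_. 0))" for n
  have Y'_eq: "\<forall>\<^sub>F n in sequentially. Y' n = Y n"
    using K_less_N by eventually_elim (simp add: Y'_def)
  have Y'_meas [measurable]: "Y' n \<in> borel_measurable M" for n
  proof (cases "\<forall>j\<in>J. K n j < N n j")
    case True
    have "(\<lambda>\<omega>. hill (subsample X (N n) j \<omega>) (K n j)) \<in> borel_measurable M" if j: "j \<in> J" for j
      using hill_measurable[OF sub_list measurable_X[OF subsetD[OF Ij_sub[OF j]]]] True j
      by (simp add: card_Ij)
    then show ?thesis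
      unfolding Y'_def Y_def[abs_def] pooled_hill_def[abs_def] J_def[symmetric] using True
      by simp
  next
    case False
    show ?thesis
      unfolding Y'_def if_not_P[OF False] by simp
  qed
  have Z_meas [measurable]: "Z n \<in> borel_measurable M" for n
  proof -
    have [measurable]: "i \<in> I n \<Longrightarrow> W i \<in> borel_measurable M" for i
      using I_sub[of n] by (auto intro: measurable_W)
    show ?thesis
      unfolding Z_def[abs_def] by measurable
  qed
  have char_Z: "(\<lambda>n. char (distr M borel (Z n)) s) \<longlonglongrightarrow> complex_of_real (exp (- s\<^sup>2 / 2))" for s
    unfolding Z_def[abs_def] by (rule excess_char_tendsto[OF I_fin I_sub k_top total u_nonneg])
  have "((\<lambda>p. Y' (fst p) (snd p) - \<gamma> * Z (fst p) (snd p)) \<longlongrightarrow> \<mu>) (whp M)"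
  proof (rule Lim_transform_eventually[OF YZ])
    show "\<forall>\<^sub>F p in whp M. Y (fst p) (snd p) - \<gamma> * Z (fst p) (snd p) = Y' (fst p) (snd p) - \<gamma> * Z (fst p) (snd p)"
      using eventually_whp_fst[OF Y'_eq] by eventually_elim simp
  qed
  from Slutsky_normal[OF Y'_meas Z_meas char_Z this \<gamma>]
  have limit: "weak_conv_m (\<lambda>n. distr M borel (Y' n)) (density lborel (normal_density \<mu> \<gamma>))" .
  have real_distr: "real_distribution (distr M borel (Y' n))" for n
    by (rule real_distribution_distr) simp
  have conv_iff: "weak_conv_m (\<lambda>n. distr M borel (Y n)) (density lborel (normal_density (lam / (1 - \<rho>)) \<gamma>))
      \<longleftrightarrow> \<mu> = lam / (1 - \<rho>)"
  proof -
    have "\<forall>\<^sub>F n in sequentially. distr M borel (Y n) = distr M borel (Y' n)"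
      using Y'_eq by eventually_elim simp
    from weak_conv_m_cong_eventually[OF this]
    have "weak_conv_m (\<lambda>n. distr M borel (Y n)) (density lborel (normal_density (lam / (1 - \<rho>)) \<gamma>))
        \<longleftrightarrow> weak_conv_m (\<lambda>n. distr M borel (Y' n)) (density lborel (normal_density (lam / (1 - \<rho>)) \<gamma>))" .
    also have "\<dots> \<longleftrightarrow> \<mu> = lam / (1 - \<rho>)"
    proof
      assume "weak_conv_m (\<lambda>n. distr M borel (Y' n)) (density lborel (normal_density (lam / (1 - \<rho>)) \<gamma>))"
      then show "\<mu> = lam / (1 - \<rho>)"
        by (rule weak_conv_normal_unique[OF real_distr \<gamma> limit])
    next
      assume "\<mu> = lam / (1 - \<rho>)"
      with limit show "weak_conv_m (\<lambda>n. distr M borel (Y' n)) (density lborel (normal_density (lam / (1 - \<rho>)) \<gamma>))"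
        by (simp only:)
    qed
    finally show ?thesis .
  qed
  \<comment> \<open>Here \<open>lam \<noteq> 0\<close> is essential: it allows the common factor
    \<open>lam / (1 - \<rho>)\<close> to be cancelled.\<close>
  also have "\<dots> \<longleftrightarrow> (\<Sum>j\<in>J. p j * (q j / p j) powr \<rho>) = 1"
    using \<open>lam \<noteq> 0\<close> \<rho> by (simp add: \<mu>_def)
  also have "\<dots> \<longleftrightarrow> \<rho> = 0 \<or> (\<forall>j\<in>J. p j = q j)"
    by (rule weighted_powr_sum_eq_1_iff) (use J p q \<rho> in auto)
  finally have main: "weak_conv_m (\<lambda>n. distr M borel (Y n)) (density lborel (normal_density (lam / (1 - \<rho>)) \<gamma>))
      \<longleftrightarrow> \<rho> = 0 \<or> (\<forall>j\<in>J. p j = q j)" .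

  \<comment> \<open>The balance condition on the fractions \<open>k_j / n_j\<close>\<close>
  define R where "R j n = (real (K n j) / real (N n j)) / (real (k n) / real n)" for j n
  have R_lim: "R j \<longlonglongrightarrow> p j / q j" if j: "j \<in> J" for j
  proof -
    have "(\<lambda>n. (real (K n j) / real (k n)) / (real (N n j) / real n)) \<longlonglongrightarrow> p j / q j"
      using q(1)[OF j] by (intro tendsto_divide p_lim q_lim j) auto
    then show ?thesis
      by (simp add: R_def[abs_def] mult.commute)
  qed
  have eq_if: "p j = q j" if j: "j \<in> J" and \<epsilon>: "\<epsilon> \<longlonglongrightarrow> 0"
    and ev: "\<forall>\<^sub>F n in sequentially. real (K n j) / real (N n j) = real (k n) / real n * (1 + \<epsilon> n)" for j \<epsilon>
  proof -
    have "(\<lambda>n. 1 + \<epsilon> n) \<longlonglongrightarrow> 1 + 0"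
      by (intro tendsto_intros \<epsilon>)
    moreover have "\<forall>\<^sub>F n in sequentially. 1 + \<epsilon> n = R j n"
      using ev eventually_gt_at_top[of 0]
    proof eventually_elim
      case (elim n)
      then show ?case
        using kp[of n] by (simp add: R_def)
    qed
    ultimately have "R j \<longlonglongrightarrow> 1 + 0"
      by (rule Lim_transform_eventually)
    then have "p j / q j = 1"
      using LIMSEQ_unique[OF R_lim[OF j]] by simp
    then show ?thesis
      using q(1)[OF j] by simp
  qed
  have little_o: "(\<exists>\<epsilon>. \<epsilon> \<in> o(\<lambda>n. 1 :: real) \<and>
      (\<forall>\<^sub>F n in sequentially. real (K n j) / real (N n j) = real (k n) / real n * (1 + \<epsilon> n))) \<longleftrightarrow> p j = q j"
    if j: "j \<in> J" for j
  proof
    assume "p j = q j"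
    \<comment> \<open>For \<open>n > 0\<close> the relative error is forced to be
      \<open>R j n - 1\<close>.\<close>
    then have "(\<lambda>n. R j n - 1) \<longlonglongrightarrow> 1 - 1"
      using R_lim[OF j] q(1)[OF j] by (intro tendsto_diff tendsto_const) simp
    then have "(\<lambda>n. R j n - 1) \<in> o(\<lambda>n. 1)"
      by (intro smalloI_tendsto) auto
    moreover have "\<forall>\<^sub>F n in sequentially. real (K n j) / real (N n j) = real (k n) / real n * (1 + (R j n - 1))"
      using eventually_gt_at_top[of 0]
    proof eventually_elim
      case (elim n)
      then show ?case
        using kp[of n] by (simp add: R_def)
    qed
    ultimately show "\<exists>\<epsilon>. \<epsilon> \<in> o(\<lambda>n. 1 :: real) \<and>
        (\<forall>\<^sub>F n in sequentially. real (K n j) / real (N n j) = real (k n) / real n * (1 + \<epsilon> n))"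
      by blast
  next
    assume "\<exists>\<epsilon>. \<epsilon> \<in> o(\<lambda>n. 1 :: real) \<and>
        (\<forall>\<^sub>F n in sequentially. real (K n j) / real (N n j) = real (k n) / real n * (1 + \<epsilon> n))"
    then obtain \<epsilon> where "\<epsilon> \<in> o(\<lambda>n. 1 :: real)"
      and ev: "\<forall>\<^sub>F n in sequentially. real (K n j) / real (N n j) = real (k n) / real n * (1 + \<epsilon> n)"
      by blast
    then have "\<epsilon> \<longlonglongrightarrow> 0"
      using smalloD_tendsto[of \<epsilon> sequentially "\<lambda>_. 1"] by simp
    then show "p j = q j"
      using eq_if[OF j _ ev] by blast
  qed

  \<comment> \<open>Comparison with the benchmark Hill estimator\<close>
  have second: "conv_to_0_in_prob (\<lambda>n \<omega>. sqrt (real (k n)) *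
      (pooled_hill X m (N n) (K n) (w n) \<omega> - hill (combined_sample X m (N n) \<omega>) (k n)))"
    if pq: "\<forall>j\<in>J. p j = q j"
  proof (rule conv_to_0_in_probI)
    have \<mu>_eq: "\<mu> = lam / (1 - \<rho>)"
    proof -
      have "(\<Sum>j\<in>J. p j * (q j / p j) powr \<rho>) = 1"
        by (subst weighted_powr_sum_eq_1_iff) (use J p q \<rho> pq in auto)
      then show ?thesis
        by (simp add: \<mu>_def)
    qed
    have comb: "((\<lambda>x. sqrt (real (k (fst x))) * (hill (combined_sample X m (N (fst x)) (snd x)) (k (fst x)) - \<gamma>)
      - \<gamma> * (\<Sum>i\<in>I (fst x). ?g (ln (t (fst x))) (W i (snd x))) / sqrt (real (k (fst x)))) \<longlongrightarrow> lam / (1 - \<rho>)) (whp M)"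
    proof -
      have "filterlim (\<lambda>n. real (card (I n)) / real (k n)) at_top sequentially"
        using t_top by (simp add: card_I t_def[abs_def])
      moreover have "(\<lambda>n. sqrt (real (k n)) * A (real (card (I n)) / real (k n))) \<longlonglongrightarrow> lam"
        using bias by (simp add: card_I)
      ultimately show ?thesis
        using hill_linearization[OF I_sub comb_list k_top] by (simp add: card_I t_def)
    qed
    \<comment> \<open>One bound for all machines on the distance of their thresholds from the common
      \<open>ln (t n)\<close>; it tends to 0 because \<open>q j / p j = 1\<close>.\<close>
    define d where "d n = (\<Sum>j\<in>J. \<bar>ln (y j n)\<bar>)" for n
    have "d \<longlonglongrightarrow> (\<Sum>j\<in>J. \<bar>ln (q j / p j)\<bar>)"
      unfolding d_def[abs_def] by (intro tendsto_sum tendsto_rabs tendsto_ln y_lim) (use p q in \<open>auto simp: less_le\<close>)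
    then have d0: "d \<longlonglongrightarrow> 0"
      using pq p by (simp add: less_le)
    have change: "((\<lambda>x. (\<Sum>i\<in>I (fst x). ?g (u (fst x) i) (W i (snd x)) - ?g (ln (t (fst x))) (W i (snd x)))
        / sqrt (real (k (fst x)))) \<longlongrightarrow> 0) (whp M)"
    proof (rule excess_threshold_change[where v = "\<lambda>n _. ln (t n)", OF I_fin I_sub k_top total _ d0])
      have "\<forall>\<^sub>F n in sequentially. t n \<ge> 1"
        using t_top by (simp add: filterlim_at_top)
      with u_nonneg K_less_N eventually_gt_at_top[of 0]
      show "\<forall>\<^sub>F n in sequentially. \<forall>i\<in>I n. 0 \<le> u n i \<and> 0 \<le> ln (t n) \<and> \<bar>u n i - ln (t n)\<bar> \<le> d n"
      proof (eventually_elim, intro ballI conjI)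
        fix n i assume u: "\<forall>i\<in>I n. 0 \<le> u n i" and KN: "\<forall>j\<in>J. K n j < N n j"
          and n: "0 < n" and t1: "1 \<le> t n" and i: "i \<in> I n"
        show "0 \<le> u n i" "0 \<le> ln (t n)"
          using u i t1 by auto
        have j: "snd i \<in> J"
          using i by (auto simp: I_def Ij_def)
        have "y (snd i) n > 0"
          using KN j Kp[OF j, of n] kp[of n] n by (auto simp: y_def intro!: divide_pos_pos)
        then have "u n i = ln (t n) + ln (y (snd i) n)"
          unfolding u_def ty[OF j n] using t1 by (simp add: ln_mult)
        moreover have "\<bar>ln (y (snd i) n)\<bar> \<le> d n"
          unfolding d_def by (rule member_le_sum[OF j, of "\<lambda>j. \<bar>ln (y j n)\<bar>"]) (use J in auto)
        ultimately show "\<bar>u n i - ln (t n)\<bar> \<le> d n"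
          by simp
      qed
    qed
    \<comment> \<open>The two linearizations have the same bias limit; the third term removes the
      difference of their exponential sums, and what remains is the scaled difference of the
      estimators.\<close>
    have "((\<lambda>x. (Y (fst x) (snd x) - \<gamma> * Z (fst x) (snd x))
        - (sqrt (real (k (fst x))) * (hill (combined_sample X m (N (fst x)) (snd x)) (k (fst x)) - \<gamma>)
          - \<gamma> * (\<Sum>i\<in>I (fst x). ?g (ln (t (fst x))) (W i (snd x))) / sqrt (real (k (fst x))))
        + \<gamma> * ((\<Sum>i\<in>I (fst x). ?g (u (fst x) i) (W i (snd x)) - ?g (ln (t (fst x))) (W i (snd x)))
          / sqrt (real (k (fst x))))) \<longlongrightarrow> \<mu> - lam / (1 - \<rho>) + \<gamma> * 0) (whp M)"
      by (intro tendsto_add tendsto_diff tendsto_mult tendsto_const YZ comb change)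
    then have "((\<lambda>x. (Y (fst x) (snd x) - \<gamma> * Z (fst x) (snd x))
        - (sqrt (real (k (fst x))) * (hill (combined_sample X m (N (fst x)) (snd x)) (k (fst x)) - \<gamma>)
          - \<gamma> * (\<Sum>i\<in>I (fst x). ?g (ln (t (fst x))) (W i (snd x))) / sqrt (real (k (fst x))))
        + \<gamma> * ((\<Sum>i\<in>I (fst x). ?g (u (fst x) i) (W i (snd x)) - ?g (ln (t (fst x))) (W i (snd x)))
          / sqrt (real (k (fst x))))) \<longlongrightarrow> 0) (whp M)"
      unfolding \<mu>_eq by (simp only: diff_self mult_zero_right add_0_right)
    then show "((\<lambda>x. sqrt (real (k (fst x))) * (pooled_hill X m (N (fst x)) (K (fst x)) (w (fst x)) (snd x)
        - hill (combined_sample X m (N (fst x)) (snd x)) (k (fst x)))) \<longlongrightarrow> 0) (whp M)"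
    proof (rule Lim_transform_eventually[OF _ always_eventually], intro allI)
      fix x :: "nat \<times> 'a"
      have Z_eq: "Z (fst x) (snd x) = (\<Sum>i\<in>I (fst x). ?g (u (fst x) i) (W i (snd x))) / sqrt (real (k (fst x)))"
        by (simp add: Z_def sum_divide_distrib)
      have cancel: "(s * (P - \<gamma>) - \<gamma> * (S / s)) - (s * (H - \<gamma>) - \<gamma> * S' / s) + \<gamma> * ((S - S') / s) = s * (P - H)"
        for s P H S S' :: real
        by (simp add: right_diff_distrib diff_divide_distrib)
      show "(Y (fst x) (snd x) - \<gamma> * Z (fst x) (snd x))
        - (sqrt (real (k (fst x))) * (hill (combined_sample X m (N (fst x)) (snd x)) (k (fst x)) - \<gamma>)
          - \<gamma> * (\<Sum>i\<in>I (fst x). ?g (ln (t (fst x))) (W i (snd x))) / sqrt (real (k (fst x))))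
        + \<gamma> * ((\<Sum>i\<in>I (fst x). ?g (u (fst x) i) (W i (snd x)) - ?g (ln (t (fst x))) (W i (snd x)))
          / sqrt (real (k (fst x))))
        = sqrt (real (k (fst x))) * (pooled_hill X m (N (fst x)) (K (fst x)) (w (fst x)) (snd x)
          - hill (combined_sample X m (N (fst x)) (snd x)) (k (fst x)))"
        unfolding sum_subtractf Z_eq Y_def by (rule cancel)
    qed
  qed
  have big_O: "\<forall>j\<in>J. p j = q j" if "\<forall>j\<in>J. \<exists>\<epsilon>. \<epsilon> \<in> O(\<lambda>n. 1 / sqrt (real (k n))) \<and>
      (\<forall>\<^sub>F n in sequentially. real (K n j) / real (N n j) = real (k n) / real n * (1 + \<epsilon> n))"
  proof
    fix j assume j: "j \<in> J"
    then obtain \<epsilon> where O: "\<epsilon> \<in> O(\<lambda>n. 1 / sqrt (real (k n)))"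
      and ev: "\<forall>\<^sub>F n in sequentially. real (K n j) / real (N n j) = real (k n) / real n * (1 + \<epsilon> n)"
      using \<open>\<forall>j\<in>J. _\<close> by blast
    have "(\<lambda>n. 1 / sqrt (real (k n))) \<longlonglongrightarrow> 0"
      by (intro tendsto_divide_0[OF tendsto_const] filterlim_at_top_imp_at_infinity
          filterlim_compose[OF sqrt_at_top k_real])
    then have "(\<lambda>n. 1 / sqrt (real (k n))) \<in> o(\<lambda>_. 1 :: real)"
      by (intro smalloI_tendsto) auto
    with O have "\<epsilon> \<in> o(\<lambda>_. 1 :: real)"
      by (rule landau_o.big_small_trans)
    then have "\<epsilon> \<longlonglongrightarrow> 0"
      using smalloD_tendsto[of \<epsilon> sequentially "\<lambda>_. 1"] by simp
    then show "p j = q j"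
      using eq_if[OF j _ ev] by blast
  qed
  show ?thesis
    using main little_o second big_O unfolding J_def Y_def[abs_def] by (auto simp: J_def[symmetric])
qed

end
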